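(* Let $0\le k\le n$. The following formulas define a (local) action of the braid group $B_{2n}$ on $\overline R^q_{n,k}$ (with coefficients extended to $\mathbb{Z}[q^{1/2},q^{-1/2}]$): for $1\le i\le 2n-1$ and $b\in B_{n,k}$, $$\sigma_i\cdot b=\begin{cases}-q^{3/2}\,b & \text{if } i \text{ and } i+1 \text{ are joined by an undotted arc of } b,\\ q^{-1/2}\,b & \text{if } i,i+1 \text{ are joined by a dotted arc, or lie on two different dotted arcs of } b,\\ q^{-1/2}\,b+q^{1/2}\,b' & \text{otherwise,}\end{cases}$$ where $b'$ is obtained from $b$ by replacing the two arcs ending at $i$ and $i+1$ by an undotted arc $(i,i+1)$ and an arc joining the other two endpoints, the latter being dotted if and only if one of the two original arcs is dotted. Moreover the map $\overline R^q_{n,k}\to S^q_{n,k}$ obtained by restricting $\widetilde\psi_{n,k}$ to $\overline R^q_{n,k}$ and composing with the quotient map $\widetilde S^q_{n,k}\to S^q_{n,k}$ respects the action of $B_{2n}$.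
   Context: A diagram is a crossingless matching of the points $1,\ldots,2n$ on a line (arcs below the line) with exactly $k$ of its arcs dotted (one dot each). Arc $(p,p')$ is nested in arc $(e,e')$ if $e<p<p'<e'$; an arc is outer if it is nested in no arc. $\widetilde R^q_{n,k}$ is the free $\mathbb{Z}[q,q^{-1}]$-module on diagrams, $B_{n,k}$ is the set of diagrams all of whose dots lie on outer arcs, and $\overline R^q_{n,k}\subset\widetilde R^q_{n,k}$ is the span of $B_{n,k}$. Kauffman--Lins space. Fix $2(n+k)$ points on a line; the leftmost $k$ and the rightmost $k$ form the left and right "projectors". $\widetilde S^q_{n,k}$ is the $\mathbb{Z}[q^{1/2},q^{-1/2}]$-module spanned by tangle diagrams below the line (up to regular isotopy) consisting of $n+k$ arcs with the given endpoints and finitely many circles, modulo: (i) a diagram having an arc with both endpoints in one projector is $0$; (ii) a circle equals $-q-q^{-1}$; (iii) a crossing whose over-strand runs from upper left to lower right equals $q^{1/2}$ times the smoothing joining the two upper ends and the two lower ends plus $q^{-1/2}$ times the smoothing joining the two left ends and the two right ends (the other crossing is the 90-degree rotation). $\varphi_{n,k-1}:\widetilde S^q_{n,k-1}\to\widetilde S^q_{n,k}$ adds one new endpoint at the far left (in the left projector) and one at the far right (in the right projector), joined by an arc below everything else. For $k\ge1$, $S^q_{n,k}=\operatorname{coker}\varphi_{n,k-1}$; $S^q_{n,0}=\widetilde S^q_{n,0}$. The braid group $B_{2n}$ acts on $\widetilde S^q_{n,k}$ and on $S^q_{n,k}$: $\sigma_i$ attaches a positive crossing at the $i$-th and $(i+1)$-st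 points (numbered from the first point after the left projector), i.e. acts by $q^{1/2}U_i+q^{-1/2}\mathrm{Id}$ where $U_i$ attaches a cap joining these two points followed by a cup. The map $\widetilde\psi_{n,k}:\widetilde R^q_{n,k}\to\widetilde S^q_{n,k}$. For a diagram $x$, add $k$ points on each side of its $2n$ points, forming the projectors. Keep the undotted arcs. Replace each dotted arc $(p,r)$ by a strand from $p$ to the left projector and a strand from $r$ to the right projector, where the left endpoints $p_1<\cdots<p_k$ of dotted arcs are joined so that $p_j$ goes to the $j$-th point from the right in the left projector, and the right endpoints $r_1<\cdots<r_k$ so that $r_j$ goes to the $j$-th point from the right in the right projector. Crossings are minimal: if a dotted arc is nested in an undotted arc, its left strand passes under and its right strand passes over that undotted arc; otherwise its strands do not meet that undotted arc; strands from nested dotted arcs are disjoint; for unnested dotted arcs the only crossing is that the right strand of the left dotted arc passes over the left strand of the right dotted arc. Finally multiply by $q^{-1/2}$ for each pair of nested dotted arcs. Extend linearly. *)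

theory Defs
  imports
    Complex_Main
    "HOL-Library.Poly_Mapping"
    "HOL-Library.Set_Algebras"
    "HOL-Algebra.Group_Action"
begin

section \<open>Free modules over the Laurent polynomials in the square root of q\<close>

text \<open>
  The group ring of the integers is the ring of Laurent polynomials; its element
  \<open>single j 1\<close>, written \<open>qhalf j\<close> below, is the power \<open>q\<close> to the \<open>j/2\<close>.
  Likewise \<open>'a \<Rightarrow>\<^sub>0 laurent\<close> is the free module with basis \<open>'a\<close>.
\<close>

type_synonym laurent = "int \<Rightarrow>\<^sub>0 int"

definition qhalf :: "int \<Rightarrow> laurent" where
  "qhalf j = Poly_Mapping.single j 1"

definition smul :: "laurent \<Rightarrow> ('a \<Rightarrow>\<^sub>0 laurent) \<Rightarrow> ('a \<Rightarrow>\<^sub>0 laurent)" where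
  "smul c x = Poly_Mapping.map ((*) c) x"

definition basis :: "'a \<Rightarrow> ('a \<Rightarrow>\<^sub>0 laurent)" where
  "basis a = Poly_Mapping.single a 1"

definition lin_ext :: "('a \<Rightarrow> ('b \<Rightarrow>\<^sub>0 laurent)) \<Rightarrow> ('a \<Rightarrow>\<^sub>0 laurent) \<Rightarrow> ('b \<Rightarrow>\<^sub>0 laurent)" where
  "lin_ext f x = (\<Sum>a\<in>Poly_Mapping.keys x. smul (Poly_Mapping.lookup x a) (f a))"

lemma lookup_smul: "Poly_Mapping.lookup (smul c x) a = c * Poly_Mapping.lookup x a"
  by (simp add: smul_def Poly_Mapping.map.rep_eq when_def)

lemma module_smul: "module (smul :: laurent \<Rightarrow> ('a \<Rightarrow>\<^sub>0 laurent) \<Rightarrow> _)"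
  by unfold_locales
    (auto intro!: poly_mapping_eqI simp: lookup_smul lookup_add algebra_simps)

abbreviation lspan :: "('a \<Rightarrow>\<^sub>0 laurent) set \<Rightarrow> ('a \<Rightarrow>\<^sub>0 laurent) set" where
  "lspan \<equiv> module.span smul"


section \<open>Dotted crossingless matchings\<close>

type_synonym arc = "nat \<times> nat"

text \<open>A diagram is the set of all its arcs together with the set of its dotted arcs.\<close>

type_synonym diagram = "arc set \<times> arc set"

definition nested :: "arc \<Rightarrow> arc \<Rightarrow> bool" where
  "nested x y \<longleftrightarrow> fst y < fst x \<and> fst x < snd x \<and> snd x < snd y"

definition ends_at :: "arc \<Rightarrow> nat \<Rightarrow> bool" where
  "ends_at x p \<longleftrightarrow> fst x = p \<or> snd x = p"

definition crossingless_matching :: "nat \<Rightarrow> arc set \<Rightarrow> bool" where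
  "crossingless_matching N A \<longleftrightarrow>
     (\<forall>(a, b)\<in>A. 1 \<le> a \<and> a < b \<and> b \<le> N) \<and>
     (\<forall>p\<in>{1..N}. \<exists>!x. x \<in> A \<and> ends_at x p) \<and>
     \<not> (\<exists>a b c d. (a, b) \<in> A \<and> (c, d) \<in> A \<and> a < c \<and> c < b \<and> b < d)"

definition diagrams :: "nat \<Rightarrow> nat \<Rightarrow> diagram set" where
  "diagrams n k = {(A, D). crossingless_matching (2 * n) A \<and> D \<subseteq> A \<and> card D = k}"

definition outer :: "arc set \<Rightarrow> arc \<Rightarrow> bool" where
  "outer A x \<longleftrightarrow> \<not> (\<exists>y\<in>A. nested x y)"

definition B_diagrams :: "nat \<Rightarrow> nat \<Rightarrow> diagram set" where
  "B_diagrams n k = {(A, D) \<in> diagrams n k. \<forall>x\<in>D. outer A x}"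

definition Rtilde :: "nat \<Rightarrow> nat \<Rightarrow> (diagram \<Rightarrow>\<^sub>0 laurent) set" where
  "Rtilde n k = lspan (basis ` diagrams n k)"

definition Rbar :: "nat \<Rightarrow> nat \<Rightarrow> (diagram \<Rightarrow>\<^sub>0 laurent) set" where
  "Rbar n k = lspan (basis ` B_diagrams n k)"


section \<open>The braid group on N strands\<close>

text \<open>Artin's presentation; the letter \<open>(i, True)\<close> stands for the \<open>i\<close>-th standard generator
  and \<open>(i, False)\<close> for its inverse.\<close>

type_synonym braid_word = "(nat \<times> bool) list"

definition braid_words :: "nat \<Rightarrow> braid_word set" where
  "braid_words N = lists ({1..<N} \<times> UNIV)"

inductive braid_eq :: "nat \<Rightarrow> braid_word \<Rightarrow> braid_word \<Rightarrow> bool" for N where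
  refl: "w \<in> braid_words N \<Longrightarrow> braid_eq N w w"
| sym: "braid_eq N u v \<Longrightarrow> braid_eq N v u"
| trans: "braid_eq N u v \<Longrightarrow> braid_eq N v w \<Longrightarrow> braid_eq N u w"
| cong: "braid_eq N u v \<Longrightarrow> x \<in> braid_words N \<Longrightarrow> y \<in> braid_words N \<Longrightarrow>
    braid_eq N (x @ u @ y) (x @ v @ y)"
| inverse: "i \<in> {1..<N} \<Longrightarrow> braid_eq N [(i, s), (i, \<not> s)] []"
| far: "i \<in> {1..<N} \<Longrightarrow> j \<in> {1..<N} \<Longrightarrow> i + 2 \<le> j \<Longrightarrow>
    braid_eq N [(i, True), (j, True)] [(j, True), (i, True)]"
| braid: "i \<in> {1..<N} \<Longrightarrow> i + 1 \<in> {1..<N} \<Longrightarrow>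
    braid_eq N [(i, True), (i + 1, True), (i, True)] [(i + 1, True), (i, True), (i + 1, True)]"

definition braid_rel :: "nat \<Rightarrow> (braid_word \<times> braid_word) set" where
  "braid_rel N = {(u, v). braid_eq N u v}"

definition braid_group :: "nat \<Rightarrow> braid_word set monoid" where
  "braid_group N =
     \<lparr>carrier = braid_words N // braid_rel N,
      monoid.mult = (\<lambda>X Y. \<Union>u\<in>X. \<Union>v\<in>Y. braid_rel N `` {u @ v}),
      one = braid_rel N `` {[]}\<rparr>"

definition sigma :: "nat \<Rightarrow> nat \<Rightarrow> braid_word set" where
  "sigma N i = braid_rel N `` {[(i, True)]}"


section \<open>The action on matchings with outer dots\<close>

definition arc_at :: "arc set \<Rightarrow> nat \<Rightarrow> arc" where
  "arc_at A p = (THE x. x \<in> A \<and> ends_at x p)"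

definition other_end :: "arc \<Rightarrow> nat \<Rightarrow> nat" where
  "other_end x p = (if fst x = p then snd x else fst x)"

definition reconnect :: "nat \<Rightarrow> diagram \<Rightarrow> diagram" where
  "reconnect i = (\<lambda>(A, D).
     let x = arc_at A i; y = arc_at A (i + 1);
         a = other_end x i; b = other_end y (i + 1);
         z = (min a b, max a b)
     in (A - {x, y} \<union> {(i, i + 1), z},
         D - {x, y} \<union> (if x \<in> D \<or> y \<in> D then {z} else {})))"

definition sigma_formula :: "nat \<Rightarrow> diagram \<Rightarrow> (diagram \<Rightarrow>\<^sub>0 laurent)" where
  "sigma_formula i = (\<lambda>(A, D).
     if (i, i + 1) \<in> A - D then smul (- qhalf 3) (basis (A, D))
     else if (i, i + 1) \<in> D \<or> (\<exists>x\<in>D. \<exists>y\<in>D. x \<noteq> y \<and> ends_at x i \<and> ends_at y (i + 1))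
       then smul (qhalf (- 1)) (basis (A, D))
     else smul (qhalf (- 1)) (basis (A, D)) + smul (qhalf 1) (basis (reconnect i (A, D))))"

definition is_Rbar_action ::
  "nat \<Rightarrow> nat \<Rightarrow> (braid_word set \<Rightarrow> (diagram \<Rightarrow>\<^sub>0 laurent) \<Rightarrow> (diagram \<Rightarrow>\<^sub>0 laurent)) \<Rightarrow> bool" where
  "is_Rbar_action n k \<rho> \<longleftrightarrow>
     group_action (braid_group (2 * n)) (Rbar n k) \<rho> \<and>
     (\<forall>g\<in>carrier (braid_group (2 * n)). \<forall>c. \<forall>x\<in>Rbar n k. \<forall>y\<in>Rbar n k.
        \<rho> g (x + y) = \<rho> g x + \<rho> g y \<and> \<rho> g (smul c x) = smul c (\<rho> g x)) \<and>
     (\<forall>i\<in>{1..<2 * n}. \<forall>b\<in>B_diagrams n k. \<rho> (sigma (2 * n) i) (basis b) = sigma_formula i b)"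


section \<open>Tangle diagrams\<close>

text \<open>
  Tangle diagrams below a line, in Morse position: a diagram is cut by horizontal lines into slices,
  each containing one local minimum (\<open>Cup\<close>), one local maximum (\<open>Cap\<close>) or one crossing.
  The slice \<open>(s, i)\<close> has \<open>i - 1\<close> vertical strands to the left of \<open>s\<close>.  Slices are listed from the
  line downwards, so that consing attaches a slice to the endpoints.
  The over-strand of \<open>Pos\<close> runs from upper left to lower right, that of \<open>Neg\<close> from upper right to
  lower left.
\<close>

datatype shape = Cup | Cap | Pos | Neg

type_synonym tangle = "(shape \<times> nat) list"

fun legs_up :: "shape \<Rightarrow> nat" where
  "legs_up Cup = 2" | "legs_up Cap = 0" | "legs_up Pos = 2" | "legs_up Neg = 2"

fun legs_down :: "shape \<Rightarrow> nat" where
  "legs_down Cup = 0" | "legs_down Cap = 2" | "legs_down Pos = 2" | "legs_down Neg = 2"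

text \<open>\<open>tangle m w\<close>: the word \<open>w\<close> is a tangle diagram with \<open>m\<close> endpoints on the line.\<close>

inductive tangle :: "nat \<Rightarrow> tangle \<Rightarrow> bool" where
  empty: "tangle 0 []"
| slice: "tangle (l + legs_down s + r) w \<Longrightarrow> tangle (l + legs_up s + r) ((s, l + 1) # w)"

text \<open>
  Generators of regular isotopy: the first seven rules generate planar isotopy (exchange of distant
  slices, cancellation of a minimum against a maximum, sliding a strand across an extremum), the
  others are the second and third Reidemeister moves, the remaining versions of which follow.
\<close>

inductive isotopy_move :: "tangle \<Rightarrow> tangle \<Rightarrow> bool" where
  distant: "isotopy_move [(t, i + legs_up s + d), (s, i)] [(s, i), (t, i + legs_down s + d)]"
| zigzag_left: "isotopy_move [(Cap, i), (Cup, i + 1)] []"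
| zigzag_right: "isotopy_move [(Cap, i + 1), (Cup, i)] []"
| cap_over: "isotopy_move [(Cap, i), (Pos, i + 1)] [(Cap, i + 1), (Neg, i)]"
| cap_under: "isotopy_move [(Cap, i), (Neg, i + 1)] [(Cap, i + 1), (Pos, i)]"
| cup_under: "isotopy_move [(Pos, i + 1), (Cup, i)] [(Neg, i), (Cup, i + 1)]"
| cup_over: "isotopy_move [(Neg, i + 1), (Cup, i)] [(Pos, i), (Cup, i + 1)]"
| R2: "isotopy_move [(Pos, i), (Neg, i)] []"
| R2': "isotopy_move [(Neg, i), (Pos, i)] []"
| R3: "isotopy_move [(Pos, i), (Pos, i + 1), (Pos, i)] [(Pos, i + 1), (Pos, i), (Pos, i + 1)]"

text \<open>
  \<open>plain_arc w a b\<close>: the endpoints number \<open>a\<close> and \<open>b\<close> of \<open>w\<close> are joined by an arc that takes part in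
  no crossing.  The strands next to a cup or cap at \<open>i\<close> are renumbered by \<open>bump i\<close>.
\<close>

definition bump :: "nat \<Rightarrow> nat \<Rightarrow> nat" where
  "bump i a = (if a < i then a else a + 2)"

inductive plain_arc :: "tangle \<Rightarrow> nat \<Rightarrow> nat \<Rightarrow> bool" where
  sym: "plain_arc w a b \<Longrightarrow> plain_arc w b a"
| cup_new: "plain_arc ((Cup, i) # w) i (i + 1)"
| cup_old: "plain_arc w a b \<Longrightarrow> plain_arc ((Cup, i) # w) (bump i a) (bump i b)"
| cap_old: "plain_arc w (bump i a) (bump i b) \<Longrightarrow> plain_arc ((Cap, i) # w) a b"
| cap_join: "plain_arc w (bump i a) i \<Longrightarrow> plain_arc w (i + 1) (bump i b) \<Longrightarrow>
    plain_arc ((Cap, i) # w) a b"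
| pos: "plain_arc w a b \<Longrightarrow> {a, b} \<inter> {i, i + 1} = {} \<Longrightarrow> plain_arc ((Pos, i) # w) a b"
| neg: "plain_arc w a b \<Longrightarrow> {a, b} \<inter> {i, i + 1} = {} \<Longrightarrow> plain_arc ((Neg, i) # w) a b"


section \<open>The Kauffman--Lins spaces\<close>

text \<open>
  The endpoints are numbered \<open>1, \<dots>, 2(n+k)\<close> from left to right.  All spaces are quotients of the free
  module \<open>tangle_span n k\<close>, and their elements are cosets.

  As for circles, where the circle must bear no crossing, an arc returning to a projector kills the
  diagram only if it bears no crossing.  Arcs with crossings cannot be allowed: an arc returning
  to a projector and clasped with a second strand, expanded by the crossing relation, would make
  \<open>1 - q\<^sup>2\<close> annihilate the crossingless diagram in which the clasp is smoothed.
\<close>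

definition tangle_span :: "nat \<Rightarrow> nat \<Rightarrow> (tangle \<Rightarrow>\<^sub>0 laurent) set" where
  "tangle_span n k = lspan (basis ` {w. tangle (2 * (n + k)) w})"

definition left_projector :: "nat \<Rightarrow> nat \<Rightarrow> nat set" where
  "left_projector n k = {1..k}"

definition right_projector :: "nat \<Rightarrow> nat \<Rightarrow> nat set" where
  "right_projector n k = {k + 2 * n + 1..2 * (n + k)}"

inductive_set skein_relations :: "nat \<Rightarrow> nat \<Rightarrow> (tangle \<Rightarrow>\<^sub>0 laurent) set" for n k where
  isotopy: "isotopy_move v v' \<Longrightarrow> tangle (2 * (n + k)) (u @ v @ w) \<Longrightarrow>
    tangle (2 * (n + k)) (u @ v' @ w) \<Longrightarrow>
    basis (u @ v @ w) - basis (u @ v' @ w) \<in> skein_relations n k"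
| projector: "tangle (2 * (n + k)) w \<Longrightarrow> plain_arc w a b \<Longrightarrow>
    {a, b} \<subseteq> left_projector n k \<or> {a, b} \<subseteq> right_projector n k \<Longrightarrow>
    basis w \<in> skein_relations n k"
| circle: "tangle (2 * (n + k)) (u @ [(Cap, i), (Cup, i)] @ w) \<Longrightarrow>
    basis (u @ [(Cap, i), (Cup, i)] @ w) - smul (- qhalf 2 - qhalf (- 2)) (basis (u @ w))
      \<in> skein_relations n k"
| pos_crossing: "tangle (2 * (n + k)) (u @ [(Pos, i)] @ w) \<Longrightarrow>
    basis (u @ [(Pos, i)] @ w) -
      (smul (qhalf 1) (basis (u @ [(Cup, i), (Cap, i)] @ w)) + smul (qhalf (- 1)) (basis (u @ w)))
      \<in> skein_relations n k"
| neg_crossing: "tangle (2 * (n + k)) (u @ [(Neg, i)] @ w) \<Longrightarrow>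
    basis (u @ [(Neg, i)] @ w) -
      (smul (qhalf 1) (basis (u @ w)) + smul (qhalf (- 1)) (basis (u @ [(Cup, i), (Cap, i)] @ w)))
      \<in> skein_relations n k"

definition Stilde_null :: "nat \<Rightarrow> nat \<Rightarrow> (tangle \<Rightarrow>\<^sub>0 laurent) set" where
  "Stilde_null n k = lspan (skein_relations n k)"

definition Stilde_space :: "nat \<Rightarrow> nat \<Rightarrow> (tangle \<Rightarrow>\<^sub>0 laurent) set set" where
  "Stilde_space n k = (\<lambda>x. x +o Stilde_null n k) ` tangle_span n k"

text \<open>The map \<open>\<phi>\<close>: the new outermost arc is the lowest slice.\<close>

definition phi_tangle :: "tangle \<Rightarrow> tangle" where
  "phi_tangle w = map (apsnd Suc) w @ [(Cup, 1)]"

definition phi :: "(tangle \<Rightarrow>\<^sub>0 laurent) \<Rightarrow> (tangle \<Rightarrow>\<^sub>0 laurent)" where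
  "phi = lin_ext (\<lambda>w. basis (phi_tangle w))"

text \<open>The vectors whose class in \<open>Stilde_space n k\<close> lies in the image of \<open>\<phi>\<close>, so that the cosets of
  \<open>S_null n k\<close> form the cokernel of \<open>\<phi>\<close>.\<close>

definition S_null :: "nat \<Rightarrow> nat \<Rightarrow> (tangle \<Rightarrow>\<^sub>0 laurent) set" where
  "S_null n k =
     (if k = 0 then Stilde_null n k else phi ` tangle_span n (k - 1) + Stilde_null n k)"

definition S_space :: "nat \<Rightarrow> nat \<Rightarrow> (tangle \<Rightarrow>\<^sub>0 laurent) set set" where
  "S_space n k = (\<lambda>x. x +o S_null n k) ` tangle_span n k"

text \<open>The quotient map from \<open>Stilde_space n k\<close> to \<open>S_space n k\<close>; the sum is the sum of sets.\<close>

definition S_proj :: "nat \<Rightarrow> nat \<Rightarrow> (tangle \<Rightarrow>\<^sub>0 laurent) set \<Rightarrow> (tangle \<Rightarrow>\<^sub>0 laurent) set" where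
  "S_proj n k X = X + S_null n k"

definition attach :: "nat \<Rightarrow> braid_word \<Rightarrow> (tangle \<Rightarrow>\<^sub>0 laurent) \<Rightarrow> (tangle \<Rightarrow>\<^sub>0 laurent)" where
  "attach k \<beta> =
     lin_ext (\<lambda>w. basis (map (\<lambda>(i, s). (if s then Pos else Neg, k + i)) \<beta> @ w))"

text \<open>The result does not depend on the representatives of the braid and of the coset.\<close>

definition S_act ::
  "nat \<Rightarrow> nat \<Rightarrow> braid_word set \<Rightarrow> (tangle \<Rightarrow>\<^sub>0 laurent) set \<Rightarrow> (tangle \<Rightarrow>\<^sub>0 laurent) set" where
  "S_act n k g X = (\<Union>\<beta>\<in>g. \<Union>x\<in>X. attach k \<beta> x +o S_null n k)"


section \<open>The map from dotted matchings to tangles\<close>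

text \<open>
  \<open>draw M\<close> draws the pairs in \<open>M\<close> (with distinct endpoints filling an initial segment of the
  positive numbers) as semicircles, such that of two crossing semicircles the one with the larger
  left endpoint is on top.  They are added by increasing left endpoint: the strand starting at \<open>a\<close>
  is created as a cup at the position of \<open>a\<close> among the endpoints already present, and its right leg
  is pulled to its final position over the endpoints in between.  These all are right endpoints of
  earlier strands, so two strands cross at most once, and only if their endpoints are linked.
\<close>

definition draw_strand :: "arc set \<Rightarrow> nat \<Rightarrow> tangle" where
  "draw_strand M a =
     (let b = (THE b. (a, b) \<in> M);
          P = {p. \<exists>x\<in>M. fst x < a \<and> ends_at x p};
          i = card {p\<in>P. p < a} + 1;
          c = card {p\<in>P. a < p \<and> p < b}
      in map (\<lambda>j. (Neg, i + j)) (rev [1..<c + 1]) @ [(Cup, i)])"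

definition draw :: "arc set \<Rightarrow> tangle" where
  "draw M = concat (map (draw_strand M) (rev (sorted_list_of_set (fst ` M))))"

text \<open>
  The strands replacing the arcs of a diagram, the point \<open>p\<close> having become number \<open>k + p\<close>.
  Drawing them by the rule above yields the prescribed crossings: a left strand starts in the
  left projector, hence is below all undotted arcs and right strands that it meets; a right strand
  meets an undotted arc only from inside, hence starts to the right of the left end of that arc and
  is above it.
\<close>

definition strands :: "nat \<Rightarrow> nat \<Rightarrow> diagram \<Rightarrow> arc set" where
  "strands n k = (\<lambda>(A, D).
     let ps = sorted_list_of_set (fst ` D); rs = sorted_list_of_set (snd ` D)
     in (\<lambda>(a, b). (k + a, k + b)) ` (A - D) \<union>
        {(k - j, k + ps ! j) | j. j < k} \<union>
        {(k + rs ! j, 2 * (n + k) - j) | j. j < k})"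

definition psi_diagram :: "nat \<Rightarrow> nat \<Rightarrow> diagram \<Rightarrow> (tangle \<Rightarrow>\<^sub>0 laurent)" where
  "psi_diagram n k d =
     smul (qhalf (- int (card {(x, y). x \<in> snd d \<and> y \<in> snd d \<and> nested x y})))
       (basis (draw (strands n k d)))"

definition psi_tilde :: "nat \<Rightarrow> nat \<Rightarrow> (diagram \<Rightarrow>\<^sub>0 laurent) \<Rightarrow> (tangle \<Rightarrow>\<^sub>0 laurent) set" where
  "psi_tilde n k x = lin_ext (psi_diagram n k) x +o Stilde_null n k"

end

theory Submission
  imports Defs
begin

text \<open>
  On both sides \<open>\<sigma>\<^sub>i\<close> acts as \<open>q\<^bsup>-1/2\<^esup> + q\<^bsup>1/2\<^esup> U\<^sub>i\<close> with \<open>U\<^sub>i\<close> a Temperley--Lieb generator, so everything is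
  about the operators \<open>U\<^sub>i\<close>.

  For the action, a diagram in \<open>B\<^sub>n\<^sub>,\<^sub>k\<close> is determined by the function sending a point to its partner
  along an undotted arc, or to \<open>0\<close> if its arc is dotted: the outer dotted arcs must join consecutive points
  among the remaining ones.  On these functions the relations between the \<open>U\<^sub>i\<close> are pointwise identities
  that need no planarity.

  Equivariance is proved by induction on \<open>n\<close>.  An undotted arc joining the neighbours \<open>j\<close> and \<open>j + 1\<close>
  can be pulled to the top of the drawing as a minimum, where \<open>U\<^sub>i\<close> cancels it, closes it to a circle
  or passes it.  If there is no such arc, then all arcs are dotted and \<open>n = k\<close>; the maximum in \<open>U\<^sub>i\<close> then leaves
  \<open>2 * (n - 1)\<close> points between projectors with \<open>2 * k\<close> points, and every crossingless diagram with fewer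
  points in the middle than in the projectors has a returning arc or an outermost arc, hence vanishes in
  the cokernel.  In particular the crossings of the drawing never have to be resolved.
\<close>

section \<open>Linear extension\<close>

text \<open>Each U_i factors through the space with one arc less: the maximum leads from n to n - 1,
  the minimum back. Attaching a slice to the middle points carries null vectors to null vectors even
  when it changes n, so a vector that vanishes for n - 1 gives zero for n. This is also where the
  cokernel enters: when all arcs are dotted, U_i is 0 on matchings, and the corresponding tangles
  are killed only together with the image of \<open>phi\<close>. On the side of matchings the
  obstacle is that a reconnection might destroy planarity or outerness. Closure is obtained from the
  same peeling induction as equivariance, not from a geometric case analysis; the relations between
  the U_i can then be checked on partner functions, because diagrams with outer dots are recovered
  from them. Equivariance is claimed for every linear action with the prescribed generators, so an
  inverse letter is known only as an inverse. It is handled by the second Reidemeister move instead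
  of a formula.\<close>

interpretation lmod: module "smul :: laurent \<Rightarrow> ('a \<Rightarrow>\<^sub>0 laurent) \<Rightarrow> _"
  by (rule module_smul)

abbreviation lsubspace :: "('a \<Rightarrow>\<^sub>0 laurent) set \<Rightarrow> bool" where
  "lsubspace \<equiv> module.subspace smul"

lemma lin_ext_superset:
  assumes "finite S" "Poly_Mapping.keys x \<subseteq> S"
  shows "lin_ext f x = (\<Sum>a\<in>S. smul (Poly_Mapping.lookup x a) (f a))"
  unfolding lin_ext_def using assms
  by (intro sum.mono_neutral_left) (auto simp: in_keys_iff)

lemma lin_ext_add: "lin_ext f (x + y) = lin_ext f x + lin_ext f y"
proof -
  let ?S = "Poly_Mapping.keys x \<union> Poly_Mapping.keys y"
  have "lin_ext f z = (\<Sum>a\<in>?S. smul (Poly_Mapping.lookup z a) (f a))"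
    if "z \<in> {x, y, x + y}" for z
    using that by (intro lin_ext_superset) (use keys_add[of x y] in auto)
  then show ?thesis
    by (simp add: lookup_add lmod.scale_left_distrib sum.distrib)
qed

lemma lin_ext_smul: "lin_ext f (smul c x) = smul c (lin_ext f x)"
proof -
  have "lin_ext f (smul c x) = (\<Sum>a\<in>Poly_Mapping.keys x. smul (Poly_Mapping.lookup (smul c x) a) (f a))"
    by (intro lin_ext_superset) (auto simp: in_keys_iff lookup_smul)
  then show ?thesis
    by (simp add: lin_ext_def lookup_smul lmod.scale_sum_right)
qed

lemma lin_ext_zero [simp]: "lin_ext f 0 = 0"
  by (simp add: lin_ext_def)

lemma lin_ext_minus: "lin_ext f (- x) = - lin_ext f x"
  using lin_ext_smul[of f "- 1" x] by simp

lemma lin_ext_diff: "lin_ext f (x - y) = lin_ext f x - lin_ext f y"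
  using lin_ext_add[of f x "- y"] by (simp add: lin_ext_minus)

lemma lin_ext_basis [simp]: "lin_ext f (basis a) = f a"
  by (simp add: lin_ext_def basis_def)

lemma subspace_vimage_lin_ext:
  assumes "lsubspace N"
  shows "lsubspace {x. lin_ext f x \<in> N}"
  using assms by (auto simp: lmod.subspace_def lin_ext_add lin_ext_smul)

text \<open>The vectors sent into a subspace form a subspace, so it suffices to look at spanning
  vectors. Stability of the various spans and null spaces under linearly extended maps is checked in
  this way.\<close>

lemma lin_ext_span:
  assumes "lsubspace N" "\<And>x. x \<in> X \<Longrightarrow> lin_ext f x \<in> N" "x \<in> lspan X"
  shows "lin_ext f x \<in> N"
  using lmod.span_minimal[OF _ subspace_vimage_lin_ext[OF assms(1), of f], of X] assms by auto

lemma qhalf_mult: "qhalf i * qhalf j = qhalf (i + j)"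
  by (simp add: qhalf_def mult_single)

lemma qhalf_0 [simp]: "qhalf 0 = 1"
  by (simp add: qhalf_def)

text \<open>Quotients are handled through representatives: identities of cosets become chains of
  congruences, and cosets return only in the final theorem.\<close>

definition mod_eq :: "('a \<Rightarrow>\<^sub>0 laurent) set \<Rightarrow> ('a \<Rightarrow>\<^sub>0 laurent) \<Rightarrow> ('a \<Rightarrow>\<^sub>0 laurent) \<Rightarrow> bool" where
  "mod_eq N x y \<longleftrightarrow> x - y \<in> N"

context
  fixes N :: "('a \<Rightarrow>\<^sub>0 laurent) set"
  assumes N: "lsubspace N"
begin

lemma mod_eq_refl: "mod_eq N x x"
  using N by (simp add: mod_eq_def lmod.subspace_0)

lemma mod_eq_sym: "mod_eq N x y \<Longrightarrow> mod_eq N y x"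
  using lmod.subspace_neg[OF N, of "x - y"] by (simp add: mod_eq_def)

lemma mod_eq_trans: "mod_eq N x y \<Longrightarrow> mod_eq N y z \<Longrightarrow> mod_eq N x z"
  using lmod.subspace_add[OF N, of "x - y" "y - z"] by (simp add: mod_eq_def)

lemma mod_eq_add: "mod_eq N x y \<Longrightarrow> mod_eq N x' y' \<Longrightarrow> mod_eq N (x + x') (y + y')"
  using lmod.subspace_add[OF N, of "x - y" "x' - y'"] by (simp add: mod_eq_def algebra_simps)

lemma mod_eq_smul: "mod_eq N x y \<Longrightarrow> mod_eq N (smul c x) (smul c y)"
  using lmod.subspace_scale[OF N, of "x - y" c] by (simp add: mod_eq_def lmod.scale_right_diff_distrib)

lemma mod_eq_coset: "mod_eq N x y \<Longrightarrow> x +o N = y +o N"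
proof -
  have "x +o N \<subseteq> y +o N" if "mod_eq N x y" for x y
  proof
    fix z assume "z \<in> x +o N"
    then obtain s where s: "s \<in> N" "z = x + s" by (auto simp: elt_set_plus_def)
    have "z = y + ((x - y) + s)" by (simp add: s)
    moreover have "(x - y) + s \<in> N"
      using that s N by (auto simp: mod_eq_def intro: lmod.subspace_add)
    ultimately show "z \<in> y +o N" unfolding elt_set_plus_def by blast
  qed
  then show "mod_eq N x y \<Longrightarrow> x +o N = y +o N" using mod_eq_sym by blast
qed

end

lemma mod_eq_mono: "mod_eq N x y \<Longrightarrow> N \<subseteq> N' \<Longrightarrow> mod_eq N' x y"
  by (auto simp: mod_eq_def)

section \<open>The braid group\<close>

lemma braid_eq_words: "braid_eq N u v \<Longrightarrow> u \<in> braid_words N \<and> v \<in> braid_words N"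
  by (induction rule: braid_eq.induct) (auto simp: braid_words_def)

lemma equiv_braid_rel: "equiv (braid_words N) (braid_rel N)"
  by (auto intro!: equivI refl_onI symI transI simp: braid_rel_def
      intro: braid_eq.refl braid_eq.sym braid_eq.trans dest: braid_eq_words)

lemma braid_eq_append:
  assumes "braid_eq N u u'" "braid_eq N v v'"
  shows "braid_eq N (u @ v) (u' @ v')"
proof (rule braid_eq.trans)
  show "braid_eq N (u @ v) (u' @ v)"
    using braid_eq.cong[OF assms(1), of "[]" v] braid_eq_words[OF assms(2)] by (simp add: braid_words_def)
  show "braid_eq N (u' @ v) (u' @ v')"
    using braid_eq.cong[OF assms(2), of u' "[]"] braid_eq_words[OF assms(1)] by (simp add: braid_words_def)
qed

abbreviation braid_class :: "nat \<Rightarrow> braid_word \<Rightarrow> braid_word set" where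
  "braid_class N w \<equiv> braid_rel N `` {w}"

lemma braid_class_eq_iff:
  "u \<in> braid_words N \<Longrightarrow> v \<in> braid_words N \<Longrightarrow> braid_class N u = braid_class N v \<longleftrightarrow> braid_eq N u v"
  using eq_equiv_class_iff[OF equiv_braid_rel] by (fastforce simp: braid_rel_def)

lemma mem_braid_class: "v \<in> braid_class N u \<longleftrightarrow> braid_eq N u v"
  by (simp add: braid_rel_def)

lemma carrier_braid_groupE:
  assumes "g \<in> carrier (braid_group N)"
  obtains w where "w \<in> braid_words N" "g = braid_class N w"
  using assms by (auto simp: braid_group_def quotient_def)

lemma braid_class_carrier: "w \<in> braid_words N \<Longrightarrow> braid_class N w \<in> carrier (braid_group N)"
  by (auto simp: braid_group_def quotient_def)

text \<open>The union over all representatives collapses to one class because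
  \<open>braid_eq\<close> is compatible with concatenation.\<close>

lemma braid_mult:
  assumes "u \<in> braid_words N" "v \<in> braid_words N"
  shows "braid_class N u \<otimes>\<^bsub>braid_group N\<^esub> braid_class N v = braid_class N (u @ v)"
proof -
  have "braid_class N (u' @ v') = braid_class N (u @ v)"
    if "u' \<in> braid_class N u" "v' \<in> braid_class N v" for u' v'
  proof -
    have "braid_eq N (u @ v) (u' @ v')" using that braid_eq_append unfolding mem_braid_class by blast
    then show ?thesis using braid_class_eq_iff braid_eq_words by metis
  qed
  moreover have "u \<in> braid_class N u" "v \<in> braid_class N v"
    using assms by (auto simp only: mem_braid_class intro: braid_eq.refl)
  ultimately have "(\<Union>u'\<in>braid_class N u. \<Union>v'\<in>braid_class N v. braid_class N (u' @ v')) = braid_class N (u @ v)"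
    by blast
  then show ?thesis by (simp add: braid_group_def)
qed

lemma braid_one: "\<one>\<^bsub>braid_group N\<^esub> = braid_class N []"
  by (simp add: braid_group_def)

definition braid_word_inv :: "braid_word \<Rightarrow> braid_word" where
  "braid_word_inv w = rev (map (\<lambda>(i, s). (i, \<not> s)) w)"

lemma braid_word_inv_words: "w \<in> braid_words N \<Longrightarrow> braid_word_inv w \<in> braid_words N"
  by (auto simp: braid_words_def braid_word_inv_def lists_eq_set)

text \<open>The first letter of \<open>w\<close> and its inverse meet in the middle of the product;
  cancelling them leaves the same claim for a shorter word.\<close>

lemma braid_word_inv_append: "w \<in> braid_words N \<Longrightarrow> braid_eq N (braid_word_inv w @ w) []"
proof (induction w)
  case Nil
  then show ?case by (simp add: braid_word_inv_def braid_eq.refl)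
next
  case (Cons x w)
  obtain i s where x: "x = (i, s)" by (cases x)
  have w: "w \<in> braid_words N" and i: "i \<in> {1..<N}"
    using Cons.prems by (auto simp: braid_words_def x)
  have "braid_eq N (braid_word_inv w @ [(i, \<not> s), (i, \<not> \<not> s)] @ w) (braid_word_inv w @ [] @ w)"
    using braid_eq.cong[OF braid_eq.inverse[OF i] braid_word_inv_words[OF w] w] .
  then show ?case using Cons.IH[OF w] by (auto simp: braid_word_inv_def x intro: braid_eq.trans)
qed

lemma group_braid_group: "group (braid_group N)"
proof (rule groupI)
  show "\<one>\<^bsub>braid_group N\<^esub> \<in> carrier (braid_group N)"
    unfolding braid_one by (rule braid_class_carrier) (simp add: braid_words_def)
next
  fix x y assume "x \<in> carrier (braid_group N)" "y \<in> carrier (braid_group N)"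
  then show "x \<otimes>\<^bsub>braid_group N\<^esub> y \<in> carrier (braid_group N)"
    by (elim carrier_braid_groupE) (simp add: braid_mult, rule braid_class_carrier, simp add: braid_words_def)
next
  fix x y z assume "x \<in> carrier (braid_group N)" "y \<in> carrier (braid_group N)" "z \<in> carrier (braid_group N)"
  then obtain u v w where "u \<in> braid_words N" "v \<in> braid_words N" "w \<in> braid_words N"
    "x = braid_class N u" "y = braid_class N v" "z = braid_class N w"
    by (metis carrier_braid_groupE)
  moreover from this have "u @ v \<in> braid_words N" "v @ w \<in> braid_words N" by (auto simp: braid_words_def)
  ultimately show "x \<otimes>\<^bsub>braid_group N\<^esub> y \<otimes>\<^bsub>braid_group N\<^esub> z = x \<otimes>\<^bsub>braid_group N\<^esub> (y \<otimes>\<^bsub>braid_group N\<^esub> z)"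
    by (simp add: braid_mult)
next
  fix x assume "x \<in> carrier (braid_group N)"
  then show "\<one>\<^bsub>braid_group N\<^esub> \<otimes>\<^bsub>braid_group N\<^esub> x = x"
    unfolding braid_one by (elim carrier_braid_groupE) (simp add: braid_mult braid_words_def)
next
  fix x assume "x \<in> carrier (braid_group N)"
  then obtain w where w: "w \<in> braid_words N" "x = braid_class N w" by (elim carrier_braid_groupE)
  have "braid_class N (braid_word_inv w) \<otimes>\<^bsub>braid_group N\<^esub> x = \<one>\<^bsub>braid_group N\<^esub>"
    using braid_word_inv_append[OF w(1)] braid_word_inv_words[OF w(1)] w braid_eq_words
    by (simp add: braid_mult braid_one braid_class_eq_iff)
  then show "\<exists>y\<in>carrier (braid_group N). y \<otimes>\<^bsub>braid_group N\<^esub> x = \<one>\<^bsub>braid_group N\<^esub>"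
    using braid_class_carrier[OF braid_word_inv_words[OF w(1)]] by blast
qed

section \<open>Dotted matchings\<close>

text \<open>The part of \<open>crossingless_matching\<close> that does not mention planarity. It is
  kept separate because the strands drawn for a dotted diagram may cross and satisfy this part only.
  Expressed by images and injectivity, it transports easily along renumberings.\<close>

definition pairing :: "nat \<Rightarrow> arc set \<Rightarrow> bool" where
  "pairing N A \<longleftrightarrow> (\<forall>x\<in>A. fst x < snd x) \<and> inj_on fst A \<and> inj_on snd A \<and>
     fst ` A \<inter> snd ` A = {} \<and> fst ` A \<union> snd ` A = {1..N}"

definition noncrossing :: "arc set \<Rightarrow> bool" where
  "noncrossing A \<longleftrightarrow> \<not> (\<exists>x\<in>A. \<exists>y\<in>A. fst x < fst y \<and> fst y < snd x \<and> snd x < snd y)"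

lemma pairing_unique:
  "pairing N A \<Longrightarrow> x \<in> A \<Longrightarrow> y \<in> A \<Longrightarrow> ends_at x p \<Longrightarrow> ends_at y p \<Longrightarrow> x = y"
  unfolding pairing_def ends_at_def inj_on_def by (metis IntI empty_iff imageI)

lemma pairing_ex: "pairing N A \<Longrightarrow> 1 \<le> p \<Longrightarrow> p \<le> N \<Longrightarrow> \<exists>x\<in>A. ends_at x p"
proof -
  assume "pairing N A" "1 \<le> p" "p \<le> N"
  then have "p \<in> fst ` A \<union> snd ` A" by (simp add: pairing_def)
  then show ?thesis by (auto simp: ends_at_def)
qed

lemma pairing_range: "pairing N A \<Longrightarrow> x \<in> A \<Longrightarrow> ends_at x p \<Longrightarrow> 1 \<le> p \<and> p \<le> N"
proof -
  assume "pairing N A" "x \<in> A" "ends_at x p"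
  then have "p \<in> fst ` A \<union> snd ` A" "fst ` A \<union> snd ` A = {1..N}"
    by (auto simp: ends_at_def pairing_def)
  then show ?thesis by auto
qed

lemma pairing_less: "pairing N A \<Longrightarrow> x \<in> A \<Longrightarrow> fst x < snd x"
  by (simp add: pairing_def)

lemma pairing_finite: "pairing N A \<Longrightarrow> finite A"
  by (metis finite_Un finite_atLeastAtMost finite_imageD pairing_def)

lemma crossingless_matching_iff: "crossingless_matching N A \<longleftrightarrow> pairing N A \<and> noncrossing A"
proof
  assume c: "crossingless_matching N A"
  then have less: "1 \<le> fst x \<and> fst x < snd x \<and> snd x \<le> N" if "x \<in> A" for x
    using that by (auto simp: crossingless_matching_def)
  have unique: "x = y" if "x \<in> A" "y \<in> A" "ends_at x p" "ends_at y p" for x y p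
  proof -
    have "p \<in> {1..N}" using less[OF that(1)] that(3) by (auto simp: ends_at_def)
    then have "\<exists>!x. x \<in> A \<and> ends_at x p" using c by (simp add: crossingless_matching_def)
    then show ?thesis using that by blast
  qed
  have ex: "\<exists>x\<in>A. ends_at x p" if "p \<in> {1..N}" for p
    using c that by (auto simp: crossingless_matching_def)
  have "pairing N A"
    unfolding pairing_def
  proof (intro conjI)
    show "\<forall>x\<in>A. fst x < snd x" using less by auto
    show "inj_on fst A"
    proof (rule inj_onI)
      fix x y assume "x \<in> A" "y \<in> A" "fst x = fst y"
      then show "x = y" by (intro unique[of x y "fst x"]) (auto simp: ends_at_def)
    qed
    show "inj_on snd A"
    proof (rule inj_onI)
      fix x y assume "x \<in> A" "y \<in> A" "snd x = snd y"
      then show "x = y" by (intro unique[of x y "snd x"]) (auto simp: ends_at_def)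
    qed
    show "fst ` A \<inter> snd ` A = {}"
    proof (intro equals0I)
      fix p assume "p \<in> fst ` A \<inter> snd ` A"
      then obtain x y where "x \<in> A" "y \<in> A" "fst x = p" "snd y = p" by auto
      then have "x = y" by (intro unique[of _ _ p]) (auto simp: ends_at_def)
      then show False using less[of x] \<open>x \<in> A\<close> \<open>fst x = p\<close> \<open>snd y = p\<close> by auto
    qed
    show "fst ` A \<union> snd ` A = {1..N}"
    proof (intro equalityI subsetI)
      fix p assume "p \<in> fst ` A \<union> snd ` A"
      then show "p \<in> {1..N}" by (auto dest!: less)
    next
      fix p assume "p \<in> {1..N}"
      from ex[OF this] show "p \<in> fst ` A \<union> snd ` A" by (auto simp: ends_at_def)
    qed
  qed
  moreover have "\<not> (\<exists>a b c d. (a, b) \<in> A \<and> (c, d) \<in> A \<and> a < c \<and> c < b \<and> b < d)"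
    using c unfolding crossingless_matching_def by (elim conjE)
  then have "noncrossing A" unfolding noncrossing_def by (metis prod.collapse)
  ultimately show "pairing N A \<and> noncrossing A" ..
next
  assume p: "pairing N A \<and> noncrossing A"
  have "1 \<le> a \<and> a < b \<and> b \<le> N" if "(a, b) \<in> A" for a b
    using p that pairing_range[of N A "(a, b)" a] pairing_range[of N A "(a, b)" b] pairing_less[of N A "(a, b)"]
    by (auto simp: ends_at_def)
  then have "\<forall>(a, b)\<in>A. 1 \<le> a \<and> a < b \<and> b \<le> N" by blast
  moreover have "\<exists>!x. x \<in> A \<and> ends_at x q" if q: "q \<in> {1..N}" for q
  proof -
    obtain x where "x \<in> A" "ends_at x q" using pairing_ex[of N A q] p q by auto
    then show ?thesis using pairing_unique[of N A] p by blast
  qed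
  moreover have "\<not> (a < c \<and> c < b \<and> b < d)" if "(a, b) \<in> A" "(c, d) \<in> A" for a b c d
  proof -
    have "\<not> (fst (a, b) < fst (c, d) \<and> fst (c, d) < snd (a, b) \<and> snd (a, b) < snd (c, d))"
      using p that unfolding noncrossing_def by blast
    then show ?thesis by simp
  qed
  ultimately show "crossingless_matching N A"
    unfolding crossingless_matching_def by blast
qed

lemma B_diagrams_iff: "(A, D) \<in> B_diagrams n k \<longleftrightarrow>
   pairing (2 * n) A \<and> noncrossing A \<and> D \<subseteq> A \<and> card D = k \<and> (\<forall>x\<in>D. outer A x)"
  by (auto simp: B_diagrams_def diagrams_def crossingless_matching_iff)

lemma arc_at_eq: "pairing N A \<Longrightarrow> x \<in> A \<Longrightarrow> ends_at x p \<Longrightarrow> arc_at A p = x"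
  unfolding arc_at_def by (rule the_equality) (auto intro: pairing_unique)

lemma card_pairing: "pairing (2 * n) A \<Longrightarrow> card A = n"
proof -
  assume p: "pairing (2 * n) A"
  have "card (fst ` A \<union> snd ` A) = card (fst ` A) + card (snd ` A)"
    using p pairing_finite[OF p] by (intro card_Un_disjoint) (auto simp: pairing_def)
  also have "\<dots> = card A + card A"
    using p by (simp add: card_image pairing_def)
  finally show ?thesis using p by (simp add: pairing_def)
qed

section \<open>Inserting an undotted arc between neighbouring points\<close>

lemma bump_less_iff [simp]: "bump j a < bump j b \<longleftrightarrow> a < b"
  by (auto simp: bump_def)

lemma bump_eq_iff [simp]: "bump j a = bump j b \<longleftrightarrow> a = b"
  by (auto simp: bump_def)

lemma inj_bump: "inj (bump j)"
  by (auto simp: inj_def)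

lemma bump_neq [simp]: "bump j a \<noteq> j" "bump j a \<noteq> Suc j" "j \<noteq> bump j a" "Suc j \<noteq> bump j a"
  by (auto simp: bump_def)

lemma bump_less_self_iff [simp]: "bump j a < j \<longleftrightarrow> a < j" "bump j a < Suc j \<longleftrightarrow> a < j"
  "j < bump j a \<longleftrightarrow> \<not> a < j" "Suc j < bump j a \<longleftrightarrow> \<not> a < j"
  by (auto simp: bump_def)

lemma bump_cases: obtains "p = j" | "p = Suc j" | a where "p = bump j a"
proof -
  have "p = bump j (if p < j then p else p - 2)" if "p \<noteq> j" "p \<noteq> Suc j"
    using that by (auto simp: bump_def)
  then show thesis using that by blast
qed

lemma image_bump: "1 \<le> j \<Longrightarrow> j \<le> N + 1 \<Longrightarrow> {j, Suc j} \<union> bump j ` {1..N} = {1..N + 2}"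
proof (intro equalityI subsetI)
  fix p assume j: "1 \<le> j" "j \<le> N + 1" and p: "p \<in> {1..N + 2}"
  show "p \<in> {j, Suc j} \<union> bump j ` {1..N}"
  proof (cases p j rule: bump_cases)
    case (3 a)
    then have "a \<in> {1..N}" using p j by (auto simp: bump_def split: if_splits)
    then show ?thesis using 3 by auto
  qed auto
qed (auto simp: bump_def split: if_splits)

abbreviation bump_arc :: "nat \<Rightarrow> arc \<Rightarrow> arc" where
  "bump_arc j \<equiv> map_prod (bump j) (bump j)"

definition insert_arc :: "nat \<Rightarrow> arc set \<Rightarrow> arc set" where
  "insert_arc j A = insert (j, Suc j) (bump_arc j ` A)"

definition insert_diagram :: "nat \<Rightarrow> diagram \<Rightarrow> diagram" where
  "insert_diagram j = (\<lambda>(A, D). (insert_arc j A, bump_arc j ` D))"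

lemma inj_bump_arc: "inj (bump_arc j)"
  by (simp add: inj_bump prod.inj_map)

lemma new_arc_notin_image [simp]: "(j, a) \<notin> bump_arc j ` A" "(a, Suc j) \<notin> bump_arc j ` A"
  "(Suc j, a) \<notin> bump_arc j ` A" "(a, j) \<notin> bump_arc j ` A"
  by (auto simp: map_prod_def split: prod.splits)

lemma ends_at_bump [simp]: "ends_at (bump_arc j x) (bump j p) \<longleftrightarrow> ends_at x p"
  by (auto simp: ends_at_def)

lemma Un_disjoint_cancel: "C \<inter> X = {} \<Longrightarrow> C \<inter> Y = {} \<Longrightarrow> C \<union> X = C \<union> Y \<longleftrightarrow> X = Y"
  by blast

text \<open>An equivalence, as it serves both to insert an arc and to peel one off. The images of
  \<open>bump j\<close> avoid exactly the two new points, so each clause of \<open>pairing\<close>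
  reduces to the injectivity of \<open>bump j\<close>.\<close>

lemma pairing_insert_arc:
  assumes "1 \<le> j" "j \<le> N + 1"
  shows "pairing (N + 2) (insert_arc j A) \<longleftrightarrow> pairing N A"
proof -
  have f: "fst ` insert_arc j A = insert j (bump j ` fst ` A)"
    and s: "snd ` insert_arc j A = insert (Suc j) (bump j ` snd ` A)"
    by (auto simp: insert_arc_def image_image)
  have 1: "(\<forall>x\<in>insert_arc j A. fst x < snd x) \<longleftrightarrow> (\<forall>x\<in>A. fst x < snd x)"
    by (simp add: insert_arc_def)
  have 2: "inj_on fst (insert_arc j A) \<longleftrightarrow> inj_on fst A" "inj_on snd (insert_arc j A) \<longleftrightarrow> inj_on snd A"
    by (fastforce simp: insert_arc_def inj_on_def)+
  have "fst ` insert_arc j A \<inter> snd ` insert_arc j A = bump j ` (fst ` A \<inter> snd ` A)"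
    unfolding f s by (auto simp: image_Int[OF inj_bump])
  then have 3: "fst ` insert_arc j A \<inter> snd ` insert_arc j A = {} \<longleftrightarrow> fst ` A \<inter> snd ` A = {}"
    by simp
  have disj: "{j, Suc j} \<inter> bump j ` X = {}" for X by auto
  have "fst ` insert_arc j A \<union> snd ` insert_arc j A = {j, Suc j} \<union> bump j ` (fst ` A \<union> snd ` A)"
    unfolding f s by auto
  also have "\<dots> = {1..N + 2} \<longleftrightarrow> bump j ` (fst ` A \<union> snd ` A) = bump j ` {1..N}"
    unfolding image_bump[OF assms, symmetric]
    by (rule Un_disjoint_cancel[OF disj disj])
  also have "\<dots> \<longleftrightarrow> fst ` A \<union> snd ` A = {1..N}"
    by (rule inj_image_eq_iff[OF inj_bump])
  finally show ?thesis by (simp only: pairing_def 1 2 3)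
qed

lemma noncrossing_insert_arc: "noncrossing (insert_arc j A) \<longleftrightarrow> noncrossing A"
  by (auto simp: noncrossing_def insert_arc_def)

text \<open>The new arc joins neighbours, hence encloses nothing, and \<open>bump j\<close> is
  strictly monotone.\<close>

lemma outer_insert_arc: "outer (insert_arc j A) (bump_arc j x) \<longleftrightarrow> outer A x"
  by (auto simp: outer_def insert_arc_def nested_def)

lemma insert_diagram_B_iff:
  assumes "1 \<le> j" "j \<le> 2 * n + 1"
  shows "insert_diagram j b \<in> B_diagrams (Suc n) k \<longleftrightarrow> b \<in> B_diagrams n k"
proof (cases b)
  case (Pair A D)
  have "bump_arc j ` D \<subseteq> insert_arc j A \<longleftrightarrow> bump_arc j ` D \<subseteq> bump_arc j ` A"
    by (auto simp: insert_arc_def)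
  then have "bump_arc j ` D \<subseteq> insert_arc j A \<longleftrightarrow> D \<subseteq> A"
    by (simp add: inj_image_subset_iff[OF inj_bump_arc])
  moreover have "card (bump_arc j ` D) = card D"
    by (rule card_image[OF inj_on_subset[OF inj_bump_arc]]) simp
  ultimately show ?thesis
    using pairing_insert_arc[OF assms, of A]
    by (simp add: Pair insert_diagram_def B_diagrams_iff noncrossing_insert_arc outer_insert_arc)
qed

text \<open>No other arc touches j or j + 1, so all remaining arcs lie in the range of
  \<open>bump_arc j\<close>, and taking preimages removes the two points.\<close>

lemma B_diagrams_adjacent:
  assumes b: "(A, D) \<in> B_diagrams m k" and j: "(j, Suc j) \<in> A - D"
  obtains n b where "m = Suc n" "1 \<le> j" "j \<le> 2 * n + 1" "(A, D) = insert_diagram j b" "b \<in> B_diagrams n k"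
proof -
  let ?b = "(bump_arc j -` A, bump_arc j -` D)"
  have p: "pairing (2 * m) A" and D: "D \<subseteq> A" using b by (auto simp: B_diagrams_iff)
  have r: "1 \<le> j" "Suc j \<le> 2 * m"
    using pairing_range[OF p, of "(j, Suc j)" j] pairing_range[OF p, of "(j, Suc j)" "Suc j"] j
    by (auto simp: ends_at_def)
  have range: "x \<in> range (bump_arc j)" if "x \<in> A" "x \<noteq> (j, Suc j)" for x
  proof -
    have "\<not> ends_at x j" "\<not> ends_at x (Suc j)"
      using pairing_unique[OF p that(1), of "(j, Suc j)"] j that by (auto simp: ends_at_def)
    then obtain a a' where "fst x = bump j a" "snd x = bump j a'"
      by (metis bump_cases ends_at_def)
    then have "x = bump_arc j (a, a')" by (cases x) simp
    then show ?thesis by blast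
  qed
  have "A = insert (j, Suc j) (bump_arc j ` (bump_arc j -` A))" "D = bump_arc j ` (bump_arc j -` D)"
    using range j D by (auto simp: image_iff) blast+
  then have eq: "(A, D) = insert_diagram j ?b"
    by (simp add: insert_diagram_def insert_arc_def)
  have "m = Suc (m - 1)" "j \<le> 2 * (m - 1) + 1" using r by auto
  then show thesis using that[of "m - 1" ?b] eq r b insert_diagram_B_iff[of j "m - 1" ?b k] by auto
qed

text \<open>Induction on the length of an arc. An undotted arc does not join neighbours, so another
  arc ends just to the right of its left end; since arcs do not cross, that arc is nested inside and
  shorter, hence dotted by induction, contradicting that dotted arcs are outer.\<close>

lemma B_diagrams_no_adjacent:
  assumes b: "(A, D) \<in> B_diagrams n k" and no: "\<And>j. (j, Suc j) \<notin> A - D"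
  shows "A = D" "n = k"
proof -
  have p: "pairing (2 * n) A" and nc: "noncrossing A" and D: "D \<subseteq> A" "card D = k"
    and out: "\<And>x. x \<in> D \<Longrightarrow> outer A x"
    using b by (auto simp: B_diagrams_iff)
  have "x \<in> D" if "x \<in> A" for x
    using that
  proof (induction "snd x - fst x" arbitrary: x rule: less_induct)
    case less
    show ?case
    proof (rule ccontr)
      assume "x \<notin> D"
      then have "x \<noteq> (fst x, Suc (fst x))" using no[of "fst x"] less.prems by auto
      then have lt: "Suc (fst x) < snd x"
        using pairing_less[OF p less.prems] by (cases x) auto
      moreover have "snd x \<le> 2 * n" using pairing_range[OF p less.prems, of "snd x"] by (simp add: ends_at_def)
      ultimately obtain y where y: "y \<in> A" "ends_at y (Suc (fst x))"
        using pairing_ex[OF p, of "Suc (fst x)"] by auto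
      have "y \<noteq> x" using y lt by (auto simp: ends_at_def)
      then have "\<not> ends_at y (fst x)" "\<not> ends_at y (snd x)"
        using pairing_unique[OF p y(1) less.prems] by (auto simp: ends_at_def)
      then have "fst y = Suc (fst x)" "snd y < snd x" "fst y < snd y"
        using y nc less.prems lt pairing_less[OF p y(1)]
        by (auto simp: ends_at_def noncrossing_def)
          (metis lessI linorder_neqE_nat)+
      then have "nested y x" "snd y - fst y < snd x - fst x" by (auto simp: nested_def)
      then show False
        using less.hyps[of y] y(1) out[of y] less.prems by (auto simp: outer_def)
    qed
  qed
  then show "A = D" using D by auto
  then show "n = k" using card_pairing[OF p] D by simp
qed

section \<open>Temperley--Lieb generators on dotted matchings\<close>

definition dotted :: "arc set \<Rightarrow> nat \<Rightarrow> bool" where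
  "dotted D p \<longleftrightarrow> (\<exists>x\<in>D. ends_at x p)"

text \<open>The Temperley--Lieb generator U_i: what is left of \<open>sigma_formula i\<close> after
  removing the summand q^(-1/2) and the factor q^(1/2). The scalar in the first case is the circle
  value -q - 1/q. The second case covers both one dotted arc joining the two points and two
  different dotted arcs.\<close>

definition tl_gen :: "nat \<Rightarrow> diagram \<Rightarrow> (diagram \<Rightarrow>\<^sub>0 laurent)" where
  "tl_gen i = (\<lambda>(A, D).
     if (i, Suc i) \<in> A - D then smul (- qhalf 2 - qhalf (- 2)) (basis (A, D))
     else if dotted D i \<and> dotted D (Suc i) then 0
     else basis (reconnect i (A, D)))"

lemma sigma_formula_tl:
  assumes "pairing N A" "D \<subseteq> A"
  shows "sigma_formula i (A, D) = smul (qhalf (- 1)) (basis (A, D)) + smul (qhalf 1) (tl_gen i (A, D))"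
proof -
  have "dotted D i \<and> dotted D (Suc i) \<longleftrightarrow>
      (i, i + 1) \<in> D \<or> (\<exists>x\<in>D. \<exists>y\<in>D. x \<noteq> y \<and> ends_at x i \<and> ends_at y (i + 1))"
  proof
    assume "dotted D i \<and> dotted D (Suc i)"
    then obtain x y where xy: "x \<in> D" "y \<in> D" "ends_at x i" "ends_at y (Suc i)"
      by (auto simp: dotted_def)
    then have "x = (i, Suc i)" if "x = y"
      using that pairing_less[OF assms(1), of x] assms(2) by (cases x) (auto simp: ends_at_def)
    then show "(i, i + 1) \<in> D \<or> (\<exists>x\<in>D. \<exists>y\<in>D. x \<noteq> y \<and> ends_at x i \<and> ends_at y (i + 1))"
      using xy by (cases "x = y") auto
  next
    assume "(i, i + 1) \<in> D \<or> (\<exists>x\<in>D. \<exists>y\<in>D. x \<noteq> y \<and> ends_at x i \<and> ends_at y (i + 1))"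
    moreover have "dotted D i \<and> dotted D (Suc i)" if "(i, i + 1) \<in> D"
      using that bexI[of "\<lambda>x. ends_at x i" "(i, i + 1)" D] bexI[of "\<lambda>x. ends_at x (Suc i)" "(i, i + 1)" D]
      by (simp add: dotted_def ends_at_def)
    ultimately show "dotted D i \<and> dotted D (Suc i)" by (auto simp: dotted_def)
  qed
  \<comment> \<open>The exceptional scalar arises as -q^(3/2) = q^(-1/2) + q^(1/2) (-q -
    1/q).\<close>
  moreover have "smul (- qhalf 3) v = smul (qhalf (- 1)) v + smul (qhalf 1) (smul (- qhalf 2 - qhalf (- 2)) v)"
    for v :: "diagram \<Rightarrow>\<^sub>0 laurent"
    by (simp add: algebra_simps qhalf_mult flip: lmod.scale_left_distrib)
  ultimately show ?thesis
    by (auto simp: sigma_formula_def tl_gen_def)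
qed

lemma reconnect_eq:
  assumes "pairing N A" "x \<in> A" "ends_at x i" "y \<in> A" "ends_at y (Suc i)"
    and "z = (min (other_end x i) (other_end y (Suc i)), max (other_end x i) (other_end y (Suc i)))"
  shows "reconnect i (A, D) =
    (A - {x, y} \<union> {(i, Suc i), z}, D - {x, y} \<union> (if x \<in> D \<or> y \<in> D then {z} else {}))"
  using arc_at_eq[OF assms(1-3)] arc_at_eq[OF assms(1,4,5)] assms(6)
  by (simp add: reconnect_def Let_def)

lemma bump_Suc: "Suc i \<noteq> j \<Longrightarrow> bump j (Suc i) = Suc (bump j i)"
  by (auto simp: bump_def)

lemma new_arc_neq: "(j, a) \<noteq> bump_arc j x" "bump_arc j x \<noteq> (j, a)"
  "(Suc j, a) \<noteq> bump_arc j x" "bump_arc j x \<noteq> (Suc j, a)"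
  by (cases x; simp)+

lemma other_end_bump: "other_end (bump_arc j x) (bump j p) = bump j (other_end x p)"
  by (simp add: other_end_def)

text \<open>The hypothesis \<open>Suc i \<noteq> j\<close> says that the new points do not separate
  i and i + 1, so that their images are again neighbours and the surgery takes place among the
  images of old arcs.\<close>

lemma reconnect_insert_far:
  assumes j: "1 \<le> j" "j \<le> N + 1" and i: "1 \<le> i" "i < N" "Suc i \<noteq> j" and p: "pairing N A"
  shows "reconnect (bump j i) (insert_diagram j (A, D)) = insert_diagram j (reconnect i (A, D))"
proof -
  obtain x y where x: "x \<in> A" "ends_at x i" and y: "y \<in> A" "ends_at y (Suc i)"
    using pairing_ex[OF p, of i] pairing_ex[OF p, of "Suc i"] i by auto
  define z where "z = (min (other_end x i) (other_end y (Suc i)), max (other_end x i) (other_end y (Suc i)))"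
  have p': "pairing (N + 2) (insert_arc j A)" using pairing_insert_arc[OF j] p by simp
  have mem: "bump_arc j x \<in> bump_arc j ` D \<longleftrightarrow> x \<in> D" for x
    by (rule inj_image_mem_iff[OF inj_bump_arc])
  have diff: "bump_arc j ` (D - {x, y}) = bump_arc j ` D - {bump_arc j x, bump_arc j y}" for D
    by (simp add: image_set_diff[OF inj_bump_arc])
  have "reconnect (bump j i) (insert_diagram j (A, D)) =
    (insert_arc j A - {bump_arc j x, bump_arc j y} \<union> {(bump j i, Suc (bump j i)), bump_arc j z},
     bump_arc j ` D - {bump_arc j x, bump_arc j y} \<union>
       (if bump_arc j x \<in> bump_arc j ` D \<or> bump_arc j y \<in> bump_arc j ` D then {bump_arc j z} else {}))"
    unfolding insert_diagram_def prod.case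
  proof (rule reconnect_eq[OF p'])
    show "bump_arc j x \<in> insert_arc j A" "bump_arc j y \<in> insert_arc j A"
      using x y by (auto simp: insert_arc_def)
    show "ends_at (bump_arc j x) (bump j i)" using x by simp
    show "ends_at (bump_arc j y) (Suc (bump j i))" using y by (simp flip: bump_Suc[OF i(3)])
    show "bump_arc j z =
      (min (other_end (bump_arc j x) (bump j i)) (other_end (bump_arc j y) (Suc (bump j i))),
       max (other_end (bump_arc j x) (bump j i)) (other_end (bump_arc j y) (Suc (bump j i))))"
      by (auto simp: z_def other_end_bump min_def max_def not_le le_less simp flip: bump_Suc[OF i(3)])
  qed
  also have "\<dots> = insert_diagram j (A - {x, y} \<union> {(i, Suc i), z}, D - {x, y} \<union> (if x \<in> D \<or> y \<in> D then {z} else {}))"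
    by (simp add: insert_diagram_def insert_arc_def diff mem bump_Suc[OF i(3)] image_Un) (auto simp: new_arc_neq)
  also have "\<dots> = insert_diagram j (reconnect i (A, D))"
    by (simp add: reconnect_eq[OF p x y z_def])
  finally show ?thesis .
qed

lemma bump_arc_Suc: "\<not> ends_at x j \<Longrightarrow> bump_arc (Suc j) x = bump_arc j x"
  by (cases x) (auto simp: ends_at_def bump_def)

lemma insert2_swap:
  "x \<notin> X \<Longrightarrow> y \<notin> X \<Longrightarrow> insert x (insert y X) - {x, y} \<union> {x', y'} = insert x' (insert y' X)"
  "x \<notin> X \<Longrightarrow> y \<notin> X \<Longrightarrow> insert x (insert y X) - {y, x} \<union> {x', y'} = insert x' (insert y' X)"
  by auto

lemma insert_swap:
  "x \<notin> X \<Longrightarrow> y \<notin> X \<Longrightarrow> x \<noteq> y \<Longrightarrow> insert y X - {x, y} \<union> {y'} = insert y' X"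
  "x \<notin> X \<Longrightarrow> y \<notin> X \<Longrightarrow> X - {x, y} = X"
  "x \<notin> X \<Longrightarrow> y \<notin> X \<Longrightarrow> x \<noteq> y \<Longrightarrow> insert y X - {y, x} \<union> {y'} = insert y' X"
  "x \<notin> X \<Longrightarrow> y \<notin> X \<Longrightarrow> X - {y, x} = X"
  by auto

text \<open>A zigzag: \<open>bump j\<close> sends j to j + 2, whereas \<open>bump (Suc j)\<close>
  fixes it, and elsewhere the two agree. So the diagrams with an arc inserted at j and at j + 1
  differ only in the inserted arc and in the arc \<open>y\<close> that ended at j; reconnecting
  exchanges precisely these.\<close>

lemma reconnect_insert_adjacent:
  assumes j: "1 \<le> j" "j \<le> N" and p: "pairing N A" and D: "D \<subseteq> A"
  shows "reconnect (Suc j) (insert_diagram j (A, D)) = insert_diagram (Suc j) (A, D)"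
    and "reconnect j (insert_diagram (Suc j) (A, D)) = insert_diagram j (A, D)"
proof -
  obtain y where y: "y \<in> A" "ends_at y j"
    using pairing_ex[OF p, of j] j by auto
  have p': "pairing (N + 2) (insert_arc j A)" "pairing (N + 2) (insert_arc (Suc j) A)"
    using pairing_insert_arc[of j N A] pairing_insert_arc[of "Suc j" N A] p j by auto
  have less: "fst y < snd y" by (rule pairing_less[OF p y(1)])
  have other: "bump_arc (Suc j) x = bump_arc j x" if "x \<in> A - {y}" for x
    using that pairing_unique[OF p _ y(1) _ y(2), of x] by (intro bump_arc_Suc) auto
  have mem: "bump_arc i x \<in> bump_arc i ` D \<longleftrightarrow> x \<in> D" for i x
    by (rule inj_image_mem_iff[OF inj_bump_arc])
  define XA XD where "XA = bump_arc j ` (A - {y})" and "XD = bump_arc j ` (D - {y})"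
  have X': "XA = bump_arc (Suc j) ` (A - {y})" "XD = bump_arc (Suc j) ` (D - {y})"
    unfolding XA_def XD_def using D by (intro image_cong[OF HOL.refl other[symmetric]]; blast)+
  have "bump_arc i y \<notin> bump_arc i ` (E - {y})" for i E
    by (simp add: inj_image_mem_iff[OF inj_bump_arc] del: map_prod_imageI)
  then have notin: "bump_arc j y \<notin> XA" "bump_arc (Suc j) y \<notin> XA" "bump_arc j y \<notin> XD" "bump_arc (Suc j) y \<notin> XD"
    by (metis XA_def XD_def X')+
  have new: "(j, Suc j) \<notin> XA" "(Suc j, Suc (Suc j)) \<notin> XA" "(j, Suc j) \<notin> XD" "(Suc j, Suc (Suc j)) \<notin> XD"
    by (simp_all add: XA_def XD_def)
  have image_remove: "f ` E = (if y \<in> E then insert (f y) (f ` (E - {y})) else f ` (E - {y}))"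
    for f :: "arc \<Rightarrow> arc" and E by auto
  have imA: "bump_arc j ` A = insert (bump_arc j y) XA" "bump_arc (Suc j) ` A = insert (bump_arc (Suc j) y) XA"
    using image_remove[of "bump_arc j" A] image_remove[of "bump_arc (Suc j)" A] y(1)
    by (simp_all only: XA_def[symmetric] X'(1)[symmetric] if_True)
  have imD: "bump_arc j ` D = (if y \<in> D then insert (bump_arc j y) XD else XD)"
    "bump_arc (Suc j) ` D = (if y \<in> D then insert (bump_arc (Suc j) y) XD else XD)"
    using image_remove[of "bump_arc j" D] image_remove[of "bump_arc (Suc j)" D]
    by (simp_all only: XD_def[symmetric] X'(2)[symmetric])
  have "reconnect (Suc j) (insert_diagram j (A, D)) =
    (insert_arc j A - {(j, Suc j), bump_arc j y} \<union> {(Suc j, Suc (Suc j)), bump_arc (Suc j) y},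
     bump_arc j ` D - {(j, Suc j), bump_arc j y} \<union>
       (if (j, Suc j) \<in> bump_arc j ` D \<or> bump_arc j y \<in> bump_arc j ` D then {bump_arc (Suc j) y} else {}))"
    unfolding insert_diagram_def prod.case
  proof (rule reconnect_eq[OF p'(1)])
    show "(j, Suc j) \<in> insert_arc j A" "bump_arc j y \<in> insert_arc j A"
      using y by (auto simp: insert_arc_def)
    show "ends_at (j, Suc j) (Suc j)" by (simp add: ends_at_def)
    show "ends_at (bump_arc j y) (Suc (Suc j))" using y by (auto simp: ends_at_def bump_def)
    show "bump_arc (Suc j) y =
      (min (other_end (j, Suc j) (Suc j)) (other_end (bump_arc j y) (Suc (Suc j))),
       max (other_end (j, Suc j) (Suc j)) (other_end (bump_arc j y) (Suc (Suc j))))"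
      using y less by (cases y) (auto simp: ends_at_def other_end_def bump_def)
  qed
  also have "\<dots> = insert_diagram (Suc j) (A, D)"
    unfolding insert_diagram_def insert_arc_def prod.case mem imA imD
    using notin new
    by (cases "y \<in> D")
      (simp_all only: if_True if_False simp_thms prod.inject Un_empty_right insert2_swap insert_swap
        new_arc_neq not_False_eq_True insert_iff)
  finally show "reconnect (Suc j) (insert_diagram j (A, D)) = insert_diagram (Suc j) (A, D)" .
  have "reconnect j (insert_diagram (Suc j) (A, D)) =
    (insert_arc (Suc j) A - {bump_arc (Suc j) y, (Suc j, Suc (Suc j))} \<union> {(j, Suc j), bump_arc j y},
     bump_arc (Suc j) ` D - {bump_arc (Suc j) y, (Suc j, Suc (Suc j))} \<union>
       (if bump_arc (Suc j) y \<in> bump_arc (Suc j) ` D \<or> (Suc j, Suc (Suc j)) \<in> bump_arc (Suc j) ` D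
        then {bump_arc j y} else {}))"
    unfolding insert_diagram_def prod.case
  proof (rule reconnect_eq[OF p'(2)])
    show "(Suc j, Suc (Suc j)) \<in> insert_arc (Suc j) A" "bump_arc (Suc j) y \<in> insert_arc (Suc j) A"
      using y by (auto simp: insert_arc_def)
    show "ends_at (Suc j, Suc (Suc j)) (Suc j)" by (simp add: ends_at_def)
    show "ends_at (bump_arc (Suc j) y) j" using y by (auto simp: ends_at_def bump_def)
    show "bump_arc j y =
      (min (other_end (bump_arc (Suc j) y) j) (other_end (Suc j, Suc (Suc j)) (Suc j)),
       max (other_end (bump_arc (Suc j) y) j) (other_end (Suc j, Suc (Suc j)) (Suc j)))"
      using y less by (cases y) (auto simp: ends_at_def other_end_def bump_def)
  qed
  also have "\<dots> = insert_diagram j (A, D)"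
    unfolding insert_diagram_def insert_arc_def prod.case mem imA imD
    using notin new
    by (cases "y \<in> D")
      (simp_all only: if_True if_False simp_thms prod.inject Un_empty_right insert2_swap insert_swap
        new_arc_neq not_False_eq_True insert_iff)
  finally show "reconnect j (insert_diagram (Suc j) (A, D)) = insert_diagram j (A, D)" .
qed

lemma dotted_insert [simp]: "dotted (bump_arc j ` D) (bump j p) \<longleftrightarrow> dotted D p"
  "\<not> dotted (bump_arc j ` D) j" "\<not> dotted (bump_arc j ` D) (Suc j)"
  by (auto simp: dotted_def ends_at_def)

lemma adjacent_insert_iff:
  assumes "Suc i \<noteq> j"
  shows "(bump j i, Suc (bump j i)) \<in> insert_arc j A - bump_arc j ` D \<longleftrightarrow> (i, Suc i) \<in> A - D"
proof -
  have "(bump j i, Suc (bump j i)) = bump_arc j (i, Suc i)" using assms by (simp add: bump_Suc)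
  then show ?thesis
    using inj_image_mem_iff[OF inj_bump_arc, of j "(i, Suc i)"] by (simp only: insert_arc_def) (simp add: bump_Suc assms)
qed

lemma tl_insert_same: "tl_gen j (insert_diagram j b) = smul (- qhalf 2 - qhalf (- 2)) (basis (insert_diagram j b))"
  by (cases b) (simp add: tl_gen_def insert_diagram_def insert_arc_def)

lemma tl_insert_adjacent:
  assumes j: "1 \<le> j" "j \<le> N" and p: "pairing N A" and D: "D \<subseteq> A"
  shows "tl_gen (Suc j) (insert_diagram j (A, D)) = basis (insert_diagram (Suc j) (A, D))"
    and "tl_gen j (insert_diagram (Suc j) (A, D)) = basis (insert_diagram j (A, D))"
proof -
  have "(Suc j, Suc (Suc j)) \<notin> insert_arc j A" "(j, Suc j) \<notin> insert_arc (Suc j) A"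
    by (auto simp: insert_arc_def)
  then show "tl_gen (Suc j) (insert_diagram j (A, D)) = basis (insert_diagram (Suc j) (A, D))"
    and "tl_gen j (insert_diagram (Suc j) (A, D)) = basis (insert_diagram j (A, D))"
    using reconnect_insert_adjacent[OF assms] dotted_insert(2)[of "Suc j" D] dotted_insert(3)[of j D]
    by (simp_all add: tl_gen_def insert_diagram_def)
qed

lemma tl_insert_far:
  assumes "1 \<le> j" "j \<le> N + 1" "1 \<le> i" "i < N" "Suc i \<noteq> j" "pairing N A"
  shows "tl_gen (bump j i) (insert_diagram j (A, D)) = lin_ext (\<lambda>b. basis (insert_diagram j b)) (tl_gen i (A, D))"
  using adjacent_insert_iff[OF assms(5), of A D] reconnect_insert_far[OF assms, of D]
    dotted_insert(1)[of j D i] dotted_insert(1)[of j D "Suc i"] bump_Suc[OF assms(5)]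
  by (simp add: tl_gen_def lin_ext_smul insert_diagram_def)

text \<open>The ways in which the maximum of U_i can meet the minimum of an inserted arc: it closes
  a circle, forms one of two zigzags, or misses it. The same split is used for matchings and for
  tangles.\<close>

lemma adjacent_cases:
  assumes "i \<in> {1..<2 * Suc m}" "1 \<le> j" "j \<le> 2 * m + 1"
  obtains "i = j" | "i = Suc j" "j \<le> 2 * m" | "Suc i = j" "i \<le> 2 * m"
    | i' where "i' \<in> {1..<2 * m}" "i = bump j i'" "Suc i' \<noteq> j"
proof (cases i j rule: bump_cases)
  case (3 i')
  show thesis
  proof (cases "Suc i = j")
    case False
    then have "i' \<in> {1..<2 * m} \<and> Suc i' \<noteq> j" using 3 assms by (auto simp: bump_def split: if_splits)
    then show thesis using that(4) 3 by blast
  qed (use that assms in auto)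
qed (use that assms in auto)

section \<open>Stability of the span of diagrams with outer dots\<close>

lemma keys_basis [simp]: "Poly_Mapping.keys (basis b) = {b}"
  by (simp add: basis_def)

lemma Rbar_iff: "x \<in> Rbar n k \<longleftrightarrow> Poly_Mapping.keys x \<subseteq> B_diagrams n k"
proof
  assume "x \<in> Rbar n k"
  then show "Poly_Mapping.keys x \<subseteq> B_diagrams n k"
    unfolding Rbar_def
    by (induction rule: lmod.span_induct_alt)
      (use keys_add in \<open>fastforce simp: in_keys_iff lookup_add lookup_smul basis_def lookup_single when_def split: if_splits\<close>)+
next
  assume x: "Poly_Mapping.keys x \<subseteq> B_diagrams n k"
  have "x = lin_ext basis x"
    by (rule poly_mapping_eqI)
      (simp add: lin_ext_def lookup_sum lookup_smul basis_def lookup_single when_def in_keys_iff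
        if_distrib[of "\<lambda>c. _ * c"] cong: if_cong)
  moreover have "\<dots> \<in> Rbar n k"
    unfolding lin_ext_def Rbar_def using x
    by (intro lmod.span_sum lmod.span_scale lmod.span_base) auto
  ultimately show "x \<in> Rbar n k" by simp
qed

lemma subspace_Rbar: "lsubspace (Rbar n k)"
  unfolding Rbar_def by (rule lmod.subspace_span)

lemma basis_Rbar_iff [simp]: "basis b \<in> Rbar n k \<longleftrightarrow> b \<in> B_diagrams n k"
  by (simp add: Rbar_iff)

text \<open>The case split behind both inductions on n, that for \<open>tl_Rbar\<close> and that for
  equivariance.\<close>

lemma B_diagrams_cases:
  assumes "(A, D) \<in> B_diagrams n k"
  obtains (all_dotted) "A = D" "n = k"
  | (adjacent) m j A0 D0 where "n = Suc m" "1 \<le> j" "j \<le> 2 * m + 1"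
      "(A, D) = insert_diagram j (A0, D0)" "(A0, D0) \<in> B_diagrams m k"
proof (cases "\<exists>j. (j, Suc j) \<in> A - D")
  case True
  then obtain j where "(j, Suc j) \<in> A - D" ..
  then show thesis by (rule B_diagrams_adjacent[OF assms]) (metis adjacent surj_pair)
next
  case False
  then show thesis using B_diagrams_no_adjacent[OF assms] all_dotted by blast
qed

text \<open>This is how reconnecting is seen to keep the arcs uncrossed and the dots outer. With an
  arc peeled off, the positions of \<open>adjacent_cases\<close> give again a diagram with an
  inserted arc, a multiple of one, or the case n - 1; with all arcs dotted the generator gives
  0.\<close>

lemma tl_Rbar:
  assumes "b \<in> B_diagrams n k" "i \<in> {1..<2 * n}"
  shows "tl_gen i b \<in> Rbar n k"
  using assms
proof (induction n arbitrary: b i)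
  case (Suc n b i)
  obtain A D where b: "b = (A, D)" by (cases b)
  have p: "pairing (2 * Suc n) A" using Suc.prems(1) by (simp only: b B_diagrams_iff)
  from Suc.prems(1)[unfolded b] show ?case
  proof (cases rule: B_diagrams_cases)
    case all_dotted
    moreover have "dotted A i" "dotted A (Suc i)"
      unfolding dotted_def using Suc.prems(2) by (auto intro!: pairing_ex[OF p])
    ultimately show ?thesis using lmod.subspace_0[OF subspace_Rbar] by (simp add: b tl_gen_def)
  next
    case (adjacent m j A0 D0)
    note [simp] = adjacent(1)[symmetric, simplified]
    define b0 where b0': "b0 = (A0, D0)"
    have b0: "b0 \<in> B_diagrams n k" and j: "1 \<le> j" "j \<le> 2 * n + 1" and ins: "b = insert_diagram j b0"
      using adjacent by (simp_all add: b b0')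
    have p0: "pairing (2 * n) A0" "D0 \<subseteq> A0" using b0 by (auto simp: b0' B_diagrams_iff)
    have B: "insert_diagram j b' \<in> B_diagrams (Suc n) k" if "1 \<le> j" "j \<le> 2 * n + 1" "b' \<in> B_diagrams n k" for j b'
      using insert_diagram_B_iff that by blast
    from Suc.prems(2) j show ?thesis
    proof (cases rule: adjacent_cases)
      case 1
      then show ?thesis
        using B[OF j b0] lmod.subspace_scale[OF subspace_Rbar] by (simp add: ins tl_insert_same)
    next
      case 2
      then show ?thesis
        using tl_insert_adjacent(1)[OF _ _ p0, of j] B[of "Suc j" b0] j b0 by (simp add: ins b0')
    next
      case 3
      then show ?thesis
        using tl_insert_adjacent(2)[OF _ _ p0, of i] B[of i b0] j b0 Suc.prems(2) by (auto simp: ins b0')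
    next
      case (4 i')
      have "lin_ext (\<lambda>b. basis (insert_diagram j b)) (tl_gen i' b0) \<in> Rbar (Suc n) k"
        by (rule lin_ext_span[OF subspace_Rbar _ Suc.IH[OF b0 4(1), unfolded Rbar_def]])
          (use B[OF j] in auto)
      then show ?thesis
        using tl_insert_far[of j "2 * n" i' A0 D0] 4 j p0 by (simp add: ins b0')
    qed
  qed
qed simp

section \<open>Partner functions\<close>

text \<open>The value \<open>0\<close> stands for a missing partner.\<close>

definition partner :: "diagram \<Rightarrow> nat \<Rightarrow> nat" where
  "partner = (\<lambda>(A, D) p. if \<exists>x\<in>A - D. ends_at x p then other_end (arc_at A p) p else 0)"

definition partner_fun :: "(nat \<Rightarrow> nat) \<Rightarrow> bool" where
  "partner_fun f \<longleftrightarrow> f 0 = 0 \<and> (\<forall>p. f p \<noteq> 0 \<longrightarrow> f (f p) = p \<and> f p \<noteq> p)"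

text \<open>The former partners of i and i' become partners of each other. If one of them is
  missing, its 0 is handed on to the other, which mirrors the rule that the new arc inherits a dot.
  Testing \<open>p = 0\<close> first keeps 0 fixed when \<open>f i\<close> or \<open>f i'\<close> is
  0.\<close>

definition rejoin :: "nat \<Rightarrow> nat \<Rightarrow> (nat \<Rightarrow> nat) \<Rightarrow> nat \<Rightarrow> nat" where
  "rejoin i i' f p = (if p = 0 then 0 else if p = i then i' else if p = i' then i
     else if p = f i then f i' else if p = f i' then f i else f p)"

context
  fixes f :: "nat \<Rightarrow> nat"
  assumes f: "partner_fun f"
begin

lemma partner_fun_0: "f 0 = 0"
  using f by (simp add: partner_fun_def)

lemma partner_fun_inv: "f p \<noteq> 0 \<Longrightarrow> f (f p) = p"
  using f unfolding partner_fun_def by blast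

lemma partner_fun_neq: "f p \<noteq> 0 \<Longrightarrow> f p \<noteq> p"
  using f unfolding partner_fun_def by blast

lemma partner_fun_eqD: "f p = q \<Longrightarrow> q \<noteq> 0 \<Longrightarrow> f q = p"
  using partner_fun_inv by auto

text \<open>The zigzag relation on partner functions: if i and i + 1 are joined, joining at a
  neighbouring place and then again at i undoes the change.\<close>

lemma rejoin_cancel:
  assumes i: "f i = Suc i" "1 \<le> i"
  shows "rejoin i (Suc i) (rejoin (Suc i) (Suc (Suc i)) f) = f"
    "1 \<le> j \<Longrightarrow> Suc j = i \<Longrightarrow> rejoin i (Suc i) (rejoin j i f) = f"
proof -
  have fSi: "f (Suc i) = i" using partner_fun_eqD[OF i(1)] by simp
  show "rejoin i (Suc i) (rejoin (Suc i) (Suc (Suc i)) f) = f"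
  proof
    fix p show "rejoin i (Suc i) (rejoin (Suc i) (Suc (Suc i)) f) p = f p"
      using i fSi partner_fun_0 partner_fun_inv[of p] partner_fun_inv[of "Suc (Suc i)"]
        partner_fun_neq[of "Suc (Suc i)"]
      by (auto simp: rejoin_def)
  qed
  show "rejoin i (Suc i) (rejoin j i f) = f" if "1 \<le> j" "Suc j = i"
  proof
    fix p show "rejoin i (Suc i) (rejoin j i f) p = f p"
      using i that fSi partner_fun_0 partner_fun_inv[of p] partner_fun_inv[of j] partner_fun_neq[of j]
      by (auto simp: rejoin_def)
  qed
qed

context
  fixes i i' j j' :: nat
  assumes d: "distinct [0, i, i', j, j']"
begin

lemma rejoin_far_joined: "f i = i' \<Longrightarrow> rejoin j j' f i = i'"
  using d partner_fun_inv unfolding rejoin_def by (smt (verit) distinct_length_2_or_more)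

lemma rejoin_far_zero:
  "f i = 0 \<Longrightarrow> f i' = 0 \<Longrightarrow> rejoin j j' f i = 0 \<and> rejoin j j' f i' = 0"
  using d partner_fun_inv[of j] partner_fun_inv[of j'] unfolding rejoin_def
  by (smt (verit) distinct_length_2_or_more)

text \<open>Joining i and i' can newly connect j with j' only if the former two were the partners of
  the latter two. Both joinings then produce the same two arcs.\<close>

lemma rejoin_far_new_joined:
  assumes "rejoin i i' f j = j'" "f j \<noteq> j'"
  shows "rejoin j j' f i = i' \<and> rejoin j j' f = rejoin i i' f"
proof -
  have c: "f i = j \<and> f i' = j' \<or> f i = j' \<and> f i' = j"
    using assms d partner_fun_inv[of i] partner_fun_inv[of i'] unfolding rejoin_def
    by (smt (verit) distinct_length_2_or_more)
  then have "f j = i \<and> f j' = i' \<or> f j = i' \<and> f j' = i"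
    using d partner_fun_inv[of i] partner_fun_inv[of i'] by auto
  then have "rejoin j j' f i = i'" "rejoin j j' f p = rejoin i i' f p" for p
    using c d unfolding rejoin_def by (smt (verit) distinct_length_2_or_more)+
  then show ?thesis by blast
qed

text \<open>Here one of j, j' is the partner of one of i, i', and the remaining two of the four
  points have no partner. Joining either pair then leaves the other pair without partners.\<close>

lemma rejoin_far_new_zero:
  assumes "rejoin i i' f j = 0" "rejoin i i' f j' = 0" "\<not> (f j = 0 \<and> f j' = 0)"
  shows "rejoin j j' f i = 0 \<and> rejoin j j' f i' = 0"
  using assms d partner_fun_inv[of j] partner_fun_inv[of j'] partner_fun_inv[of i] partner_fun_inv[of i']
  unfolding rejoin_def by (smt (verit) distinct_length_2_or_more)

lemma rejoin_commute_at:
  assumes "rejoin i i' f j \<noteq> j'"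
  shows "rejoin i i' (rejoin j j' f) p = rejoin j j' (rejoin i i' f) p"
proof -
  have d': "i \<noteq> 0" "i' \<noteq> 0" "j \<noteq> 0" "j' \<noteq> 0" "i \<noteq> i'" "i \<noteq> j" "i \<noteq> j'" "i' \<noteq> j" "i' \<noteq> j'" "j \<noteq> j'" using d by auto
  have gi: "rejoin j j' f i = (if i = f j then f j' else if i = f j' then f j else f i)"
   "rejoin j j' f i' = (if i' = f j then f j' else if i' = f j' then f j else f i')"
   "rejoin i i' f j = (if j = f i then f i' else if j = f i' then f i else f j)"
   "rejoin i i' f j' = (if j' = f i then f i' else if j' = f i' then f i else f j')"
    using d' unfolding rejoin_def by simp_all
  have e: "rejoin i i' (rejoin j j' f) p =  (if p = 0 then 0 else if p = i then i' else if p = i' then i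
     else if p = rejoin j j' f i then rejoin j j' f i' else if p = rejoin j j' f i' then rejoin j j' f i else rejoin j j' f p)"
     "rejoin j j' (rejoin i i' f) p =  (if p = 0 then 0 else if p = j then j' else if p = j' then j
     else if p = rejoin i i' f j then rejoin i i' f j' else if p = rejoin i i' f j' then rejoin i i' f j else rejoin i i' f p)"
     by (simp_all add: rejoin_def)
  have inv': "f j \<noteq> 0 \<longrightarrow> f (f j) = j" "f j' \<noteq> 0 \<longrightarrow> f (f j') = j'" "f i \<noteq> 0 \<longrightarrow> f (f i) = i" "f i' \<noteq> 0 \<longrightarrow> f (f i') = i'" "f p \<noteq> 0 \<longrightarrow> f (f p) = p"
    using partner_fun_inv by auto
  have neq': "f i \<noteq> i" "f i' \<noteq> i'" "f j \<noteq> j" "f j' \<noteq> j'" using partner_fun_neq d' by metis+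
  \<comment> \<open>Two links between i, i' and j, j' would make j' the new partner of j, which is
    excluded. What remains is no link or exactly one of the four possible links.\<close>
  consider "f i \<noteq> j" "f i \<noteq> j'" "f i' \<noteq> j" "f i' \<noteq> j'" | "f i = j" "f j = i" "f i' \<noteq> j" "f i' \<noteq> j'" | "f i = j'" "f j' = i" "f i' \<noteq> j" "f i' \<noteq> j'"
   | "f i' = j" "f j = i'" "f i \<noteq> j" "f i \<noteq> j'" | "f i' = j'" "f j' = i'" "f i \<noteq> j" "f i \<noteq> j'"
    using assms d' inv' unfolding gi by metis
  then show ?thesis
  proof cases
    case 1
    then have n: "f j \<noteq> i" "f j' \<noteq> i" "f j \<noteq> i'" "f j' \<noteq> i'" using d' inv' by auto
    have v: "rejoin j j' f i = f i" "rejoin j j' f i' = f i'" "rejoin i i' f j = f j" "rejoin i i' f j' = f j'" using gi 1 n by auto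
    show ?thesis unfolding e v unfolding rejoin_def using d' inv' neq' n 1 partner_fun_0 by (smt (verit))
  next
    case 2 
    then have n: "f j' \<noteq> i" "f j' \<noteq> i'" using d' inv' by auto
    have v: "rejoin j j' f i = f j'" "rejoin j j' f i' = f i'" "rejoin i i' f j = f i'" "rejoin i i' f j' = f j'" using gi 2 n d' by auto
    show ?thesis unfolding e v unfolding rejoin_def using d' inv' neq' n 2 partner_fun_0 by (smt (verit))
  next
    case 3
    then have n: "f j \<noteq> i" "f j \<noteq> i'" using d' inv' by auto
    have v: "rejoin j j' f i = f j" "rejoin j j' f i' = f i'" "rejoin i i' f j = f j" "rejoin i i' f j' = f i'" using gi 3 n d' by auto
    show ?thesis unfolding e v unfolding rejoin_def using d' inv' neq' n 3 partner_fun_0 by (smt (verit))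
  next
    case 4
    then have n: "f j' \<noteq> i" "f j' \<noteq> i'" using d' inv' by auto
    have v: "rejoin j j' f i = f i" "rejoin j j' f i' = f j'" "rejoin i i' f j = f i" "rejoin i i' f j' = f j'" using gi 4 n d' by auto
    show ?thesis unfolding e v unfolding rejoin_def using d' inv' neq' n 4 partner_fun_0 by (smt (verit))
  next
    case 5
    then have n: "f j \<noteq> i" "f j \<noteq> i'" using d' inv' by auto
    have v: "rejoin j j' f i = f i" "rejoin j j' f i' = f j" "rejoin i i' f j = f j" "rejoin i i' f j' = f i" using gi 5 n d' by auto
    show ?thesis unfolding e v unfolding rejoin_def using d' inv' neq' n 5 partner_fun_0 by (smt (verit))
  qed
qed

end

end

lemma partner_eq:
  assumes "pairing N A" "x \<in> A - D" "ends_at x p"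
  shows "partner (A, D) p = other_end x p"
  using arc_at_eq[OF assms(1) _ assms(3)] assms by (auto simp: partner_def)

lemma partner_eq_0:
  assumes "pairing N A" "D \<subseteq> A" "dotted D p \<or> \<not> (1 \<le> p \<and> p \<le> N)"
  shows "partner (A, D) p = 0"
proof -
  have "\<not> (\<exists>x\<in>A - D. ends_at x p)"
    using assms pairing_unique[OF assms(1)] pairing_range[OF assms(1)] unfolding dotted_def by blast
  then show ?thesis by (simp add: partner_def)
qed

lemma other_end:
  assumes "pairing N A" "x \<in> A" "ends_at x p"
  shows "ends_at x (other_end x p)" "other_end x p \<noteq> p" "other_end x p \<noteq> 0"
    "other_end x (other_end x p) = p"
  using assms pairing_less[OF assms(1,2)] pairing_range[OF assms(1,2), of "fst x"]
  by (auto simp: other_end_def ends_at_def)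

lemma partner_cases:
  assumes "pairing N A" "D \<subseteq> A"
  obtains "partner (A, D) p = 0" "dotted D p \<or> \<not> (1 \<le> p \<and> p \<le> N)"
  | x where "x \<in> A - D" "ends_at x p" "partner (A, D) p = other_end x p"
proof (cases "\<exists>x\<in>A - D. ends_at x p")
  case True
  then show thesis using that(2) partner_eq[OF assms(1)] by blast
next
  case False
  then have "dotted D p \<or> \<not> (1 \<le> p \<and> p \<le> N)"
    using pairing_ex[OF assms(1), of p] unfolding dotted_def by blast
  then show thesis using that(1) partner_eq_0[OF assms, of p] by simp
qed

lemma partner_fun_partner:
  assumes "pairing N A" "D \<subseteq> A"
  shows "partner_fun (partner (A, D))"
  unfolding partner_fun_def
proof (intro conjI allI impI)
  show "partner (A, D) 0 = 0" using partner_eq_0[OF assms] by simp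
  fix p assume "partner (A, D) p \<noteq> 0"
  then obtain x where x: "x \<in> A - D" "ends_at x p" "partner (A, D) p = other_end x p"
    by (cases rule: partner_cases[OF assms, of p]) auto
  have "x \<in> A" using x(1) by simp
  from other_end[OF assms(1) this x(2)]
  show "partner (A, D) (partner (A, D) p) = p" "partner (A, D) p \<noteq> p"
    using partner_eq[OF assms(1) x(1), of "other_end x p"] by (simp_all add: x(3))
qed

lemma partner_eq_0_iff:
  assumes "pairing N A" "D \<subseteq> A" "1 \<le> p" "p \<le> N"
  shows "partner (A, D) p = 0 \<longleftrightarrow> dotted D p"
proof (cases rule: partner_cases[OF assms(1,2), of p])
  case (2 x)
  then have "partner (A, D) p \<noteq> 0" using other_end(3)[OF assms(1), of x p] by simp
  then show ?thesis using partner_eq_0[OF assms(1,2), of p] by blast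
qed (use assms in simp)

lemma partner_eq_Suc_iff:
  assumes "pairing N A" "D \<subseteq> A"
  shows "partner (A, D) i = Suc i \<longleftrightarrow> (i, Suc i) \<in> A - D"
proof
  assume *: "partner (A, D) i = Suc i"
  then obtain x where x: "x \<in> A - D" "ends_at x i" "other_end x i = Suc i"
    by (cases rule: partner_cases[OF assms, of i]) auto
  then have "x = (i, Suc i)"
    using pairing_less[OF assms(1), of x] by (cases x) (auto simp: ends_at_def other_end_def split: if_splits)
  then show "(i, Suc i) \<in> A - D" using x by simp
next
  assume "(i, Suc i) \<in> A - D"
  then show "partner (A, D) i = Suc i"
    using partner_eq[OF assms(1), of "(i, Suc i)" D i] by (simp add: ends_at_def other_end_def)
qed

text \<open>Translates the surgery on arcs into \<open>rejoin\<close>, a dotted arc contributing the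
  partner 0. That the result is again a pairing appears as a hypothesis here;
  \<open>tl_partner\<close> supplies it from \<open>tl_Rbar\<close>.\<close>

lemma partner_reconnect:
  assumes p: "pairing N A" "D \<subseteq> A" and i: "1 \<le> i" "i < N"
    and no: "(i, Suc i) \<notin> A - D" "\<not> (dotted D i \<and> dotted D (Suc i))"
    and A': "reconnect i (A, D) = (A', D')" "pairing N A'" "D' \<subseteq> A'"
  shows "partner (A', D') = rejoin i (Suc i) (partner (A, D))"
proof
  fix q
  let ?f = "partner (A, D)" and ?g = "partner (A', D')"
  obtain x y where x: "x \<in> A" "ends_at x i" and y: "y \<in> A" "ends_at y (Suc i)"
    using pairing_ex[OF p(1), of i] pairing_ex[OF p(1), of "Suc i"] i by auto
  define a b where "a = other_end x i" and "b = other_end y (Suc i)"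
  define z where "z = (min a b, max a b)"
  have neq: "x \<noteq> y"
  proof
    assume "x = y"
    then have "x = (i, Suc i)"
      using x y pairing_less[OF p(1) x(1)] by (cases x) (auto simp: ends_at_def)
    then show False using no \<open>x = y\<close> x y by (auto simp: dotted_def)
  qed
  note xu = pairing_unique[OF p(1) _ x(1)] and yu = pairing_unique[OF p(1) _ y(1)]
  note oa = other_end[OF p(1) x, folded a_def] and ob = other_end[OF p(1) y, folded b_def]
  have ab: "a \<noteq> b" "a \<noteq> i" "a \<noteq> Suc i" "b \<noteq> i" "b \<noteq> Suc i"
    using neq oa ob x y xu yu by metis+
  have eq: "A' = A - {x, y} \<union> {(i, Suc i), z}" "D' = D - {x, y} \<union> (if x \<in> D \<or> y \<in> D then {z} else {})"
    using reconnect_eq[OF p(1) x y, of z D] A'(1) by (simp_all add: z_def a_def b_def)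
  have z: "ends_at z a" "ends_at z b" "other_end z a = b" "other_end z b = a" "z \<noteq> (i, Suc i)"
    using ab by (auto simp: z_def ends_at_def other_end_def min_def max_def)
  have fi: "?f i = (if x \<in> D then 0 else a)" "?f a = (if x \<in> D then 0 else i)"
    using partner_eq[OF p(1) _ x(2), of D] partner_eq[OF p(1) _ oa(1), of D] partner_eq_0[OF p, of i]
      partner_eq_0[OF p, of a] x oa by (auto simp: a_def dotted_def)
  have fSi: "?f (Suc i) = (if y \<in> D then 0 else b)" "?f b = (if y \<in> D then 0 else Suc i)"
    using partner_eq[OF p(1) _ y(2), of D] partner_eq[OF p(1) _ ob(1), of D] partner_eq_0[OF p, of "Suc i"]
      partner_eq_0[OF p, of b] y ob by (auto simp: b_def dotted_def)
  have notD: "(i, Suc i) \<notin> D"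
    using no by (force simp: dotted_def ends_at_def)
  have new: "(i, Suc i) \<in> A' - D'" using eq z notD by auto
  \<comment> \<open>Were \<open>z\<close> already an arc of \<open>A\<close>, it would share the end
    a with \<open>x\<close> and hence equal \<open>x\<close>, which has been removed. So a dot on
    \<open>z\<close> can come only from the rule for the new arc.\<close>
  have zD: "z \<in> D' \<longleftrightarrow> x \<in> D \<or> y \<in> D"
  proof -
    have "z \<in> {x, y}" if "z \<in> A"
      using xu[OF that z(1) oa(1)] by simp
    then show ?thesis using eq p by auto
  qed
  have zA: "z \<in> A'" using eq by simp
  have nxy: "\<not> (x \<in> D \<and> y \<in> D)" using no(2) x y by (auto simp: dotted_def)
  consider "q = 0" | "q = i" | "q = Suc i" | "q = a" "q \<noteq> 0" | "q = b" "q \<noteq> 0" | "q \<notin> {0, i, Suc i, a, b}" by blast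
  then show "?g q = rejoin i (Suc i) ?f q"
  proof cases
    case 1
    then show ?thesis using partner_eq_0[OF A'(2,3), of 0] by (simp add: rejoin_def)
  next
    case 2
    then show ?thesis
      using partner_eq[OF A'(2) new, of i] i by (simp add: rejoin_def ends_at_def other_end_def)
  next
    case 3
    then show ?thesis
      using partner_eq[OF A'(2) new, of "Suc i"] i by (simp add: rejoin_def ends_at_def other_end_def)
  next
    case 4
    have "?g a = (if x \<in> D \<or> y \<in> D then 0 else b)"
      using partner_eq[OF A'(2) _ z(1), of D'] partner_eq_0[OF A'(2,3), of a] zD z zA by (auto simp: dotted_def)
    then show ?thesis using 4 ab fi fSi nxy by (auto simp: rejoin_def)
  next
    case 5
    have "?g b = (if x \<in> D \<or> y \<in> D then 0 else a)"
      using partner_eq[OF A'(2) _ z(2), of D'] partner_eq_0[OF A'(2,3), of b] zD z zA by (auto simp: dotted_def)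
    then show ?thesis using 5 ab fi fSi nxy by (auto simp: rejoin_def)
  next
    case 6
    have "?g q = ?f q"
    proof (cases "1 \<le> q \<and> q \<le> N")
      case True
      then obtain w where w: "w \<in> A" "ends_at w q" using pairing_ex[OF p(1)] by blast
      have "w \<noteq> x" "w \<noteq> y"
        using w 6 x y by (auto simp: a_def b_def ends_at_def other_end_def split: if_splits)
      then have w': "w \<in> A'" "w \<in> D' \<longleftrightarrow> w \<in> D"
        using w 6 eq p by (auto simp: z_def ends_at_def min_def max_def split: if_splits)
      moreover have "dotted D q" "dotted D' q" if "w \<in> D"
        using that w w' unfolding dotted_def by blast+
      ultimately show ?thesis
        using partner_eq[OF p(1) _ w(2), of D] partner_eq[OF A'(2) _ w(2), of D']
          partner_eq_0[OF p, of q] partner_eq_0[OF A'(2,3), of q] w(1) by (cases "w \<in> D") auto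
    next
      case False
      then show ?thesis using partner_eq_0[OF p] partner_eq_0[OF A'(2,3)] by simp
    qed
    then show ?thesis using 6 fi fSi by (auto simp: rejoin_def)
  qed
qed

text \<open>A dotted arc ending strictly between p and r either crosses (p, r) or is nested in it;
  the former contradicts planarity, the latter that the arc is outer.\<close>

lemma outer_gap:
  assumes "pairing N A" "noncrossing A" "D \<subseteq> A" "\<forall>x\<in>D. outer A x" "(p, r) \<in> D" "p < q" "q < r"
  shows "\<not> dotted D q"
proof
  assume "dotted D q"
  then obtain w where w: "w \<in> D" "ends_at w q" by (auto simp: dotted_def)
  have A: "w \<in> A" "(p, r) \<in> A" using w assms by auto
  have less: "fst w < snd w" by (rule pairing_less[OF assms(1) A(1)])
  have ne: "w \<noteq> (p, r)" using w assms(6,7) by (auto simp: ends_at_def)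
  then have "\<not> ends_at w p" "\<not> ends_at w r"
    using pairing_unique[OF assms(1) A] by (auto simp: ends_at_def)
  then have "fst w \<noteq> p" "snd w \<noteq> p" "fst w \<noteq> r" "snd w \<noteq> r" by (auto simp: ends_at_def)
  moreover have "\<not> (p < fst w \<and> fst w < r \<and> r < snd w)" "\<not> (fst w < p \<and> p < snd w \<and> snd w < r)"
    using assms(2) A unfolding noncrossing_def by (metis fst_conv snd_conv)+
  moreover have "\<not> (p < fst w \<and> snd w < r)"
    using assms(4) w(1) A(2) less by (force simp: outer_def nested_def)
  ultimately show False using w(2) less assms(6,7) unfolding ends_at_def by linarith
qed

text \<open>Undotted arcs can be read off the partner function. Of the dotted arcs it reveals only
  the set of endpoints; by \<open>outer_gap\<close> these are paired up consecutively, which is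
  exploited from left to right by induction on the left end.\<close>

lemma B_diagrams_eqI:
  assumes b: "(A, D) \<in> B_diagrams n k" and b': "(A', D') \<in> B_diagrams n k"
    and eq: "partner (A, D) = partner (A', D')"
  shows "(A, D) = (A', D')"
proof -
  have p: "pairing (2 * n) A" "D \<subseteq> A" and p': "pairing (2 * n) A'" "D' \<subseteq> A'"
    using b b' by (simp_all add: B_diagrams_iff)
  have undotted: "A - D \<subseteq> A' - D'" if p: "pairing (2 * n) A" "D \<subseteq> A" and p': "pairing (2 * n) A'" "D' \<subseteq> A'"
    and eq: "partner (A, D) = partner (A', D')" for A D A' D'
  proof
    fix x assume x: "x \<in> A - D"
    have "ends_at x (fst x)" by (simp add: ends_at_def)
    then have "partner (A', D') (fst x) = snd x"
      using partner_eq[OF p(1) x, of "fst x"] eq by (simp add: other_end_def)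
    moreover have "snd x \<noteq> 0" and less: "fst x < snd x" using pairing_less[OF p(1), of x] x by auto
    ultimately obtain y where y: "y \<in> A' - D'" "ends_at y (fst x)" "other_end y (fst x) = snd x"
      by (cases rule: partner_cases[OF p', of "fst x"]) auto
    then have "y = x"
      using pairing_less[OF p'(1), of y] less
      by (cases x; cases y) (auto simp: ends_at_def other_end_def split: if_splits)
    then show "x \<in> A' - D'" using y by simp
  qed
  have dotted_iff: "dotted D q \<longleftrightarrow> dotted D' q" for q
  proof (cases "1 \<le> q \<and> q \<le> 2 * n")
    case True
    then show ?thesis using partner_eq_0_iff[OF p, of q] partner_eq_0_iff[OF p', of q] eq by simp
  next
    case False
    then show ?thesis
      using pairing_range[OF p(1)] pairing_range[OF p'(1)] p(2) p'(2) unfolding dotted_def by blast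
  qed
  have dotted_eq: "(q, r) \<in> D'"
    if b: "(A, D) \<in> B_diagrams n k" and b': "(A', D') \<in> B_diagrams n k"
      and IH: "\<And>s r. s < q \<Longrightarrow> (s, r) \<in> D \<longleftrightarrow> (s, r) \<in> D'"
      and d: "\<And>q. dotted D q \<longleftrightarrow> dotted D' q" and qr: "(q, r) \<in> D" for A D A' D' q r
  proof -
    have B: "pairing (2 * n) A" "noncrossing A" "D \<subseteq> A" "\<forall>x\<in>D. outer A x"
      "pairing (2 * n) A'" "noncrossing A'" "D' \<subseteq> A'" "\<forall>x\<in>D'. outer A' x"
      using b b' by (simp_all add: B_diagrams_iff)
    have "dotted D q" "dotted D r" using qr by (force simp: dotted_def ends_at_def)+
    then obtain y where y: "y \<in> D'" "ends_at y q" using d by (auto simp: dotted_def)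
    have yl: "fst y < snd y" using pairing_less[OF B(5)] y B by auto
    have ql: "q < r" using pairing_less[OF B(1), of "(q, r)"] qr B by auto
    \<comment> \<open>If q were a right end in \<open>D'\<close>, that arc would start further left,
      so by induction it would belong to \<open>D\<close> too and coincide with (q, r).\<close>
    have "fst y = q"
    proof (rule ccontr)
      assume "fst y \<noteq> q"
      then have "snd y = q" "fst y < q" using y yl by (auto simp: ends_at_def)
      then have "y \<in> D" using IH[of "fst y" "snd y"] y by (cases y) auto
      then have "y = (q, r)"
        using pairing_unique[OF B(1), of y "(q, r)" q] B(3) y qr by (auto simp: ends_at_def)
      then show False using \<open>fst y \<noteq> q\<close> by simp
    qed
    then have y': "(q, snd y) \<in> D'" "q < snd y" using y yl by (cases y; auto)+
    then have "dotted D' (snd y)"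
      unfolding dotted_def ends_at_def by (intro bexI[of _ "(q, snd y)"]) simp_all
    then have "dotted D (snd y)" by (simp add: d)
    \<comment> \<open>If the right ends differed, the smaller one would be a dotted point strictly
      under the other arc.\<close>
    then have "snd y = r"
      using outer_gap[OF B(1-4) qr, of "snd y"] outer_gap[OF B(5-8) y'(1) ql] y'(2) \<open>dotted D r\<close> d
      by (meson linorder_neqE_nat)
    then show ?thesis using y' by simp
  qed
  have "(q, r) \<in> D \<longleftrightarrow> (q, r) \<in> D'" for q r
  proof (induction q arbitrary: r rule: less_induct)
    case (less q)
    show ?case
      using dotted_eq[OF b b' _ dotted_iff] dotted_eq[OF b' b _ dotted_iff[symmetric]] less.IH by blast
  qed
  then have "D = D'" by auto
  moreover have "A - D = A' - D'"
    using undotted[OF p p' eq] undotted[OF p' p eq[symmetric]] by blast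
  ultimately show ?thesis using p p' by auto
qed

lemma tl_partner:
  assumes b: "b \<in> B_diagrams n k" and i: "i \<in> {1..<2 * n}"
  shows "tl_gen i b = (if partner b i = Suc i then smul (- qhalf 2 - qhalf (- 2)) (basis b)
      else if partner b i = 0 \<and> partner b (Suc i) = 0 then 0 else basis (reconnect i b))"
    and "partner b i \<noteq> Suc i \<Longrightarrow> \<not> (partner b i = 0 \<and> partner b (Suc i) = 0) \<Longrightarrow>
      reconnect i b \<in> B_diagrams n k \<and> partner (reconnect i b) = rejoin i (Suc i) (partner b)"
proof -
  obtain A D where b': "b = (A, D)" by (cases b)
  have p: "pairing (2 * n) A" "D \<subseteq> A" using b by (auto simp: b' B_diagrams_iff)
  have d: "partner b i = 0 \<longleftrightarrow> dotted D i" "partner b (Suc i) = 0 \<longleftrightarrow> dotted D (Suc i)"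
    using partner_eq_0_iff[OF p] i by (auto simp: b')
  show tl_gen: "tl_gen i b = (if partner b i = Suc i then smul (- qhalf 2 - qhalf (- 2)) (basis b)
      else if partner b i = 0 \<and> partner b (Suc i) = 0 then 0 else basis (reconnect i b))"
    unfolding d unfolding b' partner_eq_Suc_iff[OF p] by (simp add: tl_gen_def)
  assume *: "partner b i \<noteq> Suc i" "\<not> (partner b i = 0 \<and> partner b (Suc i) = 0)"
  \<comment> \<open>In this case \<open>tl_gen i b\<close> is a single basis vector, so stability of
    the span yields membership of the diagram itself.\<close>
  then have B: "reconnect i b \<in> B_diagrams n k"
    using tl_Rbar[OF b i] by (simp only: tl_gen * if_False basis_Rbar_iff)
  obtain A' D' where r: "reconnect i b = (A', D')" by (cases "reconnect i b")
  have "partner (A', D') = rejoin i (Suc i) (partner (A, D))"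
  proof (rule partner_reconnect[OF p])
    show "1 \<le> i" "i < 2 * n" using i by auto
    show "(i, Suc i) \<notin> A - D" using *(1) partner_eq_Suc_iff[OF p] by (simp add: b')
    show "\<not> (dotted D i \<and> dotted D (Suc i))" using *(2) d by simp
    show "reconnect i (A, D) = (A', D')" using r b' by simp
    show "pairing (2 * n) A'" "D' \<subseteq> A'" using B r by (auto simp: B_diagrams_iff)
  qed
  then show "reconnect i b \<in> B_diagrams n k \<and> partner (reconnect i b) = rejoin i (Suc i) (partner b)"
    using B r b' by simp
qed

section \<open>The Temperley--Lieb and braid relations\<close>

lemma tl_joined:
  assumes "b \<in> B_diagrams n k" "i \<in> {1..<2 * n}" "partner b i = Suc i"
  shows "tl_gen i b = smul (- qhalf 2 - qhalf (- 2)) (basis b)"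
  using tl_partner(1)[OF assms(1,2)] assms(3) by simp

lemma tl_zero:
  assumes "b \<in> B_diagrams n k" "i \<in> {1..<2 * n}" "partner b i = 0" "partner b (Suc i) = 0"
  shows "tl_gen i b = 0"
  using tl_partner(1)[OF assms(1,2)] assms(3,4) by simp

lemma tl_basis:
  assumes "b \<in> B_diagrams n k" "i \<in> {1..<2 * n}" "partner b i \<noteq> Suc i"
    "\<not> (partner b i = 0 \<and> partner b (Suc i) = 0)"
  obtains b' where "b' \<in> B_diagrams n k" "tl_gen i b = basis b'" "partner b' = rejoin i (Suc i) (partner b)"
proof (rule that)
  show "tl_gen i b = basis (reconnect i b)"
    unfolding tl_partner(1)[OF assms(1,2)] using assms(3,4) by (simp only: if_False)
qed (use tl_partner(2)[OF assms] in auto)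

lemma B_diagrams_eq_iff:
  "b \<in> B_diagrams n k \<Longrightarrow> b' \<in> B_diagrams n k \<Longrightarrow> partner b = partner b' \<longleftrightarrow> b = b'"
  by (metis B_diagrams_eqI surj_pair)

lemma partner_fun_B: "b \<in> B_diagrams n k \<Longrightarrow> partner_fun (partner b)"
  by (metis B_diagrams_iff partner_fun_partner surj_pair)

lemma rejoin_self: "i \<noteq> 0 \<Longrightarrow> rejoin i i' f i = i'"
  by (simp add: rejoin_def)

lemma tl_square:
  assumes b: "b \<in> B_diagrams n k" and i: "i \<in> {1..<2 * n}"
  shows "lin_ext (tl_gen i) (tl_gen i b) = smul (- qhalf 2 - qhalf (- 2)) (tl_gen i b)"
proof -
  consider "partner b i = Suc i" | "partner b i = 0 \<and> partner b (Suc i) = 0"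
    | "partner b i \<noteq> Suc i" "\<not> (partner b i = 0 \<and> partner b (Suc i) = 0)" by blast
  then show ?thesis
  proof cases
    case 1
    then show ?thesis by (simp add: tl_joined[OF b i] lin_ext_smul)
  next
    case 2
    then show ?thesis by (simp add: tl_zero[OF b i])
  next
    case 3
    then obtain b' where b': "b' \<in> B_diagrams n k" "tl_gen i b = basis b'"
      "partner b' = rejoin i (Suc i) (partner b)" by (rule tl_basis[OF b i])
    then have "partner b' i = Suc i" using i by (simp add: rejoin_self)
    then show ?thesis using tl_joined[OF b'(1) i] b'(2) by simp
  qed
qed

text \<open>The relation U_i U_j U_i = U_i for neighbours reduces to this, because U_i b is always a
  multiple of a diagram joining i and i + 1.\<close>

lemma tl_cancel:
  assumes b: "b \<in> B_diagrams n k" and i: "i \<in> {1..<2 * n}" "partner b i = Suc i"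
    and j: "j \<in> {1..<2 * n}" "j = Suc i \<or> i = Suc j"
  shows "lin_ext (tl_gen i) (tl_gen j b) = basis b"
proof -
  let ?f = "partner b"
  note f = partner_fun_B[OF b]
  have Si: "?f (Suc i) = i" using partner_fun_eqD[OF f i(2)] by simp
  have "?f j \<noteq> Suc j" "\<not> (?f j = 0 \<and> ?f (Suc j) = 0)" using i j Si partner_fun_eqD[OF f, of j "Suc j"] by auto
  then obtain b1 where b1: "b1 \<in> B_diagrams n k" "tl_gen j b = basis b1" "partner b1 = rejoin j (Suc j) ?f"
    by (rule tl_basis[OF b j(1)])
  have "partner b1 i \<noteq> Suc i" "\<not> (partner b1 i = 0 \<and> partner b1 (Suc i) = 0)"
    using i j Si partner_fun_neq[OF f, of "Suc (Suc i)"] partner_fun_eqD[OF f, of "Suc (Suc i)" "Suc i"]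
    by (auto simp: b1(3) rejoin_def)
  then obtain b2 where b2: "b2 \<in> B_diagrams n k" "tl_gen i b1 = basis b2" "partner b2 = rejoin i (Suc i) (partner b1)"
    by (rule tl_basis[OF b1(1) i(1)])
  have "partner b2 = ?f"
    using j rejoin_cancel[OF f i(2)] i(1) by (auto simp: b1(3) b2(3))
  then have "b2 = b" using B_diagrams_eq_iff[OF b2(1) b] by simp
  then show ?thesis by (simp add: b1(2) b2(2))
qed

lemma tl_triple:
  assumes b: "b \<in> B_diagrams n k" and i: "i \<in> {1..<2 * n}"
    and j: "j \<in> {1..<2 * n}" "j = Suc i \<or> i = Suc j"
  shows "lin_ext (tl_gen i) (lin_ext (tl_gen j) (tl_gen i b)) = tl_gen i b"
proof -
  consider "partner b i = Suc i" | "partner b i = 0 \<and> partner b (Suc i) = 0"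
    | "partner b i \<noteq> Suc i" "\<not> (partner b i = 0 \<and> partner b (Suc i) = 0)" by blast
  then show ?thesis
  proof cases
    case 1
    then show ?thesis using tl_cancel[OF b i 1 j] by (simp add: tl_joined[OF b i] lin_ext_smul)
  next
    case 2
    then show ?thesis by (simp add: tl_zero[OF b i])
  next
    case 3
    then obtain b' where b': "b' \<in> B_diagrams n k" "tl_gen i b = basis b'"
      "partner b' = rejoin i (Suc i) (partner b)" by (rule tl_basis[OF b i])
    then have "partner b' i = Suc i" using i by (simp add: rejoin_self)
    then show ?thesis using tl_cancel[OF b'(1) i _ j] b'(2) by simp
  qed
qed

text \<open>An undotted arc at one place, or two dotted points there, survive the operation at the
  other place; this is \<open>special\<close>. Otherwise U_i b and U_j b are single diagrams, and
  the first joining may connect the points of the second, leave both of them dotted, or do neither.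
  In the last case \<open>rejoin_commute_at\<close> applies, and diagrams are compared through their
  partner functions.\<close>

lemma tl_commute:
  assumes b: "b \<in> B_diagrams n k" and i: "i \<in> {1..<2 * n}" and j: "j \<in> {1..<2 * n}"
    and far: "Suc i < j \<or> Suc j < i"
  shows "lin_ext (tl_gen i) (tl_gen j b) = lin_ext (tl_gen j) (tl_gen i b)"
proof -
  note f = partner_fun_B[OF b]
  have special: "lin_ext (tl_gen i) (tl_gen j b) = lin_ext (tl_gen j) (tl_gen i b)"
    if i: "i \<in> {1..<2 * n}" and j: "j \<in> {1..<2 * n}" and far: "Suc i < j \<or> Suc j < i"
      and special: "partner b i = Suc i \<or> partner b i = 0 \<and> partner b (Suc i) = 0" for i j
  proof -
    have d: "distinct [0, i, Suc i, j, Suc j]" using i j far by auto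
    consider "partner b j = Suc j" | "partner b j = 0 \<and> partner b (Suc j) = 0"
      | "partner b j \<noteq> Suc j" "\<not> (partner b j = 0 \<and> partner b (Suc j) = 0)" by blast
    then show ?thesis
    proof cases
      case 1
      then show ?thesis using special
        by (auto simp: tl_joined[OF b i] tl_zero[OF b i] tl_joined[OF b j] lin_ext_smul)
    next
      case 2
      then show ?thesis using special
        by (auto simp: tl_joined[OF b i] tl_zero[OF b i] tl_zero[OF b j] lin_ext_smul)
    next
      case 3
      then obtain b' where b': "b' \<in> B_diagrams n k" "tl_gen j b = basis b'"
        "partner b' = rejoin j (Suc j) (partner b)" by (rule tl_basis[OF b j])
      then show ?thesis
        using special rejoin_far_joined[OF f d] rejoin_far_zero[OF f d]
        by (auto simp: tl_joined[OF b i] tl_zero[OF b i] tl_joined[OF b'(1) i] tl_zero[OF b'(1) i] lin_ext_smul)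
    qed
  qed
  show ?thesis
  proof (cases "(partner b i = Suc i \<or> partner b i = 0 \<and> partner b (Suc i) = 0) \<or>
      (partner b j = Suc j \<or> partner b j = 0 \<and> partner b (Suc j) = 0)")
    case True
    then show ?thesis using special[OF i j far] special[OF j i] far by auto
  next
    case False
    then obtain b1 b2 where b1: "b1 \<in> B_diagrams n k" "tl_gen i b = basis b1" "partner b1 = rejoin i (Suc i) (partner b)"
      and b2: "b2 \<in> B_diagrams n k" "tl_gen j b = basis b2" "partner b2 = rejoin j (Suc j) (partner b)"
      by (metis tl_basis[OF b i] tl_basis[OF b j])
    have d: "distinct [0, i, Suc i, j, Suc j]" "distinct [0, j, Suc j, i, Suc i]" using i j far by auto
    consider "partner b1 j = Suc j" | "partner b1 j = 0 \<and> partner b1 (Suc j) = 0"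
      | "partner b1 j \<noteq> Suc j" "\<not> (partner b1 j = 0 \<and> partner b1 (Suc j) = 0)" by blast
    then show ?thesis
    proof cases
      case 1
      then have "partner b2 i = Suc i" "partner b2 = partner b1"
        using rejoin_far_new_joined[OF f d(1) 1[unfolded b1(3)]] False unfolding b1(3) b2(3) by blast+
      moreover from this have "b2 = b1" using B_diagrams_eq_iff[OF b2(1) b1(1)] by simp
      ultimately show ?thesis
        using 1 by (simp add: b1(2) b2(2) tl_joined[OF b1(1) i] tl_joined[OF b1(1) j])
    next
      case 2
      then have "partner b2 i = 0 \<and> partner b2 (Suc i) = 0"
        using rejoin_far_new_zero[OF f d(1)] False by (simp add: b1(3) b2(3))
      then show ?thesis
        using 2 by (simp add: b1(2) b2(2) tl_zero[OF b2(1) i] tl_zero[OF b1(1) j])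
    next
      case 3
      have 4: "partner b2 i \<noteq> Suc i"
        using rejoin_far_new_joined[OF f d(2)] False 3(1) unfolding b1(3) b2(3) by blast
      have 5: "\<not> (partner b2 i = 0 \<and> partner b2 (Suc i) = 0)"
        using rejoin_far_new_zero[OF f d(2)] False 3(2) unfolding b1(3) b2(3) by blast
      obtain c1 where c1: "c1 \<in> B_diagrams n k" "tl_gen j b1 = basis c1" "partner c1 = rejoin j (Suc j) (partner b1)"
        using 3 by (rule tl_basis[OF b1(1) j])
      obtain c2 where c2: "c2 \<in> B_diagrams n k" "tl_gen i b2 = basis c2" "partner c2 = rejoin i (Suc i) (partner b2)"
        using 4 5 by (rule tl_basis[OF b2(1) i])
      have "partner c1 = partner c2"
        using rejoin_commute_at[OF f d(1)] 3(1) by (auto simp: b1(3) b2(3) c1(3) c2(3))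
      then have "c1 = c2" using B_diagrams_eq_iff[OF c1(1) c2(1)] by simp
      then show ?thesis by (simp add: b1(2) b2(2) c1(2) c2(2))
    qed
  qed
qed

section \<open>The braid group action on dotted matchings\<close>

definition braid_letter :: "nat \<times> bool \<Rightarrow> (diagram \<Rightarrow>\<^sub>0 laurent) \<Rightarrow> (diagram \<Rightarrow>\<^sub>0 laurent)" where
  "braid_letter = (\<lambda>(i, s) x.
     smul (qhalf (if s then - 1 else 1)) x + smul (qhalf (if s then 1 else - 1)) (lin_ext (tl_gen i) x))"

definition braid_act :: "braid_word \<Rightarrow> (diagram \<Rightarrow>\<^sub>0 laurent) \<Rightarrow> (diagram \<Rightarrow>\<^sub>0 laurent)" where
  "braid_act w x = foldr braid_letter w x"

lemma braid_act_simps [simp]: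
  "braid_act [] x = x" "braid_act (l # w) x = braid_letter l (braid_act w x)"
  "braid_act (v @ w) x = braid_act v (braid_act w x)"
  by (simp_all add: braid_act_def)

lemma braid_letter_linear:
  "braid_letter l (x + y) = braid_letter l x + braid_letter l y"
  "braid_letter l (smul c x) = smul c (braid_letter l x)"
  by (auto simp: braid_letter_def lin_ext_add lin_ext_smul lmod.scale_right_distrib mult.commute split: prod.split)

lemma braid_act_linear:
  "braid_act w (x + y) = braid_act w x + braid_act w y"
  "braid_act w (smul c x) = smul c (braid_act w x)"
  by (induction w) (simp_all add: braid_letter_linear)

lemma lin_ext_tl_Rbar: "x \<in> Rbar n k \<Longrightarrow> i \<in> {1..<2 * n} \<Longrightarrow> lin_ext (tl_gen i) x \<in> Rbar n k"
  by (rule lin_ext_span[OF subspace_Rbar, of "basis ` B_diagrams n k"]) (auto simp: tl_Rbar Rbar_def[symmetric])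

lemma braid_act_Rbar: "w \<in> braid_words (2 * n) \<Longrightarrow> x \<in> Rbar n k \<Longrightarrow> braid_act w x \<in> Rbar n k"
proof (induction w)
  case (Cons l w)
  obtain i s where l: "l = (i, s)" by (cases l)
  have "i \<in> {1..<2 * n}" "w \<in> braid_words (2 * n)" using Cons.prems by (auto simp: l braid_words_def)
  then have "braid_act w x \<in> Rbar n k" "lin_ext (tl_gen i) (braid_act w x) \<in> Rbar n k"
    using Cons by (auto intro!: lin_ext_tl_Rbar)
  then show ?case
    by (auto simp: l braid_letter_def intro!: lmod.subspace_add[OF subspace_Rbar] lmod.subspace_scale[OF subspace_Rbar])
qed simp

lemma lin_ext_tl_square:
  assumes i: "i \<in> {1..<2 * n}" and x: "x \<in> Rbar n k"
  shows "lin_ext (tl_gen i) (lin_ext (tl_gen i) x) = smul (- qhalf 2 - qhalf (- 2)) (lin_ext (tl_gen i) x)"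
  using x unfolding Rbar_def
  by (induction rule: lmod.span_induct_alt)
    (auto simp: lin_ext_add lin_ext_smul lmod.scale_right_distrib tl_square[OF _ i] mult.commute)

lemma lin_ext_tl_triple:
  assumes i: "i \<in> {1..<2 * n}" and j: "j \<in> {1..<2 * n}" "j = Suc i \<or> i = Suc j" and x: "x \<in> Rbar n k"
  shows "lin_ext (tl_gen i) (lin_ext (tl_gen j) (lin_ext (tl_gen i) x)) = lin_ext (tl_gen i) x"
  using x unfolding Rbar_def
  by (induction rule: lmod.span_induct_alt)
    (auto simp: lin_ext_add lin_ext_smul lmod.scale_right_distrib tl_triple[OF _ i j])

lemma lin_ext_tl_commute:
  assumes i: "i \<in> {1..<2 * n}" and j: "j \<in> {1..<2 * n}" "Suc i < j \<or> Suc j < i" and x: "x \<in> Rbar n k"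
  shows "lin_ext (tl_gen i) (lin_ext (tl_gen j) x) = lin_ext (tl_gen j) (lin_ext (tl_gen i) x)"
  using x unfolding Rbar_def
  by (induction rule: lmod.span_induct_alt)
    (auto simp: lin_ext_add lin_ext_smul lmod.scale_right_distrib tl_commute[OF _ i j])

lemma qhalf_mult_left: "qhalf i * (qhalf j * c) = qhalf (i + j) * c"
  by (simp add: qhalf_mult flip: mult.assoc)

text \<open>Expand both sides and apply U_i U_i = (-q - 1/q) U_i and U_i U_j U_i = U_i with j = i +
  1. On the left U_i gets the coefficient 2 q^(-1/2) + q^(1/2) (-q - 1/q) + q^(3/2) = q^(-1/2), the
  same as U_j, so the result is symmetric in i and j.\<close>

lemma braid_relation:
  assumes "i \<in> {1..<2 * n}" "Suc i \<in> {1..<2 * n}" "x \<in> Rbar n k"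
  shows "braid_act [(i, True), (Suc i, True), (i, True)] x = braid_act [(Suc i, True), (i, True), (Suc i, True)] x"
proof -
  note triple = lin_ext_tl_triple[OF assms(1,2) disjI1[OF HOL.refl] assms(3)]
    lin_ext_tl_triple[OF assms(2,1) disjI2[OF HOL.refl] assms(3)]
  note square = lin_ext_tl_square[OF assms(1,3)] lin_ext_tl_square[OF assms(2,3)]
  show ?thesis
    unfolding braid_act_simps braid_letter_def prod.case if_True lin_ext_add lin_ext_smul square triple
    by (rule poly_mapping_eqI)
      (simp add: lookup_add lookup_smul algebra_simps qhalf_mult qhalf_mult_left)
qed

lemma braid_act_eq:
  assumes "braid_eq (2 * n) u v" "x \<in> Rbar n k"
  shows "braid_act u x = braid_act v x"
  using assms
proof (induction arbitrary: x rule: braid_eq.induct)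
  \<comment> \<open>The relations are known on \<open>Rbar\<close> only, so it matters that the
    action of the suffix stays there.\<close>
  case (cong u v w y)
  then show ?case using braid_act_Rbar by simp
next
  \<comment> \<open>The product (q^(-1/2) + q^(1/2) U) (q^(1/2) + q^(-1/2) U) equals 1 + (q + 1/q) U
    + U U, and the last two summands cancel.\<close>
  case (inverse i s)
  show ?case
    unfolding braid_act_simps braid_letter_def prod.case lin_ext_add lin_ext_smul
      lin_ext_tl_square[OF inverse]
    by (rule poly_mapping_eqI)
      (cases s; simp add: lookup_add lookup_smul algebra_simps qhalf_mult qhalf_mult_left)
next
  case (far i j)
  then show ?case
    using lin_ext_tl_commute[OF far(1,2) _ far(4)]
    by (intro poly_mapping_eqI[where 'b = laurent])
      (simp add: braid_letter_def lin_ext_add lin_ext_smul lookup_add lookup_smul algebra_simps)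
next
  case (braid i)
  then show ?case using braid_relation[of i n x k] by simp
qed auto

lemma ex_Rbar_action: "\<exists>\<rho>. is_Rbar_action n k \<rho>"
proof -
  \<comment> \<open>A representative word of the class is chosen; \<open>braid_act_eq\<close> makes
    the choice irrelevant. The restriction to \<open>Rbar n k\<close> is there because the elements
    of \<open>BijGroup\<close> are extensional functions.\<close>
  define \<rho> where "\<rho> g = (\<lambda>x\<in>Rbar n k. braid_act (SOME w. w \<in> g \<and> w \<in> braid_words (2 * n)) x)" for g
  have \<rho>: "\<rho> (braid_class (2 * n) w) x = braid_act w x" if w: "w \<in> braid_words (2 * n)" and x: "x \<in> Rbar n k" for w x
  proof -
    let ?w = "SOME v. v \<in> braid_class (2 * n) w \<and> v \<in> braid_words (2 * n)"
    have "\<exists>v. v \<in> braid_class (2 * n) w \<and> v \<in> braid_words (2 * n)"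
      using braid_eq.refl[OF w] w by (simp only: mem_braid_class) blast
    from someI_ex[OF this] have "braid_eq (2 * n) w ?w" by (simp only: mem_braid_class)
    then have "braid_act ?w x = braid_act w x" using braid_act_eq[OF _ x] by simp
    then show ?thesis using x by (simp add: \<rho>_def)
  qed
  have inv: "braid_act (braid_word_inv w) (braid_act w x) = x" "braid_act w (braid_act (braid_word_inv w) x) = x"
    if w: "w \<in> braid_words (2 * n)" and x: "x \<in> Rbar n k" for w x
  proof -
    have "braid_word_inv (braid_word_inv w) = w"
      by (simp add: braid_word_inv_def rev_map comp_def case_prod_unfold)
    then show "braid_act (braid_word_inv w) (braid_act w x) = x" "braid_act w (braid_act (braid_word_inv w) x) = x"
      using braid_act_eq[OF braid_word_inv_append[OF w] x]
        braid_act_eq[OF braid_word_inv_append[OF braid_word_inv_words[OF w]] x] by simp_all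
  qed
  have Bij: "\<rho> (braid_class (2 * n) w) \<in> Bij (Rbar n k)" if w: "w \<in> braid_words (2 * n)" for w
  proof -
    have "bij_betw (\<rho> (braid_class (2 * n) w)) (Rbar n k) (Rbar n k)"
      by (rule bij_betwI[where g = "braid_act (braid_word_inv w)"])
        (auto simp: \<rho> w inv braid_act_Rbar braid_word_inv_words)
    then show ?thesis by (simp add: Bij_def \<rho>_def)
  qed
  have "group_hom (braid_group (2 * n)) (BijGroup (Rbar n k)) \<rho>"
  proof (intro group_hom.intro group_hom_axioms.intro homI)
    show "group (braid_group (2 * n))" by (rule group_braid_group)
    show "group (BijGroup (Rbar n k))" by (rule group_BijGroup)
    show "\<rho> g \<in> carrier (BijGroup (Rbar n k))" if "g \<in> carrier (braid_group (2 * n))" for g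
      using that Bij by (auto simp: BijGroup_def elim!: carrier_braid_groupE)
    show "\<rho> (g \<otimes>\<^bsub>braid_group (2 * n)\<^esub> h) = \<rho> g \<otimes>\<^bsub>BijGroup (Rbar n k)\<^esub> \<rho> h"
      if gh: "g \<in> carrier (braid_group (2 * n))" "h \<in> carrier (braid_group (2 * n))" for g h
    proof -
      obtain u v where u: "u \<in> braid_words (2 * n)" "g = braid_class (2 * n) u"
        and v: "v \<in> braid_words (2 * n)" "h = braid_class (2 * n) v"
        using gh by (metis carrier_braid_groupE)
      have uv: "u @ v \<in> braid_words (2 * n)" using u v by (simp add: braid_words_def)
      have "\<rho> (braid_class (2 * n) (u @ v)) = compose (Rbar n k) (\<rho> g) (\<rho> h)"
      proof
        fix x
        show "\<rho> (braid_class (2 * n) (u @ v)) x = compose (Rbar n k) (\<rho> g) (\<rho> h) x"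
        proof (cases "x \<in> Rbar n k")
          case True
          then show ?thesis
            using \<rho>[OF uv True] \<rho>[OF v(1) True] \<rho>[OF u(1) braid_act_Rbar[OF v(1) True]] u v
            by (simp add: compose_def)
        next
          case False
          then show ?thesis by (simp add: compose_def \<rho>_def)
        qed
      qed
      then show ?thesis
        using Bij[OF u(1)] Bij[OF v(1)] u v by (simp add: BijGroup_def braid_mult)
    qed
  qed
  moreover have "\<rho> g (x + y) = \<rho> g x + \<rho> g y \<and> \<rho> g (smul c x) = smul c (\<rho> g x)"
    if g: "g \<in> carrier (braid_group (2 * n))" and xy: "x \<in> Rbar n k" "y \<in> Rbar n k" for g c x y
  proof -
    obtain w where w: "w \<in> braid_words (2 * n)" "g = braid_class (2 * n) w"
      using g by (rule carrier_braid_groupE)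
    then show ?thesis
      using xy by (simp add: \<rho> braid_act_linear lmod.subspace_add[OF subspace_Rbar] lmod.subspace_scale[OF subspace_Rbar])
  qed
  moreover have "\<rho> (sigma (2 * n) i) (basis b) = sigma_formula i b" if "i \<in> {1..<2 * n}" "b \<in> B_diagrams n k" for i b
  proof -
    obtain A D where b: "b = (A, D)" by (cases b)
    have "pairing (2 * n) A" "D \<subseteq> A" using that(2) by (auto simp: b B_diagrams_iff)
    then show ?thesis
      using \<rho>[of "[(i, True)]" "basis b"] that
      by (simp add: sigma_def braid_words_def braid_letter_def b sigma_formula_tl)
  qed
  ultimately have "is_Rbar_action n k \<rho>"
    unfolding is_Rbar_action_def group_action_def by blast
  then show ?thesis by (rule exI[where x = \<rho>])
qed

section \<open>Words of slices\<close>

lemma tangle_index: "tangle a w \<Longrightarrow> a = b \<Longrightarrow> tangle b w"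
  by simp

lemma tangle_Nil [simp]: "tangle m [] \<longleftrightarrow> m = 0"
  by (auto elim: tangle.cases intro: tangle.empty)

text \<open>The computational form of the inductive rule. Since i is at least 1, the bound forces
  \<open>legs_up s \<le> m\<close>, so the subtraction does not truncate.\<close>

lemma tangle_Cons [simp]:
  "tangle m ((s, i) # w) \<longleftrightarrow> 1 \<le> i \<and> i + legs_up s \<le> Suc m \<and> tangle (m - legs_up s + legs_down s) w"
proof
  assume "tangle m ((s, i) # w)"
  then show "1 \<le> i \<and> i + legs_up s \<le> Suc m \<and> tangle (m - legs_up s + legs_down s) w"
    by (cases rule: tangle.cases) (auto simp: ac_simps)
next
  assume *: "1 \<le> i \<and> i + legs_up s \<le> Suc m \<and> tangle (m - legs_up s + legs_down s) w"
  have "tangle ((i - 1) + legs_up s + (m - legs_up s - (i - 1))) ((s, (i - 1) + 1) # w)"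
    using * by (intro tangle.slice) (auto elim: tangle_index)
  then show "tangle m ((s, i) # w)" using * by (auto elim: tangle_index)
qed

text \<open>The prefix \<open>u\<close> determines how many strands reach \<open>v\<close>;
  quantifying over this number allows local replacements without computing it.\<close>

lemma tangle_append_mono:
  "tangle m (u @ v) \<Longrightarrow> (\<And>m. tangle m v \<Longrightarrow> tangle m v') \<Longrightarrow> tangle m (u @ v')"
  by (induction u arbitrary: m) auto

lemma tangle_append_iff:
  "(\<And>m. tangle m v \<longleftrightarrow> tangle m v') \<Longrightarrow> tangle m (u @ v) \<longleftrightarrow> tangle m (u @ v')"
  using tangle_append_mono by blast

lemma tangle_distant:
  "j \<le> p \<Longrightarrow> tangle m ((t, p + 2) # (Cup, j) # w) \<longleftrightarrow> tangle m ((Cup, j) # (t, p) # w)"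
  by (cases t) (auto simp: numeral_eq_Suc elim!: tangle_index)

lemma subspace_Stilde_null: "lsubspace (Stilde_null n k)"
  unfolding Stilde_null_def by (rule lmod.subspace_span)

lemma skein_relation_mod_eq: "x - y \<in> skein_relations n k \<Longrightarrow> mod_eq (Stilde_null n k) x y"
  unfolding mod_eq_def Stilde_null_def by (rule lmod.span_base)

lemma isotopy_mod_eq:
  "isotopy_move v v' \<Longrightarrow> tangle (2 * (n + k)) (u @ v @ w) \<Longrightarrow> tangle (2 * (n + k)) (u @ v' @ w) \<Longrightarrow>
    mod_eq (Stilde_null n k) (basis (u @ v @ w)) (basis (u @ v' @ w))"
  by (intro skein_relation_mod_eq skein_relations.isotopy)

lemma circle_mod_eq:
  "tangle (2 * (n + k)) (u @ (Cap, i) # (Cup, i) # w) \<Longrightarrow>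
    mod_eq (Stilde_null n k) (basis (u @ (Cap, i) # (Cup, i) # w)) (smul (- qhalf 2 - qhalf (- 2)) (basis (u @ w)))"
  using skein_relations.circle[of n k u i w] by (intro skein_relation_mod_eq) simp

lemma pos_mod_eq:
  "tangle (2 * (n + k)) (u @ (Pos, i) # w) \<Longrightarrow> mod_eq (Stilde_null n k) (basis (u @ (Pos, i) # w))
    (smul (qhalf 1) (basis (u @ (Cup, i) # (Cap, i) # w)) + smul (qhalf (- 1)) (basis (u @ w)))"
  using skein_relations.pos_crossing[of n k u i w] by (intro skein_relation_mod_eq) simp

lemma neg_mod_eq:
  "tangle (2 * (n + k)) (u @ (Neg, i) # w) \<Longrightarrow> mod_eq (Stilde_null n k) (basis (u @ (Neg, i) # w))
    (smul (qhalf 1) (basis (u @ w)) + smul (qhalf (- 1)) (basis (u @ (Cup, i) # (Cap, i) # w)))"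
  using skein_relations.neg_crossing[of n k u i w] by (intro skein_relation_mod_eq) simp

lemma zigzag_mod_eq:
  "tangle (2 * (n + k)) (u @ (Cap, i) # (Cup, Suc i) # w) \<Longrightarrow> mod_eq (Stilde_null n k)
    (basis (u @ (Cap, i) # (Cup, Suc i) # w)) (basis (u @ w))"
  "tangle (2 * (n + k)) (u @ (Cap, Suc i) # (Cup, i) # w) \<Longrightarrow> mod_eq (Stilde_null n k)
    (basis (u @ (Cap, Suc i) # (Cup, i) # w)) (basis (u @ w))"
proof -
  have t: "tangle m w" if "tangle m ((Cap, i) # (Cup, Suc i) # w) \<or> tangle m ((Cap, Suc i) # (Cup, i) # w)" for m
    using that by auto
  show "mod_eq (Stilde_null n k) (basis (u @ (Cap, i) # (Cup, Suc i) # w)) (basis (u @ w))"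
    if *: "tangle (2 * (n + k)) (u @ (Cap, i) # (Cup, Suc i) # w)"
  proof -
    have "tangle (2 * (n + k)) (u @ w)" by (rule tangle_append_mono[OF *], rule t) simp
    then show ?thesis using isotopy_mod_eq[OF isotopy_move.zigzag_left, of n k u i w] * by simp
  qed
  show "mod_eq (Stilde_null n k) (basis (u @ (Cap, Suc i) # (Cup, i) # w)) (basis (u @ w))"
    if *: "tangle (2 * (n + k)) (u @ (Cap, Suc i) # (Cup, i) # w)"
  proof -
    have "tangle (2 * (n + k)) (u @ w)" by (rule tangle_append_mono[OF *], rule t) simp
    then show ?thesis using isotopy_mod_eq[OF isotopy_move.zigzag_right, of n k u i w] * by simp
  qed
qed

text \<open>A slice to the right of a minimum has index p + 2 when it lies above the minimum, since
  the two legs are then counted, and index p when it lies below.\<close>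

lemma distant_cup_mod_eq:
  assumes "tangle (2 * (n + k)) (u @ (Cup, j) # (t, p) # w)" "j \<le> p"
  shows "mod_eq (Stilde_null n k) (basis (u @ (t, p + 2) # (Cup, j) # w)) (basis (u @ (Cup, j) # (t, p) # w))"
  using isotopy_mod_eq[OF isotopy_move.distant[of t j Cup "p - j"], of n k u w]
    tangle_append_iff[OF tangle_distant[OF assms(2), of _ t w], of "2 * (n + k)" u] assms
  by simp

lemma distant_cap_mod_eq:
  assumes "tangle (2 * (n + k)) (u @ (Cap, i) # (t, p + 2) # w)" "i \<le> p"
  shows "tangle (2 * (n + k)) (u @ (t, p) # (Cap, i) # w)"
    and "mod_eq (Stilde_null n k) (basis (u @ (Cap, i) # (t, p + 2) # w)) (basis (u @ (t, p) # (Cap, i) # w))"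
proof -
  have "tangle m ((t, p) # (Cap, i) # w)" if "tangle m ((Cap, i) # (t, p + 2) # w)" for m
    using that assms(2) by (cases t) (auto simp: numeral_eq_Suc elim!: tangle_index)
  then show *: "tangle (2 * (n + k)) (u @ (t, p) # (Cap, i) # w)"
    by (rule tangle_append_mono[OF assms(1)])
  show "mod_eq (Stilde_null n k) (basis (u @ (Cap, i) # (t, p + 2) # w)) (basis (u @ (t, p) # (Cap, i) # w))"
    by (rule mod_eq_sym[OF subspace_Stilde_null])
      (use isotopy_mod_eq[OF isotopy_move.distant[of t i Cap "p - i"], of n k u w] * assms in simp)
qed

section \<open>Reduction to cup words\<close>

definition cup_word :: "tangle \<Rightarrow> bool" where
  "cup_word w \<longleftrightarrow> (\<forall>x\<in>set w. fst x = Cup)"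

lemma cup_word_simps [simp]: "cup_word []" "cup_word ((s, i) # w) \<longleftrightarrow> s = Cup \<and> cup_word w"
  by (auto simp: cup_word_def)

lemma tangle_appendD: "tangle m (u @ v) \<Longrightarrow> \<exists>m'. tangle m' v"
  by (induction u arbitrary: m) auto

text \<open>The maximum is pushed down through the minima: it closes a circle, cancels in a zigzag,
  or slides past. It cannot reach the bottom, where it would leave two loose strands. Minima that it
  has passed join the prefix \<open>u\<close>, which is therefore arbitrary in the
  induction.\<close>

lemma cap_cup_word:
  assumes "cup_word v" "tangle (2 * (n + k)) (u @ (Cap, i) # v)"
  shows "\<exists>c v'. cup_word v' \<and> tangle (2 * (n + k)) (u @ v') \<and>
    mod_eq (Stilde_null n k) (basis (u @ (Cap, i) # v)) (smul c (basis (u @ v')))"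
  using assms
proof (induction v arbitrary: u i)
  case Nil
  then show ?case using tangle_appendD[of _ u "[(Cap, i)]"] by auto
next
  case (Cons x v)
  then obtain j where x: "x = (Cup, j)" and v: "cup_word v" by (cases x) auto
  note t = Cons.prems(2)[unfolded x]
  have tv: "tangle (2 * (n + k)) (u @ v)" by (rule tangle_append_mono[OF t]) auto
  have "j = i \<or> j = Suc i \<or> i = Suc j \<or> j = (j - 2) + 2 \<and> i \<le> j - 2 \<or> i = (i - 2) + 2 \<and> j \<le> i - 2"
    by linarith
  then consider "j = i" | "j = Suc i" | "i = Suc j" | p where "j = p + 2" "i \<le> p" | p where "i = p + 2" "j \<le> p"
    by blast
  then show ?case
  proof cases
    case 1
    then show ?thesis using circle_mod_eq[of n k u i v] t v tv x by auto
  next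
    case 2
    then have "mod_eq (Stilde_null n k) (basis (u @ (Cap, i) # x # v)) (smul 1 (basis (u @ v)))"
      using zigzag_mod_eq(1)[of n k u i v] t x by simp
    then show ?thesis using v tv by blast
  next
    case 3
    then have "mod_eq (Stilde_null n k) (basis (u @ (Cap, i) # x # v)) (smul 1 (basis (u @ v)))"
      using zigzag_mod_eq(2)[of n k u j v] t x by simp
    then show ?thesis using v tv by blast
  next
    case (4 p)
    note d = distant_cap_mod_eq[of n k u i Cup p v]
    have "tangle (2 * (n + k)) ((u @ [(Cup, p)]) @ (Cap, i) # v)" using d(1) t 4 by simp
    from Cons.IH[OF v this] obtain c v' where "cup_word v'" "tangle (2 * (n + k)) ((u @ [(Cup, p)]) @ v')"
      "mod_eq (Stilde_null n k) (basis ((u @ [(Cup, p)]) @ (Cap, i) # v)) (smul c (basis ((u @ [(Cup, p)]) @ v')))"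
      by blast
    then show ?thesis
      using mod_eq_trans[OF subspace_Stilde_null d(2)] t 4 x
      by (intro exI[of _ c] exI[of _ "(Cup, p) # v'"]) simp
  next
    case (5 p)
    have t': "tangle (2 * (n + k)) (u @ (Cup, j) # (Cap, p) # v)"
      using t tangle_append_iff[OF tangle_distant[OF 5(2), of _ Cap v], of "2 * (n + k)" u] 5 by simp
    note d = distant_cup_mod_eq[OF t' 5(2)]
    have "tangle (2 * (n + k)) ((u @ [(Cup, j)]) @ (Cap, p) # v)" using t' by simp
    from Cons.IH[OF v this] obtain c v' where "cup_word v'" "tangle (2 * (n + k)) ((u @ [(Cup, j)]) @ v')"
      "mod_eq (Stilde_null n k) (basis ((u @ [(Cup, j)]) @ (Cap, p) # v)) (smul c (basis ((u @ [(Cup, j)]) @ v')))"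
      by blast
    then show ?thesis
      using mod_eq_trans[OF subspace_Stilde_null d] 5 x
      by (intro exI[of _ c] exI[of _ "(Cup, j) # v'"]) simp
  qed
qed

text \<open>Slices are eliminated from the bottom upwards: below the slice \<open>x\<close> the word
  may be taken to consist of minima. A crossing is then resolved by its skein relation, and any
  maximum is absorbed by \<open>cap_cup_word\<close>.\<close>

lemma span_cup_words:
  assumes "tangle (2 * (n + k)) (u @ w)"
  shows "basis (u @ w) \<in> lspan (basis ` {u @ v | v. cup_word v \<and> tangle (2 * (n + k)) (u @ v)} \<union> Stilde_null n k)"
  using assms
proof (induction w arbitrary: u)
  case Nil
  then show ?case by (intro lmod.span_base UnI1 imageI CollectI exI[of _ "[]"]) simp
next
  case (Cons x w)
  obtain s i where x: "x = (s, i)" by (cases x)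
  let ?G = "\<lambda>u. basis ` {u @ v | v. cup_word v \<and> tangle (2 * (n + k)) (u @ v)}"
  let ?C = "lspan (?G u \<union> Stilde_null n k)"
  have base: "basis (u @ v) \<in> ?C" if "cup_word v" "tangle (2 * (n + k)) (u @ v)" for v
    using that by (intro lmod.span_base) blast
  have null: "y \<in> ?C" if "y \<in> Stilde_null n k" for y
    using that by (intro lmod.span_base) simp
  have C: "y \<in> ?C" if "mod_eq (Stilde_null n k) y z" "z \<in> ?C" for y z
    using lmod.span_add[OF null[of "y - z"] that(2)] that(1) by (simp add: mod_eq_def)
  have "basis (u @ (s, i) # v) \<in> ?C" if v: "cup_word v" and t: "tangle (2 * (n + k)) (u @ (s, i) # v)" for v
  proof -
    have cup_cap: "basis (u @ (Cup, i) # (Cap, i) # v) \<in> ?C" "tangle (2 * (n + k)) (u @ v)"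
      if "s = Pos \<or> s = Neg"
    proof -
      have "tangle (2 * (n + k)) ((u @ [(Cup, i)]) @ (Cap, i) # v)"
        unfolding append_assoc append_Cons append_Nil
        by (rule tangle_append_mono[OF t]) (use that in \<open>auto elim: tangle_index\<close>)
      from cap_cup_word[OF v this] obtain c v' where "cup_word v'"
        "tangle (2 * (n + k)) ((u @ [(Cup, i)]) @ v')"
        "mod_eq (Stilde_null n k) (basis ((u @ [(Cup, i)]) @ (Cap, i) # v)) (smul c (basis ((u @ [(Cup, i)]) @ v')))"
        by blast
      then show "basis (u @ (Cup, i) # (Cap, i) # v) \<in> ?C"
        using C[OF _ lmod.span_scale[OF base[of "(Cup, i) # v'"]]] by simp
      show "tangle (2 * (n + k)) (u @ v)"
        by (rule tangle_append_mono[OF t]) (use that in \<open>auto elim: tangle_index\<close>)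
    qed
    show ?thesis
    proof (cases s)
      case Cup
      then show ?thesis using base[of "(s, i) # v"] v t by simp
    next
      case Cap
      then obtain c v' where "cup_word v'" "tangle (2 * (n + k)) (u @ v')"
        "mod_eq (Stilde_null n k) (basis (u @ (Cap, i) # v)) (smul c (basis (u @ v')))"
        using cap_cup_word[OF v t[unfolded Cap]] by blast
      then show ?thesis using C[OF _ lmod.span_scale[OF base]] Cap by simp
    next
      case Pos
      then show ?thesis
        using C[OF pos_mod_eq[of n k u i v]] t cup_cap base[OF v] by (simp add: lmod.span_add lmod.span_scale)
    next
      case Neg
      then show ?thesis
        using C[OF neg_mod_eq[of n k u i v]] t cup_cap base[OF v] by (simp add: lmod.span_add lmod.span_scale)
    qed
  qed
  then have "?G (u @ [x]) \<union> Stilde_null n k \<subseteq> ?C" using null by (auto simp: x)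
  then have "lspan (?G (u @ [x]) \<union> Stilde_null n k) \<subseteq> ?C"
    by (rule lmod.span_minimal) (rule lmod.subspace_span)
  moreover have "basis ((u @ [x]) @ w) \<in> lspan (?G (u @ [x]) \<union> Stilde_null n k)"
    by (rule Cons.IH) (use Cons.prems in simp)
  ultimately show ?case by auto
qed

section \<open>Cup words with few points between the projectors\<close>

text \<open>Induction on the topmost minimum, with projectors of sizes l and r that may differ,
  since a minimum may use one projector point and one middle point. Unless it returns to a
  projector, removing it preserves c < l + r, except when it is itself the last arc, running from
  projector to projector. Hence a word without returning arcs ends with an outermost arc between the
  projectors.\<close>

lemma cup_word_few_middle:
  assumes "cup_word w" "tangle (l + c + r) w" "c < l + r"
  shows "(\<exists>a b. plain_arc w a b \<and> ({a, b} \<subseteq> {1..l} \<or> {a, b} \<subseteq> {l + c + 1..l + c + r})) \<or>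
    1 \<le> l \<and> 1 \<le> r \<and> (\<exists>v. w = phi_tangle v \<and> tangle (l + c + r - 2) v)"
  using assms
proof (induction w arbitrary: l c r)
  case (Cons x w)
  then obtain j where x: "x = (Cup, j)" and w: "cup_word w" by (cases x) auto
  have t: "1 \<le> j" "Suc j \<le> l + c + r" "tangle (l + c + r - 2) w"
    using Cons.prems(2) by (auto simp: x)
  have new: "plain_arc (x # w) j (j + 1)" unfolding x by (rule plain_arc.cup_new)
  have old: "plain_arc (x # w) (bump j a) (bump j b)" if "plain_arc w a b" for a b
    unfolding x using that by (rule plain_arc.cup_old)
  \<comment> \<open>Below the new leftmost strand all positions are shifted by one, so the minimum
    at j corresponds to one at j - 1 before \<open>phi_tangle\<close> is applied.\<close>
  have phi: "\<exists>v. x # w = phi_tangle v \<and> tangle (l + c + r - 2) v"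
    if "w = phi_tangle v" "tangle (l + c + r - 4) v" "2 \<le> j" "j \<le> l + c + r - 2" "4 \<le> l + c + r" for v
    using that by (intro exI[of _ "(Cup, j - 1) # v"]) (auto simp: x phi_tangle_def)
  \<comment> \<open>Transfers the conclusion from the word below the topmost minimum: renumbering by
    \<open>bump j\<close> carries the smaller projectors into the given ones.\<close>
  have step: ?case if IH: "(\<exists>a b. plain_arc w a b \<and> ({a, b} \<subseteq> {1..l'} \<or> {a, b} \<subseteq> {l' + c' + 1..l' + c' + r'})) \<or>
      1 \<le> l' \<and> 1 \<le> r' \<and> (\<exists>v. w = phi_tangle v \<and> tangle (l' + c' + r' - 2) v)"
    and le: "l' \<le> l" "l' < j" "r' \<le> r" "j \<le> l' + c' + 1" "l' + c' + r' + 2 = l + c + r" "l + c \<le> l' + c' + 2" for l' c' r'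
  proof -
    from IH consider a b where "plain_arc w a b" "{a, b} \<subseteq> {1..l'}"
      | a b where "plain_arc w a b" "{a, b} \<subseteq> {l' + c' + 1..l' + c' + r'}"
      | v where "1 \<le> l'" "1 \<le> r'" "w = phi_tangle v" "tangle (l' + c' + r' - 2) v" by blast
    then show ?case
    proof cases
      case (1 a b)
      then have "{bump j a, bump j b} \<subseteq> {1..l}" using le by (auto simp: bump_def)
      then show ?thesis using old[OF 1(1)] by blast
    next
      case (2 a b)
      then have "{bump j a, bump j b} \<subseteq> {l + c + 1..l + c + r}" using le by (auto simp: bump_def)
      then show ?thesis using old[OF 2(1)] by blast
    next
      case (3 v)
      have "tangle (l + c + r - 4) v" by (rule tangle_index[OF 3(4)]) (use le in linarith)
      then show ?thesis using phi[OF 3(3)] 3(1,2) le by auto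
    qed
  qed
  have lt: "c < l + r" by fact
  have IH: "(\<exists>a b. plain_arc w a b \<and> ({a, b} \<subseteq> {1..l'} \<or> {a, b} \<subseteq> {l' + c' + 1..l' + c' + r'})) \<or>
      1 \<le> l' \<and> 1 \<le> r' \<and> (\<exists>v. w = phi_tangle v \<and> tangle (l' + c' + r' - 2) v)"
    if "l' + c' + r' + 2 = l + c + r" "c' < l' + r'" for l' c' r'
    using Cons.IH[OF w, of l' c' r'] t(3) that by (metis add_diff_cancel_right')
  consider "Suc j \<le> l" | "l + c + 1 \<le> j" | "j = l" "c = 0" "l = 1" "r = 1" | "j = l" "c = 0" "2 < l + r" "1 \<le> r"
    | "j = l" "1 \<le> c" | "l < j" "Suc j \<le> l + c" | "j = l + c" "1 \<le> c" "1 \<le> r"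
    using t lt by linarith
  then show ?case
  proof cases
    case 1
    then show ?thesis using new t by (intro disjI1 exI[of _ j] exI[of _ "j + 1"]) auto
  next
    case 2
    then show ?thesis using new t by (intro disjI1 exI[of _ j] exI[of _ "j + 1"]) auto
  next
    \<comment> \<open>The word is the single minimum joining the two projectors, that is
      \<open>phi_tangle []\<close>.\<close>
    case 3
    then have "w = []" using t(3) w by (cases w) auto
    then show ?thesis using 3 x by (auto simp: phi_tangle_def)
  next
    case 4
    show ?thesis by (rule step[OF IH[of "l - 1" 0 "r - 1"]]) (use 4 t lt in auto)
  next
    case 5
    show ?thesis by (rule step[OF IH[of "l - 1" "c - 1" r]]) (use 5 t lt in auto)
  next
    case 6
    show ?thesis by (rule step[OF IH[of l "c - 2" r]]) (use 6 t lt in auto)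
  next
    case 7
    show ?thesis by (rule step[OF IH[of l "c - 1" "r - 1"]]) (use 7 t lt in auto)
  qed
qed auto

section \<open>Attaching slices\<close>

lemma lin_ext_lin_ext: "lin_ext f (lin_ext g x) = lin_ext (\<lambda>a. lin_ext f (g a)) x"
proof -
  have sum: "lin_ext f (sum h S) = (\<Sum>a\<in>S. lin_ext f (h a))" for h S
    by (induction S rule: infinite_finite_induct) (simp_all add: lin_ext_add)
  show ?thesis by (simp add: lin_ext_def[of g] lin_ext_def[of _ x] sum lin_ext_smul)
qed

definition attach_slices :: "tangle \<Rightarrow> (tangle \<Rightarrow>\<^sub>0 laurent) \<Rightarrow> (tangle \<Rightarrow>\<^sub>0 laurent)" where
  "attach_slices u = lin_ext (\<lambda>w. basis (u @ w))"

lemma attach_slices_basis [simp]: "attach_slices u (basis w) = basis (u @ w)"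
  by (simp add: attach_slices_def)

lemma attach_slices_append: "attach_slices u (attach_slices v x) = attach_slices (u @ v) x"
  by (simp add: attach_slices_def lin_ext_lin_ext)

lemma attach_slices_Nil [simp]: "attach_slices [] x = x"
proof (rule poly_mapping_eqI)
  fix a
  show "Poly_Mapping.lookup (attach_slices [] x) a = Poly_Mapping.lookup x a"
    by (simp add: attach_slices_def lin_ext_def lookup_sum lookup_smul basis_def lookup_single when_def in_keys_iff
        if_distrib[of "\<lambda>c. _ * c"] cong: if_cong)
qed

text \<open>A slice that attaches only to the \<open>2 * n\<close> points between the projectors, leaving \<open>2 * n'\<close> such points.\<close>

definition middle_slice :: "nat \<Rightarrow> nat \<Rightarrow> shape \<Rightarrow> nat \<Rightarrow> bool" where
  "middle_slice n n' s i \<longleftrightarrow> 1 \<le> i \<and> i + legs_up s \<le> Suc (2 * n') \<and> 2 * n' + legs_down s = 2 * n + legs_up s"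

lemma tangle_middle_slice:
  "middle_slice n n' s i \<Longrightarrow> tangle (2 * (n' + k)) ((s, k + i) # w) \<longleftrightarrow> tangle (2 * (n + k)) w"
  by (cases s) (auto simp: middle_slice_def elim!: tangle_index)

text \<open>The slice touches only middle points, so it does not meet an arc that returns to a
  projector. A minimum or maximum merely renumbers the ends of that arc.\<close>

lemma plain_arc_middle_slice:
  assumes s: "middle_slice n n' s i" and arc: "plain_arc w a b"
    and ab: "{a, b} \<subseteq> left_projector n k \<or> {a, b} \<subseteq> right_projector n k"
  shows "\<exists>a b. plain_arc ((s, k + i) # w) a b \<and>
    ({a, b} \<subseteq> left_projector n' k \<or> {a, b} \<subseteq> right_projector n' k)"
proof (cases s)
  case Cup
  have "{bump (k + i) a, bump (k + i) b} \<subseteq> left_projector n' k \<or> {bump (k + i) a, bump (k + i) b} \<subseteq> right_projector n' k"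
    using ab s by (auto simp: Cup middle_slice_def left_projector_def right_projector_def bump_def)
  then show ?thesis using plain_arc.cup_old[OF arc] Cup by blast
next
  case Cap
  have n: "n = Suc n'" "1 \<le> i" "i \<le> Suc (2 * n')" using s by (auto simp: middle_slice_def Cap)
  \<comment> \<open>The inverse of \<open>bump (k + i)\<close> on projector points: those on the
    left lie below k + i and stay, those on the right lie above the two strands closed by the
    maximum.\<close>
  define a' b' where "a' = (if a \<le> k then a else a - 2)" and "b' = (if b \<le> k then b else b - 2)"
  have "bump (k + i) a' = a" "bump (k + i) b' = b"
    using ab n by (auto simp: a'_def b'_def bump_def left_projector_def right_projector_def)
  moreover have "{a', b'} \<subseteq> left_projector n' k \<or> {a', b'} \<subseteq> right_projector n' k"
    using ab n by (auto simp: a'_def b'_def left_projector_def right_projector_def)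
  ultimately show ?thesis using plain_arc.cap_old[of w "k + i" a' b'] arc Cap by auto
next
  case Pos
  have "{a, b} \<inter> {k + i, k + i + 1} = {}" "n = n'"
    using s ab by (auto simp: Pos middle_slice_def left_projector_def right_projector_def)
  then show ?thesis using plain_arc.pos[OF arc] ab Pos by blast
next
  case Neg
  have "{a, b} \<inter> {k + i, k + i + 1} = {}" "n = n'"
    using s ab by (auto simp: Neg middle_slice_def left_projector_def right_projector_def)
  then show ?thesis using plain_arc.neg[OF arc] ab Neg by blast
qed

text \<open>All relations but the one for projectors hold after an arbitrary prefix
  \<open>u\<close>, so the slice is absorbed into \<open>u\<close>; for a returning arc
  \<open>plain_arc_middle_slice\<close> is used.\<close>

lemma skein_relations_middle_slice:
  assumes s: "middle_slice n n' s i" and x: "x \<in> skein_relations n k"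
  shows "attach_slices [(s, k + i)] x \<in> skein_relations n' k"
proof -
  note t = tangle_middle_slice[OF s, of k]
  note simps = attach_slices_def lin_ext_diff lin_ext_add lin_ext_smul
  from x show ?thesis
  proof cases
    case (isotopy v v' u w)
    then show ?thesis
      using skein_relations.isotopy[of v v' n' k "(s, k + i) # u" w] t by (simp add: simps del: tangle_Cons)
  next
    case (projector w a b)
    from plain_arc_middle_slice[OF s projector(3,4)] obtain a' b' where arc: "plain_arc ((s, k + i) # w) a' b'"
      "{a', b'} \<subseteq> left_projector n' k \<or> {a', b'} \<subseteq> right_projector n' k"
      by (elim exE conjE)
    have "tangle (2 * (n' + k)) ((s, k + i) # w)" unfolding t by fact
    from skein_relations.projector[OF this arc] show ?thesis
      by (simp only: projector(1) attach_slices_basis append_Cons append_Nil)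
  next
    case (circle u j w)
    then show ?thesis
      using skein_relations.circle[of n' k "(s, k + i) # u" j w] t by (simp add: simps del: tangle_Cons)
  next
    case (pos_crossing u j w)
    then show ?thesis
      using skein_relations.pos_crossing[of n' k "(s, k + i) # u" j w] t by (simp add: simps del: tangle_Cons)
  next
    case (neg_crossing u j w)
    then show ?thesis
      using skein_relations.neg_crossing[of n' k "(s, k + i) # u" j w] t by (simp add: simps del: tangle_Cons)
  qed
qed

lemma Stilde_null_middle_slice:
  assumes "middle_slice n n' s i" "x \<in> Stilde_null n k"
  shows "attach_slices [(s, k + i)] x \<in> Stilde_null n' k"
  unfolding attach_slices_def
proof (rule lin_ext_span[OF subspace_Stilde_null])
  show "x \<in> lspan (skein_relations n k)" using assms(2) by (simp add: Stilde_null_def)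
  show "lin_ext (\<lambda>w. basis ([(s, k + i)] @ w)) y \<in> Stilde_null n' k" if "y \<in> skein_relations n k" for y
    using skein_relations_middle_slice[OF assms(1) that] unfolding attach_slices_def Stilde_null_def
    by (rule lmod.span_base)
qed

lemma tangle_span_middle_slice:
  assumes "middle_slice n n' s i" "x \<in> tangle_span n k"
  shows "attach_slices [(s, k + i)] x \<in> tangle_span n' k"
  unfolding attach_slices_def
proof (rule lin_ext_span)
  show "lsubspace (tangle_span n' k)" unfolding tangle_span_def by (rule lmod.subspace_span)
  show "x \<in> lspan (basis ` {w. tangle (2 * (n + k)) w})" using assms(2) by (simp add: tangle_span_def)
  show "lin_ext (\<lambda>w. basis ([(s, k + i)] @ w)) y \<in> tangle_span n' k"
    if "y \<in> basis ` {w. tangle (2 * (n + k)) w}" for y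
    using that tangle_middle_slice[OF assms(1), of k] unfolding tangle_span_def
    by (auto simp del: tangle_Cons intro!: lmod.span_base)
qed

text \<open>The arc added by \<open>phi_tangle\<close> is the lowest slice, so a slice attached on
  top commutes with it up to the shift by one caused by the new leftmost endpoint.\<close>

lemma attach_slices_phi: "1 \<le> k \<Longrightarrow> attach_slices [(s, k + i)] (phi x) = phi (attach_slices [(s, k - 1 + i)] x)"
  by (simp add: attach_slices_def phi_def lin_ext_lin_ext phi_tangle_def)

section \<open>The null space of the cokernel\<close>

lemma S_null_0: "S_null n 0 = Stilde_null n 0"
  by (simp add: S_null_def)

lemma S_null_pos: "1 \<le> k \<Longrightarrow> S_null n k = {phi x + y | x y. x \<in> tangle_span n (k - 1) \<and> y \<in> Stilde_null n k}"
  by (auto simp: S_null_def set_plus_def)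

lemma subspace_tangle_span: "lsubspace (tangle_span n k)"
  unfolding tangle_span_def by (rule lmod.subspace_span)

lemma subspace_sums:
  assumes "lsubspace A" "lsubspace B"
  shows "lsubspace {x + y | x y. x \<in> A \<and> y \<in> B}"
proof (rule lmod.subspaceI)
  have "0 = 0 + (0 :: 'a \<Rightarrow>\<^sub>0 laurent)" by simp
  then show "0 \<in> {x + y | x y. x \<in> A \<and> y \<in> B}"
    using assms[THEN lmod.subspace_0] by blast
next
  fix u v assume "u \<in> {x + y | x y. x \<in> A \<and> y \<in> B}" "v \<in> {x + y | x y. x \<in> A \<and> y \<in> B}"
  then obtain x y x' y' where xy: "u = x + y" "v = x' + y'" "x \<in> A" "x' \<in> A" "y \<in> B" "y' \<in> B" by blast
  then have "u + v = (x + x') + (y + y')" by simp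
  then show "u + v \<in> {x + y | x y. x \<in> A \<and> y \<in> B}"
    using xy assms[THEN lmod.subspace_add] by blast
next
  fix c u assume "u \<in> {x + y | x y. x \<in> A \<and> y \<in> B}"
  then obtain x y where xy: "u = x + y" "x \<in> A" "y \<in> B" by blast
  then have "smul c u = smul c x + smul c y" by (simp add: lmod.scale_right_distrib)
  then show "smul c u \<in> {x + y | x y. x \<in> A \<and> y \<in> B}"
    using xy assms[THEN lmod.subspace_scale] by blast
qed

lemma subspace_S_null: "lsubspace (S_null n k)"
proof (cases "k = 0")
  case True
  then show ?thesis using S_null_0 subspace_Stilde_null by simp
next
  case False
  have "lsubspace (phi ` tangle_span n (k - 1))"
    using subspace_tangle_span[of n "k - 1"] unfolding lmod.subspace_def phi_def
    by (auto simp flip: lin_ext_add lin_ext_smul intro!: image_eqI[of _ _ 0])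
  then have "lsubspace {x + y | x y. x \<in> phi ` tangle_span n (k - 1) \<and> y \<in> Stilde_null n k}"
    by (rule subspace_sums[OF _ subspace_Stilde_null])
  moreover have "S_null n k = {x + y | x y. x \<in> phi ` tangle_span n (k - 1) \<and> y \<in> Stilde_null n k}"
    using False by (auto simp: S_null_def set_plus_def)
  ultimately show ?thesis by simp
qed

lemma Stilde_null_subset: "Stilde_null n k \<subseteq> S_null n k"
proof (cases "k = 0")
  case False
  have "0 \<in> tangle_span n (k - 1)" by (rule lmod.subspace_0[OF subspace_tangle_span])
  then show ?thesis using False by (force simp: S_null_pos phi_def)
qed (simp add: S_null_0)

lemma phi_in_S_null: "1 \<le> k \<Longrightarrow> x \<in> tangle_span n (k - 1) \<Longrightarrow> phi x \<in> S_null n k"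
  using lmod.subspace_0[OF subspace_Stilde_null, of n k] by (force simp: S_null_pos)

text \<open>Both summands of \<open>S_null\<close> are respected, the image of \<open>phi\<close> by
  \<open>attach_slices_phi\<close>. As n may change, vanishing after attaching a maximum can be
  carried back by attaching a minimum.\<close>

lemma S_null_middle_slice:
  assumes s: "middle_slice n n' s i" and x: "x \<in> S_null n k"
  shows "attach_slices [(s, k + i)] x \<in> S_null n' k"
proof (cases "k = 0")
  case True
  then show ?thesis using Stilde_null_middle_slice[OF s, of x 0] x by (simp add: S_null_0)
next
  case False
  then obtain y z where x: "x = phi y + z" "y \<in> tangle_span n (k - 1)" "z \<in> Stilde_null n k"
    using x by (auto simp: S_null_pos)
  have "attach_slices [(s, k + i)] x = phi (attach_slices [(s, k - 1 + i)] y) + attach_slices [(s, k + i)] z"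
    using attach_slices_phi[of k s i y] False by (simp add: x(1) attach_slices_def lin_ext_add)
  then show ?thesis
    using tangle_span_middle_slice[OF s x(2)] Stilde_null_middle_slice[OF s x(3)] False by (auto simp: S_null_pos)
qed

lemma S_mod_eq: "mod_eq (Stilde_null n k) x y \<Longrightarrow> mod_eq (S_null n k) x y"
  using Stilde_null_subset by (rule mod_eq_mono[rotated])

text \<open>For n < k the middle has 2 n < k + k points, so \<open>cup_word_few_middle\<close>
  applies to each spanning word: a returning arc makes it a skein relation, an outermost arc puts it
  into the image of \<open>phi\<close>.\<close>

lemma tangle_in_S_null:
  assumes "n < k" "tangle (2 * (n + k)) w"
  shows "basis w \<in> S_null n k"
proof -
  have "basis v \<in> S_null n k" if v: "cup_word v" "tangle (2 * (n + k)) v" for v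
  proof -
    have e: "k + 2 * n + k = 2 * (n + k)" by simp
    have "(\<exists>a b. plain_arc v a b \<and> ({a, b} \<subseteq> left_projector n k \<or> {a, b} \<subseteq> right_projector n k)) \<or>
      (\<exists>u. v = phi_tangle u \<and> tangle (2 * (n + (k - 1))) u)"
      using cup_word_few_middle[OF v(1), of k "2 * n" k] v(2) assms(1) unfolding e left_projector_def right_projector_def
      by (auto simp: diff_mult_distrib2)
    then show ?thesis
    proof (elim disjE exE conjE)
      fix a b assume "plain_arc v a b" "{a, b} \<subseteq> left_projector n k"
      then have "basis v \<in> skein_relations n k" using v(2) by (intro skein_relations.projector) auto
      then show ?thesis using Stilde_null_subset lmod.span_base unfolding Stilde_null_def by blast
    next
      fix a b assume "plain_arc v a b" "{a, b} \<subseteq> right_projector n k"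
      then have "basis v \<in> skein_relations n k" using v(2) by (intro skein_relations.projector) auto
      then show ?thesis using Stilde_null_subset lmod.span_base unfolding Stilde_null_def by blast
    next
      fix u assume u: "v = phi_tangle u" "tangle (2 * (n + (k - 1))) u"
      then have "basis u \<in> tangle_span n (k - 1)"
        unfolding tangle_span_def by (intro lmod.span_base) simp
      then have "phi (basis u) \<in> S_null n k" using assms(1) by (intro phi_in_S_null) auto
      then show ?thesis using u(1) by (simp add: phi_def)
    qed
  qed
  then have "basis ` {[] @ v | v. cup_word v \<and> tangle (2 * (n + k)) ([] @ v)} \<union> Stilde_null n k \<subseteq> S_null n k"
    using Stilde_null_subset by auto
  from lmod.span_minimal[OF this subspace_S_null] span_cup_words[of n k "[]" w] assms(2) show ?thesis
    unfolding append_Nil by blast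
qed

section \<open>Drawings\<close>

definition endpoints_before :: "arc set \<Rightarrow> nat \<Rightarrow> nat set" where
  "endpoints_before M a = {p. \<exists>x\<in>M. fst x < a \<and> ends_at x p}"

definition strand_word :: "nat \<Rightarrow> nat \<Rightarrow> tangle" where
  "strand_word a c = map (\<lambda>j. (Neg, a + j)) (rev [1..<c + 1]) @ [(Cup, a)]"

text \<open>Every point left of a lies on an arc that starts left of a, so all these points are
  present when the strand at a is drawn. Hence its minimum is created at position a itself.\<close>

lemma endpoints_before_less:
  assumes "pairing N M" "a \<le> N"
  shows "{p \<in> endpoints_before M a. p < a} = {1..<a}"
proof (intro equalityI subsetI)
  fix p assume p: "p \<in> {1..<a}"
  then obtain x where x: "x \<in> M" "ends_at x p" using pairing_ex[OF assms(1), of p] assms(2) by auto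
  then have "fst x < a" using pairing_less[OF assms(1) x(1)] p by (auto simp: ends_at_def)
  then show "p \<in> {p \<in> endpoints_before M a. p < a}" using x p by (auto simp: endpoints_before_def)
next
  fix p assume "p \<in> {p \<in> endpoints_before M a. p < a}"
  then show "p \<in> {1..<a}" using pairing_range[OF assms(1)] by (force simp: endpoints_before_def)
qed

lemma draw_strand_eq:
  assumes M: "pairing N M" and ab: "(a, b) \<in> M"
  shows "draw_strand M a = strand_word a (card {p \<in> endpoints_before M a. a < p \<and> p < b})"
proof -
  have a: "1 \<le> a" "a \<le> N" using pairing_range[OF M ab, of a] by (auto simp: ends_at_def)
  have "(THE b. (a, b) \<in> M) = b"
  proof (rule the_equality)
    show "b' = b" if "(a, b') \<in> M" for b'
      using pairing_unique[OF M ab that, of a] by (simp add: ends_at_def)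
  qed (rule ab)
  then show ?thesis
    using endpoints_before_less[OF M a(2)] a
    by (simp add: draw_strand_def Let_def strand_word_def flip: endpoints_before_def)
qed

lemma tangle_strand_word:
  "tangle m w \<Longrightarrow> 1 \<le> a \<Longrightarrow> a + c \<le> m + 1 \<Longrightarrow> tangle (m + 2) (strand_word a c @ w)"
  by (induction c) (auto simp: strand_word_def elim: tangle_index)

text \<open>The invariant is that the word for the strands with left ends in \<open>ys\<close> is a
  tangle with \<open>card (E ys)\<close> endpoints, where \<open>E ys\<close> is the set of points
  already present. Later strands are attached on top.\<close>

lemma tangle_draw:
  assumes M: "pairing N M"
  shows "tangle N (draw M)"
proof -
  define xs where "xs = sorted_list_of_set (fst ` M)"
  have fin: "finite (fst ` M)" using pairing_finite[OF M] by simp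
  have xs: "set xs = fst ` M" "sorted_wrt (<) xs" using fin by (simp_all add: xs_def)
  define E where "E ys = {p. \<exists>x\<in>M. fst x \<in> set ys \<and> ends_at x p}" for ys
  have E: "E ys \<subseteq> {1..N}" for ys using pairing_range[OF M] by (fastforce simp: E_def)
  have "tangle (card (E ys)) (concat (map (draw_strand M) (rev ys)))" if "xs = ys @ zs" for ys zs
    using that
  proof (induction ys arbitrary: zs rule: rev_induct)
    case Nil
    then show ?case by (simp add: E_def)
  next
    case (snoc a ys)
    have "a \<in> fst ` M" using snoc.prems xs(1) by auto
    then obtain b where ab: "(a, b) \<in> M" by auto
    have lt: "a < b" using pairing_less[OF M ab] by simp
    have r: "1 \<le> a" "b \<le> N"
      using pairing_range[OF M ab, of a] pairing_range[OF M ab, of b] by (auto simp: ends_at_def)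
    have before: "endpoints_before M a = E ys"
    proof -
      have "fst x < a \<longleftrightarrow> fst x \<in> set ys" if "x \<in> M" for x
      proof -
        have "fst x \<in> set xs" using that xs by simp
        then show ?thesis using xs(2) unfolding snoc.prems
          by (auto simp: sorted_wrt_append dest: less_asym)
      qed
      then show ?thesis by (auto simp: endpoints_before_def E_def)
    qed
    have notin: "a \<notin> set ys" using xs(2) unfolding snoc.prems by (auto simp: sorted_wrt_append)
    have "p \<notin> E ys" if "p \<in> {a, b}" for p
    proof
      assume "p \<in> E ys"
      then obtain x where x: "x \<in> M" "fst x \<in> set ys" "ends_at x p" by (auto simp: E_def)
      have "x = (a, b)" by (rule pairing_unique[OF M x(1) ab x(3)]) (use that in \<open>auto simp: ends_at_def\<close>)
      then show False using x(2) notin by simp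
    qed
    then have new: "a \<notin> E ys" "b \<notin> E ys" by auto
    have "E (ys @ [a]) = insert a (insert b (E ys))"
    proof (intro equalityI subsetI)
      fix p assume "p \<in> E (ys @ [a])"
      then obtain x where x: "x \<in> M" "fst x \<in> set ys \<or> fst x = a" "ends_at x p" by (auto simp: E_def)
      have "x = (a, b)" if "fst x = a"
        using pairing_unique[OF M x(1) ab, of a] that by (simp add: ends_at_def)
      then have "p = a \<or> p = b" if "fst x = a"
        using that x(3) unfolding ends_at_def by (metis fst_conv snd_conv)
      moreover have "p \<in> E ys" if "fst x \<in> set ys"
        using that x(1,3) unfolding E_def by blast
      ultimately show "p \<in> insert a (insert b (E ys))" using x(2) by blast
    next
      fix p assume "p \<in> insert a (insert b (E ys))"
      then show "p \<in> E (ys @ [a])" using ab by (force simp: E_def ends_at_def)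
    qed
    then have card: "card (E (ys @ [a])) = card (E ys) + 2"
      using new lt finite_subset[OF E] by simp
    let ?c = "card {p \<in> E ys. a < p \<and> p < b}"
    have "card ({p \<in> E ys. p < a} \<union> {p \<in> E ys. a < p \<and> p < b}) \<le> card (E ys)"
      using finite_subset[OF E] by (intro card_mono) auto
    moreover have "card ({p \<in> E ys. p < a} \<union> {p \<in> E ys. a < p \<and> p < b}) = card {p \<in> E ys. p < a} + ?c"
      using finite_subset[OF E] by (intro card_Un_disjoint) auto
    moreover have "card {p \<in> E ys. p < a} = a - 1"
      using endpoints_before_less[OF M, of a] r lt by (simp add: before)
    \<comment> \<open>The endpoints present include a - 1 points left of a and \<open>?c\<close>
      points between a and b, so there is room to pull the right leg across the latter.\<close>
    ultimately have c: "a + ?c \<le> card (E ys) + 1" using r by linarith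
    show ?case
      using tangle_strand_word[OF snoc.IH r(1) c, of "a # zs"] snoc.prems draw_strand_eq[OF M ab]
      by (simp add: card before)
  qed
  from this[of xs "[]"] have "tangle (card (E xs)) (draw M)"
    by (simp add: draw_def xs_def)
  moreover have "E xs = {1..N}"
    using E pairing_ex[OF M] xs(1) by (force simp: E_def)
  ultimately show ?thesis by simp
qed

text \<open>The slices of \<open>U\<close> act to the right of the minimum, so they can be moved
  below it one at a time, each losing the two legs from its index.\<close>

lemma pull_cup:
  assumes "\<forall>(s, p)\<in>set U. j \<le> p" "tangle (2 * (n + k)) (V @ (Cup, j) # U @ W)"
  shows "mod_eq (Stilde_null n k) (basis (V @ map (apsnd (\<lambda>p. p + 2)) U @ (Cup, j) # W)) (basis (V @ (Cup, j) # U @ W))"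
  using assms
proof (induction U arbitrary: V)
  case Nil
  then show ?case by (simp add: mod_eq_refl[OF subspace_Stilde_null])
next
  case (Cons x U)
  obtain t p where x: "x = (t, p)" by (cases x)
  have jp: "j \<le> p" and U: "\<forall>(s, p)\<in>set U. j \<le> p" using Cons.prems(1) by (auto simp: x)
  have t: "tangle (2 * (n + k)) (V @ (Cup, j) # (t, p) # U @ W)" using Cons.prems(2) by (simp add: x)
  then have "tangle (2 * (n + k)) ((V @ [(t, p + 2)]) @ (Cup, j) # U @ W)"
    using tangle_append_iff[OF tangle_distant[OF jp, of _ t "U @ W"], of "2 * (n + k)" V] by simp
  from Cons.IH[OF U this] show ?case
    using mod_eq_trans[OF subspace_Stilde_null _ distant_cup_mod_eq[OF t jp]] by (simp add: x)
qed

lemma strand_word_ge: "(s, p) \<in> set (strand_word a c) \<Longrightarrow> a \<le> p"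
  by (auto simp: strand_word_def)

lemma strand_word_shift: "strand_word (a + d) c = map (apsnd (\<lambda>p. p + d)) (strand_word a c)"
  by (simp add: strand_word_def)

text \<open>The number of crossings is unchanged: a strand starting left of j is drawn before the
  new points appear, and for one starting at j or later they lie to the left of its left end. Only
  the position may shift by 2.\<close>

lemma draw_strand_insert_old:
  assumes M: "pairing N M" and j: "1 \<le> j" "j \<le> N + 1" and a: "a \<in> fst ` M"
  shows "draw_strand (insert_arc j M) (bump j a) =
    (if a < j then draw_strand M a else map (apsnd (\<lambda>p. p + 2)) (draw_strand M a))"
proof -
  obtain b where ab: "(a, b) \<in> M" using a by auto
  have M': "pairing (N + 2) (insert_arc j M)" using pairing_insert_arc[OF j] M by simp
  have ab': "(bump j a, bump j b) \<in> insert_arc j M" using ab by (force simp: insert_arc_def)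
  have "endpoints_before (insert_arc j M) (bump j a) =
      bump j ` endpoints_before M a \<union> (if a < j then {} else {j, Suc j})"
  proof (intro equalityI subsetI)
    fix p assume "p \<in> endpoints_before (insert_arc j M) (bump j a)"
    then obtain x where "x \<in> insert_arc j M" "fst x < bump j a" "ends_at x p"
      by (auto simp: endpoints_before_def)
    then show "p \<in> bump j ` endpoints_before M a \<union> (if a < j then {} else {j, Suc j})"
      by (auto simp: insert_arc_def endpoints_before_def ends_at_def image_iff) (metis fst_conv snd_conv)+
  next
    fix p assume p: "p \<in> bump j ` endpoints_before M a \<union> (if a < j then {} else {j, Suc j})"
    show "p \<in> endpoints_before (insert_arc j M) (bump j a)"
    proof (cases "p \<in> bump j ` endpoints_before M a")
      case True
      then obtain q x where "p = bump j q" "x \<in> M" "fst x < a" "ends_at x q" by (auto simp: endpoints_before_def)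
      then have "bump_arc j x \<in> insert_arc j M" "fst (bump_arc j x) < bump j a" "ends_at (bump_arc j x) p"
        by (auto simp: insert_arc_def)
      then show ?thesis unfolding endpoints_before_def by blast
    next
      case False
      then have "\<not> a < j" "ends_at (j, Suc j) p" using p by (auto simp: ends_at_def split: if_splits)
      then show ?thesis
        unfolding endpoints_before_def by (intro CollectI bexI[of _ "(j, Suc j)"]) (auto simp: insert_arc_def)
    qed
  qed
  then have "{p \<in> endpoints_before (insert_arc j M) (bump j a). bump j a < p \<and> p < bump j b} =
      bump j ` {p \<in> endpoints_before M a. a < p \<and> p < b}"
    by (cases "a < j") auto
  then have card: "card {p \<in> endpoints_before (insert_arc j M) (bump j a). bump j a < p \<and> p < bump j b} =
      card {p \<in> endpoints_before M a. a < p \<and> p < b}"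
    by (simp only: card_image[OF inj_on_subset[OF inj_bump]] subset_UNIV)
  show ?thesis
    unfolding draw_strand_eq[OF M ab] draw_strand_eq[OF M' ab'] card
    by (cases "a < j") (simp_all only: bump_def strand_word_shift if_True if_False)
qed

lemma draw_strand_insert_new:
  assumes M: "pairing N M" and j: "1 \<le> j" "j \<le> N + 1"
  shows "draw_strand (insert_arc j M) j = [(Cup, j)]"
proof -
  have M': "pairing (N + 2) (insert_arc j M)" using pairing_insert_arc[OF j] M by simp
  have mem: "(j, Suc j) \<in> insert_arc j M" by (simp add: insert_arc_def)
  have empty: "{p \<in> endpoints_before (insert_arc j M) j. j < p \<and> p < Suc j} = {}" by auto
  show ?thesis unfolding draw_strand_eq[OF M' mem] empty by (simp add: strand_word_def)
qed

lemma sorted_list_insert_bump: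
  assumes "finite X"
  defines "xs \<equiv> sorted_list_of_set X"
  shows "sorted_list_of_set (insert j (bump j ` X)) =
    map (bump j) (filter (\<lambda>a. a < j) xs) @ j # map (bump j) (filter (\<lambda>a. \<not> a < j) xs)"
    and "xs = filter (\<lambda>a. a < j) xs @ filter (\<lambda>a. \<not> a < j) xs"
proof -
  have xs: "sorted_wrt (<) xs" "set xs = X" using assms by simp_all
  show "xs = filter (\<lambda>a. a < j) xs @ filter (\<lambda>a. \<not> a < j) xs"
    using xs by (intro strict_sorted_equal) (auto simp: sorted_wrt_append sorted_wrt_filter)
  define Y where "Y = insert j (bump j ` X)"
  have "finite Y" using assms(1) by (simp add: Y_def)
  then have Y: "sorted_wrt (<) (sorted_list_of_set Y)" "set (sorted_list_of_set Y) = Y" by simp_all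
  show "sorted_list_of_set (insert j (bump j ` X)) =
    map (bump j) (filter (\<lambda>a. a < j) xs) @ j # map (bump j) (filter (\<lambda>a. \<not> a < j) xs)"
    unfolding Y_def[symmetric]
  proof (rule strict_sorted_equal[OF _ Y(1)])
    show "sorted_wrt (<) (map (bump j) (filter (\<lambda>a. a < j) xs) @ j # map (bump j) (filter (\<lambda>a. \<not> a < j) xs))"
      using xs(1) by (auto simp: sorted_wrt_append sorted_wrt_filter sorted_wrt_map)
    show "set (sorted_list_of_set Y) =
        set (map (bump j) (filter (\<lambda>a. a < j) xs) @ j # map (bump j) (filter (\<lambda>a. \<not> a < j) xs))"
      unfolding Y(2) using xs(2) by (auto simp: Y_def)
  qed
qed

text \<open>In the new drawing the inserted minimum stands below the strands starting further right
  and above those starting further left. Only the former are shifted, and \<open>pull_cup\<close>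
  brings the minimum above them without touching any crossing.\<close>

lemma draw_insert_arc:
  assumes M: "pairing (2 * (n + k)) M" and j: "1 \<le> j" "j \<le> 2 * (n + k) + 1"
  shows "mod_eq (Stilde_null (Suc n) k) (basis (draw (insert_arc j M))) (basis ((Cup, j) # draw M))"
proof -
  define xs where "xs = sorted_list_of_set (fst ` M)"
  have fin: "finite (fst ` M)" using pairing_finite[OF M] by simp
  have set_xs: "set xs = fst ` M" using fin by (simp add: xs_def)
  let ?lo = "filter (\<lambda>a. a < j) xs" and ?hi = "filter (\<lambda>a. \<not> a < j) xs"
  let ?U = "concat (map (draw_strand M) (rev ?hi))" and ?W = "concat (map (draw_strand M) (rev ?lo))"
  note xs = sorted_list_insert_bump[OF fin, of j, folded xs_def]
  have "draw M = concat (map (draw_strand M) (rev (?lo @ ?hi)))"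
    using xs(2) by (simp add: draw_def flip: xs_def)
  then have draw: "draw M = ?U @ ?W" by simp
  have "fst ` insert_arc j M = insert j (bump j ` fst ` M)" by (auto simp: insert_arc_def image_image)
  then have "draw (insert_arc j M) = concat (map (draw_strand (insert_arc j M)) (rev (map (bump j) ?lo @ j # map (bump j) ?hi)))"
    unfolding draw_def using xs(1) by simp
  also have "\<dots> = concat (map (\<lambda>a. draw_strand (insert_arc j M) (bump j a)) (rev ?hi)) @
      (Cup, j) # concat (map (\<lambda>a. draw_strand (insert_arc j M) (bump j a)) (rev ?lo))"
    using draw_strand_insert_new[OF M j] by (simp add: rev_map comp_def)
  also have "map (\<lambda>a. draw_strand (insert_arc j M) (bump j a)) (rev ?lo) = map (draw_strand M) (rev ?lo)"
    using draw_strand_insert_old[OF M j] set_xs by (intro map_cong) auto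
  also have "map (\<lambda>a. draw_strand (insert_arc j M) (bump j a)) (rev ?hi) =
      map (\<lambda>a. map (apsnd (\<lambda>p. p + 2)) (draw_strand M a)) (rev ?hi)"
    using draw_strand_insert_old[OF M j] set_xs by (intro map_cong) auto
  also have "concat \<dots> = map (apsnd (\<lambda>p. p + 2)) ?U" by (simp add: map_concat comp_def)
  finally have draw': "draw (insert_arc j M) = map (apsnd (\<lambda>p. p + 2)) ?U @ (Cup, j) # ?W" .
  have ge: "\<forall>(s, p)\<in>set ?U. j \<le> p"
  proof (intro ballI, clarify)
    fix s p assume "(s, p) \<in> set ?U"
    then obtain a where a: "a \<in> fst ` M" "\<not> a < j" "(s, p) \<in> set (draw_strand M a)"
      using set_xs by auto
    then show "j \<le> p" using draw_strand_eq[OF M] strand_word_ge by fastforce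
  qed
  have "tangle (2 * (Suc n + k)) ([] @ (Cup, j) # ?U @ ?W)"
    using tangle_draw[OF M] j by (simp add: draw)
  from pull_cup[OF ge this] show ?thesis by (simp only: draw draw' append_Nil)
qed

section \<open>The strands of a dotted matching\<close>

lemma strands_eq:
  "strands n k (A, D) = (\<lambda>(a, b). (k + a, k + b)) ` (A - D) \<union>
    (\<lambda>j. (k - j, k + sorted_list_of_set (fst ` D) ! j)) ` {..<k} \<union>
    (\<lambda>j. (k + sorted_list_of_set (snd ` D) ! j, 2 * (n + k) - j)) ` {..<k}"
  by (auto simp: strands_def Let_def)

lemma bij_nth_sorted_list:
  "finite X \<Longrightarrow> card X = k \<Longrightarrow> bij_betw ((!) (sorted_list_of_set X)) {..<k} X"
  by (rule bij_betw_nth) auto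

lemma image_diff_lessThan: "k \<le> (m :: nat) \<Longrightarrow> (\<lambda>j. m - j) ` {..<k} = {m - k + 1..m}"
proof (intro equalityI subsetI)
  fix p assume "k \<le> m" "p \<in> {m - k + 1..m}"
  then have "p = m - (m - p) \<and> m - p < k" unfolding atLeastAtMost_iff by linarith
  then show "p \<in> (\<lambda>j. m - j) ` {..<k}" by blast
qed auto

text \<open>The ends of the strands fill three consecutive blocks: the left projector, the shifted
  points of the diagram, the right projector. In the middle block an end of a dotted arc is a right
  end for a left strand and a left end for a right strand, so the roles of \<open>fst\<close> and
  \<open>snd\<close> are exchanged on dotted arcs.\<close>

lemma pairing_strands:
  assumes p: "pairing (2 * n) A" and D: "D \<subseteq> A" "card D = k"
  shows "pairing (2 * (n + k)) (strands n k (A, D))"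
proof -
  have fin: "finite D" using finite_subset[OF D(1) pairing_finite[OF p]] .
  have inj: "inj_on fst A" "inj_on snd A" and disj: "fst ` A \<inter> snd ` A = {}"
    and un: "fst ` A \<union> snd ` A = {1..2 * n}" using p by (simp_all add: pairing_def)
  have card: "card (fst ` D) = k" "card (snd ` D) = k"
    using D inj by (simp_all add: card_image inj_on_subset)
  define ps rs where "ps = (!) (sorted_list_of_set (fst ` D))" and "rs = (!) (sorted_list_of_set (snd ` D))"
  have ps: "bij_betw ps {..<k} (fst ` D)" and rs: "bij_betw rs {..<k} (snd ` D)"
    unfolding ps_def rs_def using fin card by (auto intro: bij_nth_sorted_list)
  have psD: "ps ` {..<k} = fst ` D" and rsD: "rs ` {..<k} = snd ` D"
    using ps rs by (simp_all add: bij_betw_def)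
  \<comment> \<open>The undotted arcs, the strands to the left projector and the strands to the
    right projector.\<close>
  define F G H where "F = (\<lambda>(a, b). (k + a, k + b)) ` (A - D)" and "G = (\<lambda>j. (k - j, k + ps j)) ` {..<k}"
    and "H = (\<lambda>j. (k + rs j, 2 * (n + k) - j)) ` {..<k}"
  have strands: "strands n k (A, D) = F \<union> G \<union> H"
    by (simp add: strands_eq F_def G_def H_def ps_def rs_def)
  have fstF: "fst ` F = (+) k ` fst ` (A - D)" and sndF: "snd ` F = (+) k ` snd ` (A - D)"
    by (force simp: F_def)+
  have fstG: "fst ` G = {1..k}"
    using image_diff_lessThan[of k k] by (simp add: G_def image_image)
  have sndH: "snd ` H = {2 * n + k + 1..2 * (n + k)}"
    using image_diff_lessThan[of k "2 * (n + k)"] by (simp add: H_def image_image)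
  have sndG: "snd ` G = (+) k ` fst ` D" unfolding psD[symmetric] by (simp add: G_def image_image)
  have fstH: "fst ` H = (+) k ` snd ` D" unfolding rsD[symmetric] by (simp add: H_def image_image)
  have range: "x \<in> A \<Longrightarrow> 1 \<le> fst x \<and> fst x \<le> 2 * n" "x \<in> A \<Longrightarrow> 1 \<le> snd x \<and> snd x \<le> 2 * n" for x
    using pairing_range[OF p, of x "fst x"] pairing_range[OF p, of x "snd x"] by (auto simp: ends_at_def)
  have D1: "fst ` (A - D) \<inter> fst ` D = {}" "snd ` (A - D) \<inter> snd ` D = {}"
    using inj D(1) by (auto simp: inj_on_def) (metis in_mono prod.inject fst_conv snd_conv)+
  have D2: "fst ` (A - D) \<inter> snd ` D = {}" "fst ` D \<inter> snd ` (A - D) = {}"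
    "fst ` (A - D) \<inter> snd ` (A - D) = {}" "fst ` D \<inter> snd ` D = {}"
    using disj D(1) by blast+
  have low: "{1..k} \<inter> (+) k ` fst ` X = {}" "{1..k} \<inter> (+) k ` snd ` X = {}" if "X \<subseteq> A" for X
    using that range by fastforce+
  have high: "(+) k ` fst ` X \<inter> {2 * n + k + 1..2 * (n + k)} = {}"
    "(+) k ` snd ` X \<inter> {2 * n + k + 1..2 * (n + k)} = {}" if "X \<subseteq> A" for X
    using that range by fastforce+
  have AD: "A - D \<subseteq> A" by blast
  show ?thesis
    unfolding pairing_def strands
  proof (intro conjI)
    have "fst x < snd x" if "x \<in> F" for x
      using that pairing_less[OF p] by (force simp: F_def)
    moreover have "fst x < snd x" if x: "x \<in> G" for x
    proof -
      obtain j where j: "j < k" "x = (k - j, k + ps j)" using x by (auto simp: G_def)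
      then have "ps j \<in> fst ` D" using psD by blast
      then show ?thesis using range(1) D(1) j by fastforce
    qed
    moreover have "fst x < snd x" if x: "x \<in> H" for x
    proof -
      obtain j where j: "j < k" "x = (k + rs j, 2 * (n + k) - j)" using x by (auto simp: H_def)
      then have "rs j \<in> snd ` D" using rsD by blast
      then have "rs j \<le> 2 * n" using range(2) D(1) by auto
      then show ?thesis using j by simp
    qed
    ultimately show "\<forall>x\<in>F \<union> G \<union> H. fst x < snd x" by blast
    have injF: "inj_on f F" if f: "f = fst \<or> f = snd" for f :: "arc \<Rightarrow> nat"
    proof (rule inj_onI)
      fix x y assume "x \<in> F" "y \<in> F" and eq: "f x = f y"
      then obtain u v where uv: "u \<in> A" "v \<in> A" "x = (k + fst u, k + snd u)" "y = (k + fst v, k + snd v)"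
        by (auto simp: F_def)
      have "u = v"
        using f eq uv inj_onD[OF inj(1) _ uv(1,2)] inj_onD[OF inj(2) _ uv(1,2)] by auto
      then show "x = y" using uv by simp
    qed
    then have injs: "inj_on fst F" "inj_on snd F" by blast+
    have inj1: "inj_on fst G" "inj_on snd H"
      by (auto simp: G_def H_def inj_on_def intro!: arg_cong[where f = ps] arg_cong[where f = rs])
    have inj2: "inj_on snd G" "inj_on fst H" using ps rs by (auto simp: G_def H_def inj_on_def bij_betw_def)
    have inj_UnI: "inj_on f (F \<union> G \<union> H)"
      if "inj_on f F" "inj_on f G" "inj_on f H" "f ` F \<inter> f ` G = {}" "f ` F \<inter> f ` H = {}" "f ` G \<inter> f ` H = {}"
      for f :: "arc \<Rightarrow> nat"
      using that unfolding inj_on_def by blast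
    have shift: "X \<inter> Y = {} \<Longrightarrow> (+) k ` X \<inter> (+) k ` Y = {}" for X Y :: "nat set" by auto
    have "fst ` F \<inter> fst ` G = {}" "fst ` F \<inter> fst ` H = {}" "fst ` G \<inter> fst ` H = {}"
      unfolding fstF fstG fstH using low(1)[OF AD] low(2)[OF D(1)] shift[OF D2(1)] by (simp_all only: Int_commute)
    then show "inj_on fst (F \<union> G \<union> H)" by (intro inj_UnI injs inj1 inj2)
    have "snd ` F \<inter> snd ` G = {}" "snd ` F \<inter> snd ` H = {}" "snd ` G \<inter> snd ` H = {}"
      unfolding sndF sndG sndH using high(2)[OF AD] high(1)[OF D(1)] shift[OF D2(2)] by (simp_all only: Int_commute)
    then show "inj_on snd (F \<union> G \<union> H)" by (intro inj_UnI injs inj1 inj2)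
    have "fst ` F \<inter> snd ` F = {}" "fst ` F \<inter> snd ` G = {}" "fst ` F \<inter> snd ` H = {}"
      unfolding fstF sndF sndG sndH using shift[OF D2(3)] shift[OF D1(1)] high(1)[OF AD] by (simp_all only: Int_commute)
    moreover have "fst ` G \<inter> snd ` F = {}" "fst ` G \<inter> snd ` G = {}"
      unfolding fstG sndF sndG using low(2)[OF AD] low(1)[OF D(1)] by (simp_all only: Int_commute)
    moreover have "fst ` G \<inter> snd ` H = {}" unfolding fstG sndH by auto
    moreover have "fst ` H \<inter> snd ` F = {}" "fst ` H \<inter> snd ` G = {}" "fst ` H \<inter> snd ` H = {}"
      unfolding fstH sndF sndG sndH using shift[OF D1(2)] shift[OF D2(4)] high(2)[OF D(1)] by (simp_all only: Int_commute)
    ultimately show "fst ` (F \<union> G \<union> H) \<inter> snd ` (F \<union> G \<union> H) = {}"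
      by (simp only: image_Un Int_Un_distrib Int_Un_distrib2 Un_empty_left Un_empty_right)
    have "(+) k ` {1..2 * n} = {k + 1..k + 2 * n}" by simp
    then have mid: "(+) k ` (fst ` A \<union> snd ` A) = {k + 1..k + 2 * n}" unfolding un .
    have "A = (A - D) \<union> D" using D(1) by blast
    then have split: "f ` A = f ` (A - D) \<union> f ` D" for f :: "arc \<Rightarrow> nat"
      using image_Un[of f "A - D" D] by simp
    have "fst ` (F \<union> G \<union> H) \<union> snd ` (F \<union> G \<union> H) =
        {1..k} \<union> (+) k ` (fst ` A \<union> snd ` A) \<union> {2 * n + k + 1..2 * (n + k)}"
      unfolding split image_Un fstF fstG fstH sndF sndG sndH by (simp only: Un_ac)
    also have "\<dots> = {1..k} \<union> {k + 1..k + 2 * n} \<union> {2 * n + k + 1..2 * (n + k)}"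
      unfolding mid ..
    also have "\<dots> = {1..2 * (n + k)}" by auto
    finally show "fst ` (F \<union> G \<union> H) \<union> snd ` (F \<union> G \<union> H) = {1..2 * (n + k)}" .
  qed
qed

lemma sorted_list_of_set_bump:
  "finite X \<Longrightarrow> sorted_list_of_set (bump j ` X) = map (bump j) (sorted_list_of_set X)"
  by (intro strict_sorted_equal) (auto simp: sorted_wrt_map)

lemma bump_add: "bump (k + j) (k + a) = k + bump j a"
  by (simp add: bump_def)

text \<open>Renumbering by \<open>bump (k + j)\<close> fixes the left projector, moves the right one
  by 2, as the larger number of points requires, and keeps the order of the ends of dotted arcs, so
  that these are assigned to the same projector points as before.\<close>

lemma strands_insert_diagram:
  assumes p: "pairing (2 * n) A" and D: "D \<subseteq> A" "card D = k" and j: "1 \<le> j" "j \<le> 2 * n + 1"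
  shows "strands (Suc n) k (insert_diagram j (A, D)) = insert_arc (k + j) (strands n k (A, D))"
proof -
  have fin: "finite D" using finite_subset[OF D(1) pairing_finite[OF p]] .
  have inj: "inj_on fst A" "inj_on snd A" using p by (simp_all add: pairing_def)
  have card: "card (fst ` D) = k" "card (snd ` D) = k"
    using D inj by (simp_all add: card_image inj_on_subset)
  have sorted: "sorted_list_of_set (fst ` bump_arc j ` D) = map (bump j) (sorted_list_of_set (fst ` D))"
    "sorted_list_of_set (snd ` bump_arc j ` D) = map (bump j) (sorted_list_of_set (snd ` D))"
    using fin by (simp_all add: image_image flip: sorted_list_of_set_bump)
  have "insert_arc j A - bump_arc j ` D = insert (j, Suc j) (bump_arc j ` (A - D))"
    by (auto simp: insert_arc_def image_set_diff[OF inj_bump_arc])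
  then have 1: "(\<lambda>(a, b). (k + a, k + b)) ` (insert_arc j A - bump_arc j ` D) =
      insert (k + j, Suc (k + j)) (bump_arc (k + j) ` (\<lambda>(a, b). (k + a, k + b)) ` (A - D))"
    by (force simp: image_image bump_add case_prod_unfold)
  have 2: "(\<lambda>i. (k - i, k + map (bump j) (sorted_list_of_set (fst ` D)) ! i)) ` {..<k} =
      bump_arc (k + j) ` (\<lambda>i. (k - i, k + sorted_list_of_set (fst ` D) ! i)) ` {..<k}"
    unfolding image_image using j card by (intro image_cong) (auto simp: bump_add, auto simp: bump_def)
  have 3: "(\<lambda>i. (k + map (bump j) (sorted_list_of_set (snd ` D)) ! i, 2 * (Suc n + k) - i)) ` {..<k} =
      bump_arc (k + j) ` (\<lambda>i. (k + sorted_list_of_set (snd ` D) ! i, 2 * (n + k) - i)) ` {..<k}"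
    unfolding image_image using j card by (intro image_cong) (auto simp: bump_add, auto simp: bump_def)
  show ?thesis
    unfolding insert_diagram_def prod.case strands_eq sorted 1 2 3
    unfolding insert_arc_def image_Un by blast
qed

text \<open>Outer dotted arcs are not nested in each other, so the correcting power of q is
  1.\<close>

lemma psi_diagram_B:
  assumes "b \<in> B_diagrams n k"
  shows "psi_diagram n k b = basis (draw (strands n k b))"
proof -
  obtain A D where b: "b = (A, D)" by (cases b)
  have none: "{(x, y). x \<in> D \<and> y \<in> D \<and> nested x y} = {}"
    using assms unfolding b B_diagrams_iff outer_def by blast
  show ?thesis unfolding psi_diagram_def b snd_conv none by simp
qed

lemma tangle_draw_strands: "b \<in> B_diagrams n k \<Longrightarrow> tangle (2 * (n + k)) (draw (strands n k b))"
  using tangle_draw[OF pairing_strands] by (cases b) (auto simp only: B_diagrams_iff)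

lemma draw_insert_diagram:
  assumes "b \<in> B_diagrams n k" "1 \<le> j" "j \<le> 2 * n + 1"
  shows "mod_eq (Stilde_null (Suc n) k) (basis (draw (strands (Suc n) k (insert_diagram j b))))
    (basis ((Cup, k + j) # draw (strands n k b)))"
proof (cases b)
  case (Pair A D)
  have B: "pairing (2 * n) A" "D \<subseteq> A" "card D = k" using assms(1) by (simp_all add: Pair B_diagrams_iff)
  show ?thesis
    unfolding Pair strands_insert_diagram[OF B assms(2,3)]
    by (rule draw_insert_arc[OF pairing_strands[OF B]]) (use assms in auto)
qed

section \<open>Equivariance\<close>

definition psi_lift :: "nat \<Rightarrow> nat \<Rightarrow> (diagram \<Rightarrow>\<^sub>0 laurent) \<Rightarrow> (tangle \<Rightarrow>\<^sub>0 laurent)" where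
  "psi_lift n k = lin_ext (psi_diagram n k)"

lemma psi_lift_linear:
  "psi_lift n k (x + y) = psi_lift n k x + psi_lift n k y"
  "psi_lift n k (smul c x) = smul c (psi_lift n k x)"
  "psi_lift n k 0 = 0"
  by (simp_all add: psi_lift_def lin_ext_add lin_ext_smul)

lemma psi_lift_basis: "b \<in> B_diagrams n k \<Longrightarrow> psi_lift n k (basis b) = basis (draw (strands n k b))"
  by (simp add: psi_lift_def psi_diagram_B)

lemma psi_lift_tangle_span: "x \<in> Rbar n k \<Longrightarrow> psi_lift n k x \<in> tangle_span n k"
  unfolding psi_lift_def
  by (rule lin_ext_span[OF subspace_tangle_span, of "basis ` B_diagrams n k"])
    (use tangle_draw_strands[of _ n k] in
      \<open>auto simp: Rbar_def psi_diagram_B tangle_span_def intro!: lmod.span_base imageI\<close>)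

lemma attach_slices_linear:
  "attach_slices u (x + y) = attach_slices u x + attach_slices u y"
  "attach_slices u (smul c x) = smul c (attach_slices u x)"
  "attach_slices u (x - y) = attach_slices u x - attach_slices u y"
  "attach_slices u 0 = 0"
  by (simp_all add: attach_slices_def lin_ext_add lin_ext_smul lin_ext_diff)

lemma Rbar_induct [consumes 1, case_names zero step]:
  assumes "x \<in> Rbar n k" "P 0"
    and "\<And>c b y. b \<in> B_diagrams n k \<Longrightarrow> y \<in> Rbar n k \<Longrightarrow> P y \<Longrightarrow> P (smul c (basis b) + y)"
  shows "P x"
proof -
  have "x \<in> Rbar n k \<and> P x"
    using assms(1) unfolding Rbar_def
  proof (induction rule: lmod.span_induct_alt)
    case base
    then show ?case using assms(2) lmod.span_zero by blast
  next
    case (step c z y)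
    then obtain b where b: "b \<in> B_diagrams n k" "z = basis b" by blast
    have "smul c (basis b) + y \<in> lspan (basis ` B_diagrams n k)"
      by (intro lmod.span_add lmod.span_scale lmod.span_base imageI b(1) conjunct1[OF step(2)])
    then show ?case using assms(3)[of b y c] b step(2) by (simp add: Rbar_def)
  qed
  then show ?thesis ..
qed

lemma psi_lift_insert:
  assumes j: "1 \<le> j" "j \<le> 2 * n + 1" and x: "x \<in> Rbar n k"
  shows "mod_eq (Stilde_null (Suc n) k) (psi_lift (Suc n) k (lin_ext (\<lambda>b. basis (insert_diagram j b)) x))
    (attach_slices [(Cup, k + j)] (psi_lift n k x))"
  using x
proof (induction rule: Rbar_induct)
  case zero
  then show ?case by (simp add: psi_lift_linear attach_slices_linear mod_eq_refl[OF subspace_Stilde_null])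
next
  case (step c b y)
  have "insert_diagram j b \<in> B_diagrams (Suc n) k" using insert_diagram_B_iff[OF j] step(1) by blast
  then have b: "mod_eq (Stilde_null (Suc n) k) (psi_lift (Suc n) k (basis (insert_diagram j b)))
    (attach_slices [(Cup, k + j)] (psi_lift n k (basis b)))"
    using draw_insert_diagram[OF step(1) j] by (simp add: psi_lift_basis step(1))
  show ?case
    unfolding lin_ext_add lin_ext_smul lin_ext_basis psi_lift_linear attach_slices_linear
    by (intro mod_eq_add mod_eq_smul subspace_Stilde_null b step)
qed

lemma attach_middle_slice_mod_eq:
  "middle_slice n n' s i \<Longrightarrow> mod_eq (S_null n k) x y \<Longrightarrow>
    mod_eq (S_null n' k) (attach_slices [(s, k + i)] x) (attach_slices [(s, k + i)] y)"
  using S_null_middle_slice[of n n' s i "x - y" k] by (simp add: mod_eq_def attach_slices_linear)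

text \<open>Both sides obey the same recursion in n. The image of \<open>phi\<close> is needed
  directly only when all arcs are dotted; the other cases rest on isotopy, the circle value and the
  induction hypothesis.\<close>

lemma cup_cap_psi:
  assumes "b \<in> B_diagrams n k" "i \<in> {1..<2 * n}"
  shows "mod_eq (S_null n k) (attach_slices [(Cup, k + i), (Cap, k + i)] (psi_lift n k (basis b)))
    (psi_lift n k (tl_gen i b))"
  using assms
proof (induction n arbitrary: b i)
  case (Suc n b i)
  note S = subspace_S_null[of "Suc n" k]
  note [trans] = mod_eq_trans[OF S]
  have cup: "middle_slice n (Suc n) Cup i" and cap: "middle_slice (Suc n) n Cap i"
    using Suc.prems(2) by (auto simp: middle_slice_def)
  obtain A D where b: "b = (A, D)" by (cases b)
  from Suc.prems(1)[unfolded b] show ?case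
  proof (cases rule: B_diagrams_cases)
    case all_dotted
    have p: "pairing (2 * Suc n) A" using Suc.prems(1) by (simp only: b B_diagrams_iff)
    have "dotted A i" "dotted A (Suc i)"
      unfolding dotted_def using Suc.prems(2) by (auto intro!: pairing_ex[OF p])
    then have "tl_gen i b = 0" using all_dotted by (simp add: b tl_gen_def)
    \<comment> \<open>Here k = n + 1, so after the maximum only 2 n middle points remain, fewer than
      the projectors have together.\<close>
    moreover have "basis ((Cap, k + i) # draw (strands (Suc n) k b)) \<in> S_null n k"
    proof (rule tangle_in_S_null)
      show "n < k" using all_dotted by simp
      show "tangle (2 * (n + k)) ((Cap, k + i) # draw (strands (Suc n) k b))"
        unfolding tangle_middle_slice[OF cap] by (rule tangle_draw_strands[OF Suc.prems(1)])
    qed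
    from S_null_middle_slice[OF cup this]
    have "attach_slices [(Cup, k + i), (Cap, k + i)] (psi_lift (Suc n) k (basis b)) \<in> S_null (Suc n) k"
      by (simp add: psi_lift_basis[OF Suc.prems(1)])
    ultimately show ?thesis by (simp add: mod_eq_def psi_lift_linear)
  next
    case (adjacent m j A0 D0)
    then have m [simp]: "m = n" by simp
    define b0 where b0': "b0 = (A0, D0)"
    have b0: "b0 \<in> B_diagrams n k" and j: "1 \<le> j" "j \<le> 2 * n + 1" and ins: "b = insert_diagram j b0"
      using adjacent by (simp_all add: b b0')
    have p0: "pairing (2 * n) A0" "D0 \<subseteq> A0" using b0 by (auto simp: b0' B_diagrams_iff)
    define W where "W = draw (strands n k b0)"
    have W: "tangle (2 * (n + k)) W" unfolding W_def by (rule tangle_draw_strands[OF b0])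
    have draw: "mod_eq (S_null (Suc n) k) (psi_lift (Suc n) k (basis (insert_diagram j b0))) (basis ((Cup, k + j) # W))"
      if j: "1 \<le> j" "j \<le> 2 * n + 1" for j
      using S_mod_eq[OF draw_insert_diagram[OF b0 j]] insert_diagram_B_iff[OF j] b0
      by (simp add: psi_lift_basis W_def)
    have "mod_eq (S_null (Suc n) k) (attach_slices [(Cup, k + i), (Cap, k + i)] (psi_lift (Suc n) k (basis b)))
      (attach_slices [(Cup, k + i), (Cap, k + i)] (basis ((Cup, k + j) # W)))"
      using attach_middle_slice_mod_eq[OF cup attach_middle_slice_mod_eq[OF cap draw[OF j]]]
      by (simp add: ins attach_slices_append)
    then have start: "mod_eq (S_null (Suc n) k) (attach_slices [(Cup, k + i), (Cap, k + i)] (psi_lift (Suc n) k (basis b)))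
      (basis ((Cup, k + i) # (Cap, k + i) # (Cup, k + j) # W))" by simp
    have t: "tangle (2 * (Suc n + k)) ((Cup, k + i) # (Cap, k + i) # (Cup, k + j) # W)"
      using W j Suc.prems(2) by (auto elim!: tangle_index)
    from Suc.prems(2) j show ?thesis
    proof (cases rule: adjacent_cases)
      case 1
      note start
      also have "mod_eq (S_null (Suc n) k) (basis ((Cup, k + i) # (Cap, k + i) # (Cup, k + j) # W))
        (smul (- qhalf 2 - qhalf (- 2)) (basis ((Cup, k + j) # W)))"
        using S_mod_eq[OF circle_mod_eq[of "Suc n" k "[(Cup, k + i)]" "k + i" W]] t 1 by simp
      also have "mod_eq (S_null (Suc n) k) (smul (- qhalf 2 - qhalf (- 2)) (basis ((Cup, k + j) # W)))
        (smul (- qhalf 2 - qhalf (- 2)) (psi_lift (Suc n) k (basis b)))"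
        unfolding ins by (rule mod_eq_smul[OF S mod_eq_sym[OF S draw[OF j]]])
      finally show ?thesis unfolding ins 1 tl_insert_same psi_lift_linear .
    next
      case 2
      note start
      also have "mod_eq (S_null (Suc n) k) (basis ((Cup, k + i) # (Cap, k + i) # (Cup, k + j) # W))
        (basis ((Cup, k + i) # W))"
        using S_mod_eq[OF zigzag_mod_eq(2)[of "Suc n" k "[(Cup, k + i)]" "k + j" W]] t 2 by simp
      also have "mod_eq (S_null (Suc n) k) \<dots> (psi_lift (Suc n) k (basis (insert_diagram i b0)))"
        by (rule mod_eq_sym[OF S draw]) (use 2 j in auto)
      finally show ?thesis
        using tl_insert_adjacent(1)[OF j(1) 2(2) p0] by (simp add: ins b0' 2)
    next
      case 3
      note start
      also have "mod_eq (S_null (Suc n) k) (basis ((Cup, k + i) # (Cap, k + i) # (Cup, k + j) # W))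
        (basis ((Cup, k + i) # W))"
        using S_mod_eq[OF zigzag_mod_eq(1)[of "Suc n" k "[(Cup, k + i)]" "k + i" W]] t 3 by auto
      also have "mod_eq (S_null (Suc n) k) \<dots> (psi_lift (Suc n) k (basis (insert_diagram i b0)))"
        by (rule mod_eq_sym[OF S draw]) (use 3 Suc.prems(2) in auto)
      finally show ?thesis
        using tl_insert_adjacent(2)[OF _ 3(2) p0] 3 Suc.prems(2) by (auto simp: ins b0')
    next
      case (4 i')
      let ?E = "(Cup, k + i') # (Cap, k + i') # W"
      have tE: "tangle (2 * (n + k)) ?E" using W 4(1) by (auto elim!: tangle_index)
      have cupj: "middle_slice n (Suc n) Cup j" using j by (auto simp: middle_slice_def)
      have tjE: "tangle (2 * (Suc n + k)) ((Cup, k + j) # ?E)"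
        unfolding tangle_middle_slice[OF cupj] by (rule tE)
      \<comment> \<open>Two exchanges bring the inserted minimum above U_i; the generator,
        renumbered to i', then acts on the smaller drawing \<open>W\<close>, to which the induction
        hypothesis applies.\<close>
      have slide: "mod_eq (S_null (Suc n) k) (basis ((Cup, k + i) # (Cap, k + i) # (Cup, k + j) # W))
        (basis ((Cup, k + j) # ?E))"
      proof (cases "i' < j")
        case False
        then have le: "k + j \<le> k + i'" and i: "k + i = k + i' + 2" using 4(2) by (auto simp: bump_def)
        have "tangle (2 * (Suc n + k)) ([] @ (Cup, k + j) # (Cup, k + i') # (Cap, k + i') # W)"
          using tjE by simp
        note step2 = S_mod_eq[OF distant_cup_mod_eq[OF this le]]
        have "tangle (2 * (Suc n + k)) ([(Cup, k + i)] @ (Cup, k + j) # (Cap, k + i') # W)"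
          using t tangle_append_iff[OF tangle_distant[OF le, of _ Cap W], of "2 * (Suc n + k)" "[(Cup, k + i)]"]
          unfolding i by (simp only: append_Cons append_Nil)
        note step1 = S_mod_eq[OF distant_cup_mod_eq[OF this le]]
        show ?thesis
          using mod_eq_trans[OF S step1[unfolded append_Cons append_Nil i] step2[unfolded append_Nil]]
          unfolding i .
      next
        case True
        then have i: "i = i'" and lt: "i' + 2 \<le> j" using 4(2,3) by (auto simp: bump_def)
        define p where "p = k + j - 2"
        have p: "k + i' \<le> p" "k + j = p + 2" using lt by (auto simp: p_def)
        have t': "tangle (2 * (Suc n + k)) ([(Cup, k + i')] @ (Cap, k + i') # (Cup, p + 2) # W)"
          using t unfolding i p(2) by simp
        note step1 = distant_cap_mod_eq[OF t' p(1)]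
        have "tangle (2 * (Suc n + k)) ([] @ (Cup, k + i') # (Cup, p) # (Cap, k + i') # W)"
          using step1(1) by simp
        note step2 = distant_cup_mod_eq[OF this p(1)]
        show ?thesis
          using mod_eq_trans[OF S S_mod_eq[OF step1(2)[unfolded append_Cons append_Nil]]
              mod_eq_sym[OF S S_mod_eq[OF step2[unfolded append_Nil]]]]
          unfolding i p(2) .
      qed
      note start
      also note slide
      also have "mod_eq (S_null (Suc n) k) (basis ((Cup, k + j) # ?E))
        (attach_slices [(Cup, k + j)] (psi_lift n k (tl_gen i' b0)))"
        using attach_middle_slice_mod_eq[OF cupj Suc.IH[OF b0 4(1)]]
        by (simp add: psi_lift_basis[OF b0] W_def)
      also have "mod_eq (S_null (Suc n) k) \<dots> (psi_lift (Suc n) k (lin_ext (\<lambda>b. basis (insert_diagram j b)) (tl_gen i' b0)))"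
        by (rule mod_eq_sym[OF S S_mod_eq[OF psi_lift_insert[OF j tl_Rbar[OF b0 4(1)]]]])
      finally show ?thesis
        using tl_insert_far[of j "2 * n" i' A0 D0] 4 j p0 by (simp add: ins b0')
    qed
  qed
qed simp

text \<open>The skein relation expands the attached crossing as q^(1/2) U_i + q^(-1/2), which is the
  form of \<open>braid_letter (i, True)\<close>.\<close>

lemma pos_psi:
  assumes i: "i \<in> {1..<2 * n}" and x: "x \<in> Rbar n k"
  shows "mod_eq (S_null n k) (attach_slices [(Pos, k + i)] (psi_lift n k x)) (psi_lift n k (braid_letter (i, True) x))"
  using x
proof (induction rule: Rbar_induct)
  case zero
  then show ?case
    by (simp add: psi_lift_linear attach_slices_linear braid_letter_def mod_eq_refl[OF subspace_S_null])
next
  case (step c b y)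
  note S = subspace_S_null[of n k]
  let ?W = "draw (strands n k b)"
  have "middle_slice n n Pos i" using i by (auto simp: middle_slice_def)
  from tangle_middle_slice[OF this] have "tangle (2 * (n + k)) ([] @ (Pos, k + i) # ?W)"
    using tangle_draw_strands[OF step(1)] by simp
  from S_mod_eq[OF pos_mod_eq[OF this]]
  have "mod_eq (S_null n k) (attach_slices [(Pos, k + i)] (psi_lift n k (basis b)))
      (smul (qhalf 1) (attach_slices [(Cup, k + i), (Cap, k + i)] (psi_lift n k (basis b))) +
       smul (qhalf (- 1)) (psi_lift n k (basis b)))"
    by (simp add: psi_lift_basis[OF step(1)])
  then have "mod_eq (S_null n k) (attach_slices [(Pos, k + i)] (psi_lift n k (basis b)))
      (smul (qhalf 1) (psi_lift n k (tl_gen i b)) + smul (qhalf (- 1)) (psi_lift n k (basis b)))"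
    by (rule mod_eq_trans[OF S])
      (intro mod_eq_add mod_eq_smul S cup_cap_psi[OF step(1) i] mod_eq_refl)
  then have b: "mod_eq (S_null n k) (attach_slices [(Pos, k + i)] (psi_lift n k (basis b)))
      (psi_lift n k (braid_letter (i, True) (basis b)))"
    by (simp add: braid_letter_def psi_lift_linear add.commute)
  show ?case
    unfolding psi_lift_linear attach_slices_linear braid_letter_linear
    by (intro mod_eq_add mod_eq_smul S b step)
qed

lemma neg_pos_mod_eq:
  assumes i: "i \<in> {1..<2 * n}" and x: "x \<in> Rbar n k"
  shows "mod_eq (S_null n k) (attach_slices [(Neg, k + i), (Pos, k + i)] (psi_lift n k x)) (psi_lift n k x)"
  using x
proof (induction rule: Rbar_induct)
  case zero
  then show ?case
    by (simp add: psi_lift_linear attach_slices_linear mod_eq_refl[OF subspace_S_null])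
next
  case (step c b y)
  let ?W = "draw (strands n k b)"
  have s: "middle_slice n n Pos i" "middle_slice n n Neg i" using i by (auto simp: middle_slice_def)
  have W: "tangle (2 * (n + k)) ?W" by (rule tangle_draw_strands[OF step(1)])
  have "tangle (2 * (n + k)) ((Neg, k + i) # (Pos, k + i) # ?W)"
    unfolding tangle_middle_slice[OF s(1)] tangle_middle_slice[OF s(2)] by (rule W)
  then have b: "mod_eq (S_null n k) (attach_slices [(Neg, k + i), (Pos, k + i)] (psi_lift n k (basis b)))
      (psi_lift n k (basis b))"
    using S_mod_eq[OF isotopy_mod_eq[OF isotopy_move.R2', of n k "[]" "k + i" ?W]] W
    by (simp add: psi_lift_basis[OF step(1)])
  show ?case
    unfolding psi_lift_linear attach_slices_linear
    by (intro mod_eq_add mod_eq_smul subspace_S_null b step)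
qed

section \<open>Equivariance for braid words and arbitrary actions\<close>

definition braid_slices :: "nat \<Rightarrow> braid_word \<Rightarrow> tangle" where
  "braid_slices k = map (\<lambda>(i, s). (if s then Pos else Neg, k + i))"

lemma attach_eq: "attach k \<beta> = attach_slices (braid_slices k \<beta>)"
  by (simp add: attach_def attach_slices_def braid_slices_def)

lemma braid_slices_Cons: "braid_slices k ((i, s) # \<beta>) = (if s then Pos else Neg, k + i) # braid_slices k \<beta>"
  by (simp add: braid_slices_def)

lemma braid_words_Cons_iff: "(i, s) # \<beta> \<in> braid_words N \<longleftrightarrow> i \<in> {1..<N} \<and> \<beta> \<in> braid_words N"
  by (auto simp: braid_words_def)

lemma middle_slice_crossing: "i \<in> {1..<2 * n} \<Longrightarrow> middle_slice n n (if s then Pos else Neg) i"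
  by (auto simp: middle_slice_def)

lemma attach_S_null:
  "\<beta> \<in> braid_words (2 * n) \<Longrightarrow> x \<in> S_null n k \<Longrightarrow> attach k \<beta> x \<in> S_null n k"
proof (induction \<beta>)
  case Nil
  then show ?case by (simp add: attach_eq braid_slices_def)
next
  case (Cons l \<beta>)
  obtain i s where l: "l = (i, s)" by (cases l)
  have i: "i \<in> {1..<2 * n}" and \<beta>: "\<beta> \<in> braid_words (2 * n)" using Cons.prems(1) by (simp_all add: l braid_words_Cons_iff)
  have "attach k (l # \<beta>) x = attach_slices [(if s then Pos else Neg, k + i)] (attach k \<beta> x)"
    by (simp add: attach_eq l braid_slices_Cons attach_slices_append)
  then show ?case
    using S_null_middle_slice[OF middle_slice_crossing[OF i] Cons.IH[OF \<beta> Cons.prems(2)]] by simp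
qed

context
  fixes n k :: nat and \<rho>
  assumes \<rho>: "is_Rbar_action n k \<rho>"
begin

lemma group_action_Rbar: "group_action (braid_group (2 * n)) (Rbar n k) \<rho>"
  using \<rho> unfolding is_Rbar_action_def by (elim conjE)

lemma action_Rbar: "g \<in> carrier (braid_group (2 * n)) \<Longrightarrow> x \<in> Rbar n k \<Longrightarrow> \<rho> g x \<in> Rbar n k"
  by (rule group_action.element_image[OF group_action_Rbar _ _ HOL.refl])

lemma action_append:
  assumes "u \<in> braid_words (2 * n)" "v \<in> braid_words (2 * n)" "x \<in> Rbar n k"
  shows "\<rho> (braid_class (2 * n) (u @ v)) x = \<rho> (braid_class (2 * n) u) (\<rho> (braid_class (2 * n) v) x)"
proof -
  from group_action.composition_rule[OF group_action_Rbar assms(3) braid_class_carrier[OF assms(1)] braid_class_carrier[OF assms(2)]]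
  show ?thesis by (simp only: braid_mult[OF assms(1,2)])
qed

lemma action_Nil:
  assumes "x \<in> Rbar n k"
  shows "\<rho> (braid_class (2 * n) []) x = x"
proof -
  from group_action.id_eq_one[OF group_action_Rbar] have "restrict (\<lambda>x. x) (Rbar n k) = \<rho> (braid_class (2 * n) [])"
    by (simp add: braid_one)
  then show ?thesis using assms by (metis restrict_apply')
qed

text \<open>Additivity and homogeneity extend the prescribed values from basis diagrams to
  \<open>Rbar\<close>, so every admissible action agrees with the constructed one on positive
  letters.\<close>

lemma action_letter:
  assumes i: "i \<in> {1..<2 * n}" and x: "x \<in> Rbar n k"
  shows "\<rho> (braid_class (2 * n) [(i, True)]) x = braid_letter (i, True) x"
proof -
  have c: "sigma (2 * n) i \<in> carrier (braid_group (2 * n))"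
    unfolding sigma_def using i by (intro braid_class_carrier) (simp add: braid_words_def)
  have add: "\<rho> (sigma (2 * n) i) (x + y) = \<rho> (sigma (2 * n) i) x + \<rho> (sigma (2 * n) i) y"
    and scale: "\<rho> (sigma (2 * n) i) (smul c x) = smul c (\<rho> (sigma (2 * n) i) x)"
    if "x \<in> Rbar n k" "y \<in> Rbar n k" for x y c
    using \<rho> c that unfolding is_Rbar_action_def by blast+
  have gen: "\<rho> (sigma (2 * n) i) (basis b) = braid_letter (i, True) (basis b)" if "b \<in> B_diagrams n k" for b
  proof -
    obtain A D where b: "b = (A, D)" by (cases b)
    have "pairing (2 * n) A" "D \<subseteq> A" using that by (auto simp: b B_diagrams_iff)
    moreover have "\<rho> (sigma (2 * n) i) (basis b) = sigma_formula i b"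
      using \<rho> i that unfolding is_Rbar_action_def by blast
    ultimately show ?thesis by (simp add: b sigma_formula_tl braid_letter_def)
  qed
  have "\<rho> (sigma (2 * n) i) x = braid_letter (i, True) x"
    using x
  proof (induction rule: Rbar_induct)
    case zero
    have "0 \<in> Rbar n k" by (rule lmod.subspace_0[OF subspace_Rbar])
    then show ?case using scale[of 0 0 0] by (simp add: braid_letter_def)
  next
    case (step c b y)
    have "basis b \<in> Rbar n k" "smul c (basis b) \<in> Rbar n k"
      using step(1) lmod.subspace_scale[OF subspace_Rbar] by simp_all
    then show ?case using step by (simp add: add scale gen braid_letter_linear)
  qed
  then show ?thesis by (simp add: sigma_def)
qed

lemma attach_psi:
  "\<beta> \<in> braid_words (2 * n) \<Longrightarrow> x \<in> Rbar n k \<Longrightarrow>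
    mod_eq (S_null n k) (attach k \<beta> (psi_lift n k x)) (psi_lift n k (\<rho> (braid_class (2 * n) \<beta>) x))"
proof (induction \<beta>)
  case Nil
  then show ?case by (simp add: attach_eq braid_slices_def action_Nil mod_eq_refl[OF subspace_S_null])
next
  case (Cons l \<beta>)
  note S = subspace_S_null[of n k]
  obtain i s where l: "l = (i, s)" by (cases l)
  have i: "i \<in> {1..<2 * n}" and \<beta>: "\<beta> \<in> braid_words (2 * n)" using Cons.prems(1) by (simp_all add: l braid_words_Cons_iff)
  have letters: "[(i, s)] \<in> braid_words (2 * n)" for s using i by (simp add: braid_words_def)
  define y where "y = \<rho> (braid_class (2 * n) \<beta>) x"
  have y: "y \<in> Rbar n k" unfolding y_def by (rule action_Rbar[OF braid_class_carrier[OF \<beta>] Cons.prems(2)])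
  have split: "\<rho> (braid_class (2 * n) (l # \<beta>)) x = \<rho> (braid_class (2 * n) [(i, s)]) y"
    using action_append[OF letters \<beta> Cons.prems(2), of s] by (simp add: l y_def)
  have "mod_eq (S_null n k) (attach k (l # \<beta>) (psi_lift n k x))
      (attach_slices [(if s then Pos else Neg, k + i)] (psi_lift n k y))"
    using attach_middle_slice_mod_eq[OF middle_slice_crossing[OF i, of s] Cons.IH[OF \<beta> Cons.prems(2)]]
    by (simp add: attach_eq l braid_slices_Cons attach_slices_append y_def)
  also have "mod_eq (S_null n k) \<dots> (psi_lift n k (\<rho> (braid_class (2 * n) [(i, s)]) y))"
  proof (cases s)
    case True
    then show ?thesis using pos_psi[OF i y] action_letter[OF i y] by simp
  next
    case False
    \<comment> \<open>With z the image of y under the inverse letter, y is the image of z under the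
      positive letter. Attaching \<open>Pos\<close> to the tangle of z thus gives that of y, and a
      further \<open>Neg\<close> cancels the crossing by the second Reidemeister move.\<close>
    define z where "z = \<rho> (braid_class (2 * n) [(i, False)]) y"
    have z: "z \<in> Rbar n k" unfolding z_def by (rule action_Rbar[OF braid_class_carrier[OF letters] y])
    have "braid_class (2 * n) [(i, True), (i, False)] = braid_class (2 * n) []"
      using braid_eq.inverse[OF i, of True] braid_eq_words by (subst braid_class_eq_iff) (fastforce)+
    then have "braid_letter (i, True) z = y"
      using action_append[OF letters letters y, of True False] action_letter[OF i z] action_Nil[OF y]
      by (simp add: z_def)
    then have "mod_eq (S_null n k) (psi_lift n k y) (attach_slices [(Pos, k + i)] (psi_lift n k z))"
      using mod_eq_sym[OF S pos_psi[OF i z]] by simp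
    from attach_middle_slice_mod_eq[OF middle_slice_crossing[OF i, of False] this]
    have "mod_eq (S_null n k) (attach_slices [(Neg, k + i)] (psi_lift n k y))
      (attach_slices [(Neg, k + i), (Pos, k + i)] (psi_lift n k z))"
      by (simp add: attach_slices_append)
    then show ?thesis
      using mod_eq_trans[OF S _ neg_pos_mod_eq[OF i z]] False by (simp add: z_def)
  qed
  finally (mod_eq_trans[OF S]) show ?case unfolding split .
qed

end

lemma S_proj_psi: "S_proj n k (psi_tilde n k x) = psi_lift n k x +o S_null n k"
proof (intro equalityI subsetI)
  fix z assume "z \<in> S_proj n k (psi_tilde n k x)"
  then obtain s t where "s \<in> Stilde_null n k" "t \<in> S_null n k" "z = psi_lift n k x + (s + t)"
    by (auto simp: S_proj_def psi_tilde_def psi_lift_def set_plus_def elt_set_plus_def add.assoc)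
  moreover from this have "s + t \<in> S_null n k"
    using Stilde_null_subset lmod.subspace_add[OF subspace_S_null] by blast
  ultimately show "z \<in> psi_lift n k x +o S_null n k" unfolding elt_set_plus_def by blast
next
  fix z assume "z \<in> psi_lift n k x +o S_null n k"
  then obtain t where t: "t \<in> S_null n k" "z = (psi_lift n k x + 0) + t" by (auto simp: elt_set_plus_def)
  moreover have "psi_lift n k x + 0 \<in> psi_tilde n k x"
    unfolding psi_tilde_def psi_lift_def elt_set_plus_def
    using lmod.subspace_0[OF subspace_Stilde_null] by blast
  ultimately show "z \<in> S_proj n k (psi_tilde n k x)" unfolding S_proj_def by (blast intro: set_plus_intro)
qed

theorem proposition4p5p2:
  fixes n k :: nat
  assumes "k \<le> n"
  shows "(\<exists>\<rho>. is_Rbar_action n k \<rho>) \<and>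
    (\<forall>\<rho>. is_Rbar_action n k \<rho> \<longrightarrow>
      (\<forall>x\<in>Rbar n k. S_proj n k (psi_tilde n k x) \<in> S_space n k) \<and>
      (\<forall>g\<in>carrier (braid_group (2 * n)). \<forall>x\<in>Rbar n k.
        S_proj n k (psi_tilde n k (\<rho> g x)) = S_act n k g (S_proj n k (psi_tilde n k x))))"
proof (intro conjI allI impI ballI)
  show "\<exists>\<rho>. is_Rbar_action n k \<rho>" by (rule ex_Rbar_action)
next
  fix x assume "x \<in> Rbar n k"
  then show "S_proj n k (psi_tilde n k x) \<in> S_space n k"
    unfolding S_proj_psi S_space_def by (intro imageI psi_lift_tangle_span)
next
  fix \<rho> g x
  assume \<rho>: "is_Rbar_action n k \<rho>" and g: "g \<in> carrier (braid_group (2 * n))" and x: "x \<in> Rbar n k"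
  note S = subspace_S_null[of n k]
  obtain w where w: "w \<in> braid_words (2 * n)" "g = braid_class (2 * n) w"
    using g by (rule carrier_braid_groupE)
  \<comment> \<open>\<open>S_act\<close> is a union over all representatives of the braid and of the
    coset; each of them contributes the same coset.\<close>
  have coset: "attach k \<beta> y +o S_null n k = psi_lift n k (\<rho> g x) +o S_null n k"
    if \<beta>: "\<beta> \<in> g" and y: "y \<in> psi_lift n k x +o S_null n k" for \<beta> y
  proof (rule mod_eq_coset[OF S])
    have eq: "braid_eq (2 * n) w \<beta>" using \<beta> unfolding w(2) mem_braid_class .
    then have \<beta>': "\<beta> \<in> braid_words (2 * n)" using braid_eq_words by blast
    have g\<beta>: "g = braid_class (2 * n) \<beta>" using eq w \<beta>' by (simp add: braid_class_eq_iff)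
    obtain t where t: "t \<in> S_null n k" "y = psi_lift n k x + t" using y by (auto simp: elt_set_plus_def)
    have "attach k \<beta> y - attach k \<beta> (psi_lift n k x) = attach k \<beta> t"
      by (simp add: t(2) attach_eq attach_slices_linear)
    then have "mod_eq (S_null n k) (attach k \<beta> y) (attach k \<beta> (psi_lift n k x))"
      using attach_S_null[OF \<beta>' t(1)] by (simp add: mod_eq_def)
    from mod_eq_trans[OF S this attach_psi[OF \<rho> \<beta>' x]]
    show "mod_eq (S_null n k) (attach k \<beta> y) (psi_lift n k (\<rho> g x))" by (simp only: g\<beta>)
  qed
  have "w \<in> g" unfolding w(2) mem_braid_class by (rule braid_eq.refl[OF w(1)])
  moreover have "psi_lift n k x + 0 \<in> psi_lift n k x +o S_null n k"
    using lmod.subspace_0[OF S] unfolding elt_set_plus_def by blast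
  ultimately show "S_proj n k (psi_tilde n k (\<rho> g x)) = S_act n k g (S_proj n k (psi_tilde n k x))"
    unfolding S_proj_psi S_act_def using coset by blast
qed

end
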